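(* Let $A_0$ be a $d\times d$ expansive integral matrix with $\det A_0=\pm2$. Let $S$ be a $d\times d$ integral matrix with $\det S=\pm1$ and $A$ an integral matrix with $A_0=S^{-1}AS$, such that $A\mathbb{Z}^d=A^\tau\mathbb{Z}^d$ and there are $\vec\ell_A,\vec q_A\in\mathbb{Z}^d$ with: $\mathbb{Z}^d=(\vec\ell_A+A\mathbb{Z}^d)\dot\cup A\mathbb{Z}^d$; $\vec q_A\circ A\mathbb{Z}^d\subseteq2\mathbb{Z}$ and $\vec q_A\circ(\vec\ell_A+A\mathbb{Z}^d)\subseteq2\mathbb{Z}+1$; for $\vec m\in A\mathbb{Z}^d$, $\vec n\in\mathbb{Z}^d$: $\mathbb{Z}^d=(\vec n-A\mathbb{Z}^d)\dot\cup(\vec\ell_A-\vec m-\vec n+A\mathbb{Z}^d)$; for $\vec m\in\vec\ell_A+A\mathbb{Z}^d$, $\vec n\in\mathbb{Z}^d$: $\vec n-A\mathbb{Z}^d=\vec\ell_A-\vec m-\vec n+A\mathbb{Z}^d$. Let $\{h_{\vec n}\}$ be a finite solution, supported in $\Lambda_0=\mathbb{Z}^d\cap[-N_0,N_0]^d$, of $\sum_{\vec n}h_{\vec n}\overline{h_{\vec n+\vec k}}=\delta_{\vec0,\vec k}$ ($\vec k\in A\mathbb{Z}^d$), $\sum_{\vec n}h_{\vec n}=\sqrt2$. Let $m_0(\vec t)=\frac1{\sqrt2}\sum_{\vec n\in\Lambda_0}h_{\vec n}e^{-i\vec n\circ\vec t}$, $\varphi_A=\mathcal F^{-1}g$ with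 $g(\vec\xi)=(2\pi)^{-d/2}\prod_{j\ge1}m_0((A^\tau)^{-j}\vec\xi)$, and $\psi_A=\sum_{\vec n\in\mathbb{Z}^d}(-1)^{\vec q_A\circ\vec n}\overline{h_{\vec\ell_A-\vec n}}D_AT_{\vec n}\varphi_A$. Define $\varphi_{A_0}(\vec t)=\varphi_A(S\vec t)$ and $\psi_{A_0}(\vec t)=\psi_A(S\vec t)$. Then: (1) $\psi_{A_0}$ is a Parseval's frame wavelet associated with $A_0$; (2) $\varphi_{A_0}=\sum_{\vec n\in\Lambda_0}h_{\vec n}D_{A_0}T_{S^{-1}\vec n}\varphi_{A_0}$ and $\psi_{A_0}=\sum_{\vec n:\,\vec\ell_A-\vec n\in\Lambda_0}(-1)^{\vec q_A\circ\vec n}\overline{h_{\vec\ell_A-\vec n}}D_{A_0}T_{S^{-1}\vec n}\varphi_{A_0}$; (3) $V^{(n)}_{A_0}(\varphi_{A_0})\subset V^{(n+1)}_{A_0}(\varphi_{A_0})$ for all $n\in\mathbb{Z}$; (4) $\overline{\bigcup_{n\in\mathbb{Z}}V^{(n)}_{A_0}(\varphi_{A_0})}=L^2(\mathbb{R}^d)$.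
   Context: $\vec x\circ\vec y=\sum_j x_j\overline{y_j}$; $A^\tau$ is the transpose; a matrix is expansive if all eigenvalues have modulus $>1$. $(T_{\vec\ell}f)(\vec t)=f(\vec t-\vec\ell)$; for an integral matrix $B$ with $|\det B|=2$, $(D_Bf)(\vec t)=\sqrt2 f(B\vec t)$. Fourier transform $(\mathcal Ff)(\vec s)=(2\pi)^{-d/2}\int e^{-i\vec s\circ\vec t}f(\vec t)d\vec t$ extended unitarily to $L^2(\mathbb{R}^d)$. $\psi$ is a Parseval's frame wavelet associated with $B$ if $\sum_{n\in\mathbb{Z},\vec\ell\in\mathbb{Z}^d}|\langle f,D_B^nT_{\vec\ell}\psi\rangle|^2=\|f\|^2$ for all $f\in L^2(\mathbb{R}^d)$. For $f\in L^2(\mathbb{R}^d)$: $V^{(0)}_B(f)=\overline{\mathrm{span}}\{T_{\vec\ell}f:\vec\ell\in\mathbb{Z}^d\}$ and $V^{(n)}_B(f)=D_B^nV^{(0)}_B(f)$, $n\in\mathbb{Z}$. (The matrix $A$, being similar to $A_0$, is expansive with $|\det A|=2$.) *)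

theory Defs
  imports "HOL-Analysis.Analysis"
begin

section \<open>Lattice, integral matrices, expansive matrices\<close>

definition Zd :: "(real^'d::finite) set" where
  "Zd = {v. \<forall>i. v $ i \<in> \<int>}"

definition integral_matrix :: "real^'d^'d \<Rightarrow> bool" where
  "integral_matrix B \<longleftrightarrow> (\<forall>i j. B $ i $ j \<in> \<int>)"

text \<open>Eigenvalues are taken over the complex numbers.\<close>
definition expansive :: "real^'d^'d \<Rightarrow> bool" where
  "expansive B \<longleftrightarrow> (\<forall>c::complex. (\<exists>v::complex^'d. v \<noteq> 0 \<and>
      map_matrix complex_of_real B *v v = c *s v) \<longrightarrow> 1 < cmod c)"

definition mat_pow :: "real^'d^'d \<Rightarrow> nat \<Rightarrow> real^'d^'d" where
  "mat_pow B k = (((**) B) ^^ k) (mat 1)"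

section \<open>Translation and dilation operators\<close>

definition transl :: "real^'d \<Rightarrow> (real^'d \<Rightarrow> complex) \<Rightarrow> (real^'d \<Rightarrow> complex)" where
  "transl l f = (\<lambda>t. f (t - l))"

definition dil :: "real^'d^'d \<Rightarrow> (real^'d \<Rightarrow> complex) \<Rightarrow> (real^'d \<Rightarrow> complex)" where
  "dil B f = (\<lambda>t. complex_of_real (sqrt 2) * f (B *v t))"

text \<open>The inverse operator of \<open>dil B\<close>.\<close>
definition dil_inv :: "real^'d^'d \<Rightarrow> (real^'d \<Rightarrow> complex) \<Rightarrow> (real^'d \<Rightarrow> complex)" where
  "dil_inv B f = (\<lambda>t. f (matrix_inv B *v t) / complex_of_real (sqrt 2))"

definition dil_pow :: "real^'d^'d \<Rightarrow> int \<Rightarrow> (real^'d \<Rightarrow> complex) \<Rightarrow> (real^'d \<Rightarrow> complex)" where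
  "dil_pow B n = (if 0 \<le> n then dil B ^^ nat n else dil_inv B ^^ nat (- n))"

section \<open>L^2(R^d)\<close>

definition square_integrable :: "(real^'d::finite \<Rightarrow> complex) \<Rightarrow> bool" where
  "square_integrable f \<longleftrightarrow> f \<in> borel_measurable lebesgue \<and>
     integrable lebesgue (\<lambda>x. (cmod (f x))\<^sup>2)"

definition L2_inner :: "(real^'d::finite \<Rightarrow> complex) \<Rightarrow> (real^'d \<Rightarrow> complex) \<Rightarrow> complex" where
  "L2_inner f g = (LINT x|lebesgue. f x * cnj (g x))"

definition L2_norm_sq :: "(real^'d::finite \<Rightarrow> complex) \<Rightarrow> real" where
  "L2_norm_sq f = (LINT x|lebesgue. (cmod (f x))\<^sup>2)"

text \<open>Squared L^2 distance, valued in ennreal (infinite if the difference is not in L^2).\<close>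
definition L2_dist_sq :: "(real^'d::finite \<Rightarrow> complex) \<Rightarrow> (real^'d \<Rightarrow> complex) \<Rightarrow> ennreal" where
  "L2_dist_sq f g = (\<integral>\<^sup>+ x. ennreal ((cmod (f x - g x))\<^sup>2) \<partial>lebesgue)"

text \<open>Closure in L^2 of a set of functions (functions, not a.e.-classes).\<close>
definition L2_closure :: "(real^'d::finite \<Rightarrow> complex) set \<Rightarrow> (real^'d \<Rightarrow> complex) set" where
  "L2_closure X = {g. square_integrable g \<and> (\<forall>\<epsilon>>0. \<exists>x\<in>X. L2_dist_sq g x < ennreal \<epsilon>)}"

section \<open>Fourier transform\<close>

definition cube :: "real \<Rightarrow> (real^'d::finite) set" where
  "cube R = {s. \<forall>i. \<bar>s $ i\<bar> \<le> R}"

text \<open>Inverse Fourier integral for integrable functions.\<close>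
definition inv_fourier_int :: "(real^'d::finite \<Rightarrow> complex) \<Rightarrow> (real^'d \<Rightarrow> complex)" where
  "inv_fourier_int g = (\<lambda>t. complex_of_real ((2 * pi) powr (- real CARD('d) / 2)) *
      (LINT s|lebesgue. exp (\<i> * complex_of_real (s \<bullet> t)) * g s))"

text \<open>Inverse of the unitary (Plancherel) Fourier transform on L^2: the L^2-limit of the
  inverse Fourier integrals of the truncations of g to the cubes [-R,R]^d.\<close>
definition inv_fourier_L2 :: "(real^'d::finite \<Rightarrow> complex) \<Rightarrow> (real^'d \<Rightarrow> complex)" where
  "inv_fourier_L2 g = (SOME \<phi>. square_integrable \<phi> \<and>
      ((\<lambda>R::real. L2_dist_sq \<phi> (inv_fourier_int (\<lambda>s. indicator (cube R) s * g s))) \<longlongrightarrow> 0) at_top)"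

section \<open>Frames and MRA spaces\<close>

definition parseval_frame_wavelet :: "real^'d^'d \<Rightarrow> (real^'d::finite \<Rightarrow> complex) \<Rightarrow> bool" where
  "parseval_frame_wavelet B \<psi> \<longleftrightarrow> square_integrable \<psi> \<and>
     (\<forall>f. square_integrable f \<longrightarrow>
        ((\<lambda>(n::int, l). (cmod (L2_inner f (dil_pow B n (transl l \<psi>))))\<^sup>2) has_sum L2_norm_sq f)
          (UNIV \<times> Zd))"

definition V0 :: "(real^'d::finite \<Rightarrow> complex) \<Rightarrow> (real^'d \<Rightarrow> complex) set" where
  "V0 f = L2_closure {(\<lambda>t. \<Sum>l\<in>F. c l * transl l f t) | F c. finite F \<and> F \<subseteq> Zd}"

definition Vn :: "real^'d^'d \<Rightarrow> int \<Rightarrow> (real^'d::finite \<Rightarrow> complex) \<Rightarrow> (real^'d \<Rightarrow> complex) set" where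
  "Vn B n f = dil_pow B n ` V0 f"

section \<open>The construction\<close>

definition Lambda0 :: "nat \<Rightarrow> (real^'d::finite) set" where
  "Lambda0 N0 = {n \<in> Zd. \<forall>i. \<bar>n $ i\<bar> \<le> real N0}"

definition m0 :: "nat \<Rightarrow> (real^'d::finite \<Rightarrow> complex) \<Rightarrow> real^'d \<Rightarrow> complex" where
  "m0 N0 h t = (1 / complex_of_real (sqrt 2)) *
     (\<Sum>n\<in>Lambda0 N0. h n * exp (- \<i> * complex_of_real (n \<bullet> t)))"

definition g_fun :: "nat \<Rightarrow> (real^'d::finite \<Rightarrow> complex) \<Rightarrow> real^'d^'d \<Rightarrow> real^'d \<Rightarrow> complex" where
  "g_fun N0 h A \<xi> = complex_of_real ((2 * pi) powr (- real CARD('d) / 2)) *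
     (\<Prod>j. m0 N0 h (mat_pow (matrix_inv (transpose A)) (Suc j) *v \<xi>))"

definition phi_A :: "nat \<Rightarrow> (real^'d::finite \<Rightarrow> complex) \<Rightarrow> real^'d^'d \<Rightarrow> real^'d \<Rightarrow> complex" where
  "phi_A N0 h A = inv_fourier_L2 (g_fun N0 h A)"

definition psi_A :: "nat \<Rightarrow> (real^'d::finite \<Rightarrow> complex) \<Rightarrow> real^'d^'d \<Rightarrow> real^'d \<Rightarrow> real^'d
    \<Rightarrow> real^'d \<Rightarrow> complex" where
  "psi_A N0 h A lA qA = (\<lambda>t. \<Sum>\<^sub>\<infinity>n\<in>Zd. (-1) powi \<lfloor>qA \<bullet> n\<rfloor> * cnj (h (lA - n)) *
      dil A (transl n (phi_A N0 h A)) t)"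

end

theory Submission
  imports
    Defs
    "HOL-Computational_Algebra.Fundamental_Theorem_Algebra"
    "HOL-Probability.Characteristic_Functions"
begin

text \<open>
  The product defining \<open>g\<close> is the pointwise limit of partial products, which are the Fourier transforms
  of the discrete cascade measures \<open>\<mu>\<^sub>k = \<Sum>\<^sub>m w\<^sub>k(m) \<delta>(A\<^bsup>-k\<^esup> m)\<close>. The orthogonality of \<open>h\<close> gives
  \<open>\<Sum>\<^sub>m |w\<^sub>k(m)|\<^sup>2 = 2\<^bsup>-k\<^esup>\<close>. Hence \<open>g\<close> is square integrable by Fatou's lemma, and the total variations of the
  \<open>\<mu>\<^sub>k\<close> are uniformly bounded because \<open>\<mu>\<^sub>k\<close> has at most \<open>O(2\<^sup>k)\<close> atoms. Thus \<open>\<phi> = \<F>\<^sup>-\<^sup>1 g\<close> is the weak limit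
  of the \<open>\<mu>\<^sub>k\<close>, first against Gaussians and then against continuous functions of compact support. It
  therefore has compact support and integral one, and it satisfies the refinement equation.

  From there on all arguments take place in the time domain. The conditions on \<open>\<ell>\<^sub>A\<close> and \<open>q\<^sub>A\<close> say that
  the masks of \<open>\<phi>\<close> and \<open>\<psi>\<close> form a perfect reconstruction filter bank, so the energies
  \<open>e\<^sub>n(f) = \<Sum>\<^sub>l |\<langle>f, D\<^sup>n T\<^sub>l \<phi>\<rangle>|\<^sup>2\<close> satisfy \<open>e\<^sub>n\<^sub>+\<^sub>1(f) = e\<^sub>n(f) + \<Sum>\<^sub>l |\<langle>f, D\<^sup>n T\<^sub>l \<psi>\<rangle>|\<^sup>2\<close>. For continuous \<open>f\<close> of
  compact support, \<open>e\<^sub>n(f)\<close> is a Riemann sum tending to \<open>\<parallel>f\<parallel>\<^sup>2\<close> as \<open>n \<rightarrow> \<infinity>\<close>, and it tends to 0 as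
  \<open>n \<rightarrow> -\<infinity>\<close>. Telescoping yields the Parseval identity for \<open>A\<close> on a dense class, and the same limit
  yields the density of the spaces \<open>V\<^sup>(\<^sup>n\<^sup>)\<close>. Finally \<open>f \<mapsto> f \<circ> S\<close> carries everything from \<open>A\<close> to \<open>A\<^sub>0\<close>,
  because \<open>S\<close> is unimodular.
\<close>

section \<open>Linear changes of variables\<close>

text \<open>
  The library proves the determinant formula for \<open>wellorder\<close> index types only; elementary matrices reach
  every finite index type.
\<close>

definition scales_measure :: "real^'n::finite^'n \<Rightarrow> bool" where
  "scales_measure M \<longleftrightarrow> (\<forall>S\<in>lmeasurable. (*v) M ` S \<in> lmeasurable \<and>
     measure lebesgue ((*v) M ` S) = \<bar>det M\<bar> * measure lebesgue S)"

lemma scales_measure_mult: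
  assumes "scales_measure A" "scales_measure B"
  shows "scales_measure (A ** B)"
proof -
  have "(*v) (A ** B) ` S = (*v) A ` ((*v) B ` S)" for S
    by (simp add: image_image matrix_vector_mul_assoc)
  then show ?thesis
    using assms by (simp add: scales_measure_def det_mul abs_mult)
qed

lemma scales_measure_singular:
  assumes "det M = 0"
  shows "scales_measure M"
proof -
  have "negligible ((*v) M ` S)" for S
    using assms det_nz_iff_inj_gen[of "(*v) M"]
    by (intro negligible_linear_singular_image) (auto simp: matrix_vector_mul_linear_gen)
  then show ?thesis
    using assms by (simp add: scales_measure_def negligible_iff_measure)
qed

lemma scales_measure_diagonal:
  assumes "\<And>i j. i \<noteq> j \<Longrightarrow> M $ i $ j = 0"
  shows "scales_measure M"
proof -
  have "(\<Sum>j\<in>UNIV. M $ i $ j * x $ j) = M $ i $ i * x $ i" for i x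
    using sum.mono_neutral_right[of UNIV "{i}" "\<lambda>j. M $ i $ j * x $ j"] assms by simp
  then have "(*v) M = (\<lambda>x. \<chi> i. M $ i $ i * x $ i)"
    by (simp add: fun_eq_iff matrix_vector_mult_def)
  then show ?thesis
    using det_diagonal[of M] assms by (simp add: scales_measure_def measurable_stretch measure_stretch)
qed

lemma scales_measure_unimodularI:
  fixes M :: "real^'n::finite^'n"
  assumes "\<bar>det M\<bar> = 1"
    and "\<And>a b. measure lebesgue ((*v) M ` cbox a b) = measure lebesgue (cbox a b)"
  shows "scales_measure M"
  unfolding scales_measure_def assms(1)
proof
  fix S :: "(real^'n) set" assume "S \<in> lmeasurable"
  from measure_linear_sufficient[OF matrix_vector_mul_linear this, of M 1] assms(2)
  show "(*v) M ` S \<in> lmeasurable \<and> measure lebesgue ((*v) M ` S) = 1 * measure lebesgue S"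
    by simp
qed

lemma scales_measure_transposition:
  fixes m n :: "'n::finite"
  defines "M \<equiv> (\<chi> i j. mat 1 $ i $ Transposition.transpose m n j) :: real^'n^'n"
  shows "scales_measure M"
proof (rule scales_measure_unimodularI)
  let ?\<tau> = "Transposition.transpose m n"
  show "\<bar>det M\<bar> = 1"
    unfolding M_def by (simp add: det_permute_columns permutes_swap_id sign_swap_id abs_mult)
  have "i = ?\<tau> j \<longleftrightarrow> j = ?\<tau> i" for i j
    by (metis transpose_involutory)
  then have "(\<Sum>j\<in>UNIV. mat 1 $ i $ ?\<tau> j * x $ j) = x $ ?\<tau> i" for i and x :: "real^'n"
    using sum.mono_neutral_right[of UNIV "{?\<tau> i}" "\<lambda>j. mat 1 $ i $ ?\<tau> j * x $ j"]
    by (simp add: mat_def)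
  then have permute: "M *v x = (\<chi> i. x $ ?\<tau> i)" for x
    by (simp add: M_def matrix_vector_mult_def)
  fix a b :: "real^'n"
  have image: "(*v) M ` cbox a b = cbox (M *v a) (M *v b)"
  proof (intro equalityI subsetI)
    fix y assume "y \<in> cbox (M *v a) (M *v b)"
    then have "a $ i \<le> y $ ?\<tau> i \<and> y $ ?\<tau> i \<le> b $ i" for i
      unfolding permute mem_box_cart by (drule_tac spec[of _ "?\<tau> i"]) simp
    then have "(\<chi> i. y $ ?\<tau> i) \<in> cbox a b"
      by (simp add: mem_box_cart)
    moreover have "y = M *v (\<chi> i. y $ ?\<tau> i)"
      by (simp add: permute vec_eq_iff)
    ultimately show "y \<in> (*v) M ` cbox a b" by blast
  qed (auto simp: permute mem_box_cart)
  have "(\<Prod>i\<in>UNIV. (M *v b) $ i - (M *v a) $ i) = (\<Prod>i\<in>UNIV. b $ i - a $ i)"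
    using prod.permute[OF permutes_swap_id[of m UNIV n], of "\<lambda>i. b $ i - a $ i"]
    by (simp add: permute o_def)
  moreover have "cbox (M *v a) (M *v b) = {} \<longleftrightarrow> cbox a b = {}"
    unfolding image[symmetric] by simp
  ultimately show "measure lebesgue ((*v) M ` cbox a b) = measure lebesgue (cbox a b)"
    by (simp add: image content_cbox_if_cart)
qed

lemma scales_measure_shear:
  fixes m n :: "'n::finite"
  assumes "m \<noteq> n"
  defines "M \<equiv> (\<chi> i j. of_bool (i = m \<and> j = n \<or> i = j)) :: real^'n^'n"
  shows "scales_measure M"
proof (rule scales_measure_unimodularI)
  have "M = (\<chi> k. if k = m then row m (mat 1) + 1 *s row n (mat 1) else row k (mat 1))"
    using assms(1) by (auto simp: M_def vec_eq_iff row_def mat_def)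
  then show "\<bar>det M\<bar> = 1"
    using det_row_operation[OF assms(1), of "mat 1 :: real^'n^'n" 1] by simp
  have "(\<Sum>j\<in>UNIV. of_bool (i = m \<and> j = n \<or> i = j) * x $ j) = (if i = m then x $ m + x $ n else x $ i)"
    for i and x :: "real^'n"
    using assms(1) sum.mono_neutral_right[of UNIV "{i, n}" "\<lambda>j. of_bool (i = m \<and> j = n \<or> i = j) * x $ j"]
    by auto
  then have shear: "(*v) M = (\<lambda>x. \<chi> i. if i = m then x $ m + x $ n else x $ i)"
    by (simp add: M_def fun_eq_iff matrix_vector_mult_def)
  fix a b :: "real^'n"
  show "measure lebesgue ((*v) M ` cbox a b) = measure lebesgue (cbox a b)"
  proof (cases "cbox a b = {}")
    case False
    have box: "cbox a b = (+) a ` cbox 0 (b - a)"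
      by (simp flip: cbox_translation)
    then have nonempty: "cbox 0 (b - a) \<noteq> {}" using False by auto
    have "(*v) M ` cbox a b = (+) (M *v a) ` ((*v) M ` cbox 0 (b - a))"
      unfolding box by (simp add: image_image matrix_vector_right_distrib)
    then have "measure lebesgue ((*v) M ` cbox a b) = measure lebesgue ((*v) M ` cbox 0 (b - a))"
      by (simp only: measure_translation)
    also have "\<dots> = measure lebesgue (cbox 0 (b - a))"
      unfolding shear by (rule measure_shear_interval) (use assms(1) nonempty in auto)
    also have "\<dots> = measure lebesgue (cbox a b)"
      unfolding box by (simp only: measure_translation)
    finally show ?thesis .
  qed simp
qed

theorem scales_measure_matrix: "scales_measure M"
proof (rule induct_matrix_elementary_alt)
  fix A :: "real^'a^'a" and i
  assume "row i A = 0"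
  then show "scales_measure A"
    by (rule scales_measure_singular[OF det_zero_row(2)])
qed (rule scales_measure_mult scales_measure_transposition scales_measure_shear scales_measure_diagonal; assumption)+

lemma matrix_inv_invertible:
  fixes M :: "real^'n::finite^'n"
  assumes "det M \<noteq> 0"
  shows "M ** matrix_inv M = mat 1" "matrix_inv M ** M = mat 1"
    "M *v (matrix_inv M *v x) = x" "matrix_inv M *v (M *v x) = x"
proof -
  have "\<exists>A'. M ** A' = mat 1 \<and> A' ** M = mat 1"
    using assms by (simp add: invertible_det_nz[symmetric] invertible_def)
  then have "M ** matrix_inv M = mat 1 \<and> matrix_inv M ** M = mat 1"
    unfolding matrix_inv_def by (rule someI_ex)
  then show "M ** matrix_inv M = mat 1" "matrix_inv M ** M = mat 1" by auto
  then show "M *v (matrix_inv M *v x) = x" "matrix_inv M *v (M *v x) = x"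
    by (simp_all add: matrix_vector_mul_assoc)
qed

lemma det_matrix_inv:
  fixes M :: "real^'n::finite^'n"
  assumes "det M \<noteq> 0"
  shows "det (matrix_inv M) = inverse (det M)"
  using matrix_inv_invertible(1)[OF assms] det_mul[of M "matrix_inv M"] assms
  by (simp add: field_simps)

lemma lebesgue_matrix_image:
  fixes M :: "real^'n::finite^'n"
  assumes det: "det M \<noteq> 0" and X: "X \<in> sets lebesgue"
  shows "(*v) M ` X \<in> sets lebesgue" "emeasure lebesgue ((*v) M ` X) = ennreal \<bar>det M\<bar> * emeasure lebesgue X"
proof -
  define Y where "Y k = X \<inter> ball 0 (real k)" for k
  have Y: "Y k \<in> lmeasurable" for k
    unfolding Y_def using X by (intro bounded_set_imp_lmeasurable) (auto simp: bounded_Int)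
  have X_union: "X = (\<Union>k. Y k)"
    unfolding Y_def by (auto intro: reals_Archimedean2)
  then have union: "(*v) M ` X = (\<Union>k. (*v) M ` Y k)"
    by (metis image_UN)
  have image_Y: "(*v) M ` Y k \<in> lmeasurable"
    "measure lebesgue ((*v) M ` Y k) = \<bar>det M\<bar> * measure lebesgue (Y k)" for k
    using scales_measure_matrix[of M] Y[of k] unfolding scales_measure_def by auto
  have emeasure_Y: "emeasure lebesgue ((*v) M ` Y k) = ennreal \<bar>det M\<bar> * emeasure lebesgue (Y k)" for k
    using emeasure_eq_ennreal_measure[OF fmeasurableD2[OF image_Y(1)]]
      emeasure_eq_ennreal_measure[OF fmeasurableD2[OF Y]]
    by (simp add: image_Y(2) ennreal_mult)
  have "incseq Y" by (auto simp: incseq_def Y_def intro: less_le_trans)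
  then have incseq: "incseq Y" "incseq (\<lambda>k. (*v) M ` Y k)" by (auto simp: incseq_def image_mono)
  have "emeasure lebesgue ((*v) M ` X) = (SUP k. emeasure lebesgue ((*v) M ` Y k))"
    unfolding union by (rule SUP_emeasure_incseq[symmetric]) (use image_Y(1) incseq in auto)
  also have "\<dots> = ennreal \<bar>det M\<bar> * (SUP k. emeasure lebesgue (Y k))"
    unfolding emeasure_Y by (rule SUP_mult_left_ennreal[symmetric])
  also have "(SUP k. emeasure lebesgue (Y k)) = emeasure lebesgue (\<Union>k. Y k)"
    by (rule SUP_emeasure_incseq) (use Y incseq in auto)
  finally show "emeasure lebesgue ((*v) M ` X) = ennreal \<bar>det M\<bar> * emeasure lebesgue X"
    unfolding X_union[symmetric] .
  show "(*v) M ` X \<in> sets lebesgue"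
    unfolding union using image_Y(1) by blast
qed

lemma lebesgue_affine_vimage:
  fixes M :: "real^'n::finite^'n"
  assumes det: "det M \<noteq> 0" and X: "X \<in> sets lebesgue"
  shows "{t. M *v t + v \<in> X} \<in> sets lebesgue"
    and "emeasure lebesgue {t. M *v t + v \<in> X} = ennreal (1 / \<bar>det M\<bar>) * emeasure lebesgue X"
proof -
  let ?N = "matrix_inv M" and ?T = "\<lambda>t. 1 *\<^sub>R t + (- (matrix_inv M *v v))"
  have vimage: "{t. M *v t + v \<in> X} = ?T ` ((*v) ?N ` X)"
  proof (intro equalityI subsetI)
    fix t assume "t \<in> {t. M *v t + v \<in> X}"
    moreover have "t = ?T (?N *v (M *v t + v))"
      by (simp add: matrix_vector_right_distrib matrix_inv_invertible[OF det])
    ultimately show "t \<in> ?T ` ((*v) ?N ` X)" by blast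
  next
    fix t assume "t \<in> ?T ` ((*v) ?N ` X)"
    then show "t \<in> {t. M *v t + v \<in> X}"
      by (auto simp: matrix_vector_right_distrib matrix_vector_mult_diff_distrib matrix_inv_invertible[OF det])
  qed
  have det_inv: "det ?N \<noteq> 0" "\<bar>det ?N\<bar> = 1 / \<bar>det M\<bar>"
    using det by (simp_all add: det_matrix_inv abs_inverse inverse_eq_divide)
  show "{t. M *v t + v \<in> X} \<in> sets lebesgue"
    unfolding vimage
    using lebesgue_sets_translation[OF lebesgue_matrix_image(1)[OF det_inv(1) X], of "- (?N *v v)"]
    by (simp add: add.commute[of "- (?N *v v)"])
  have "emeasure lebesgue (?T ` ((*v) ?N ` X)) = emeasure lebesgue ((*v) ?N ` X)"
    using emeasure_lebesgue_affine[of 1 "- (?N *v v)"] by simp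
  then show "emeasure lebesgue {t. M *v t + v \<in> X} = ennreal (1 / \<bar>det M\<bar>) * emeasure lebesgue X"
    unfolding vimage lebesgue_matrix_image(2)[OF det_inv(1) X] det_inv(2) by simp
qed

lemma measurable_lebesgue_affine:
  fixes M :: "real^'n::finite^'n"
  assumes "det M \<noteq> 0"
  shows "(\<lambda>t. M *v t + v) \<in> lebesgue \<rightarrow>\<^sub>M lebesgue"
  by (rule measurableI) (use lebesgue_affine_vimage(1)[OF assms] in \<open>auto simp: vimage_def\<close>)

lemma distr_lebesgue_affine:
  fixes M :: "real^'n::finite^'n"
  assumes det: "det M \<noteq> 0"
  shows "distr lebesgue lebesgue (\<lambda>t. M *v t + v) = density lebesgue (\<lambda>_. ennreal (1 / \<bar>det M\<bar>))"
  using measurable_lebesgue_affine[OF det] lebesgue_affine_vimage(2)[OF det]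
  by (intro measure_eqI) (auto simp: emeasure_distr emeasure_density nn_integral_cmult_indicator vimage_def)

lemma nn_integral_affine:
  fixes M :: "real^'n::finite^'n" and f :: "real^'n \<Rightarrow> ennreal"
  assumes "det M \<noteq> 0" "f \<in> borel_measurable lebesgue"
  shows "(\<integral>\<^sup>+ t. f (M *v t + v) \<partial>lebesgue) = ennreal (1 / \<bar>det M\<bar>) * (\<integral>\<^sup>+ t. f t \<partial>lebesgue)"
  using nn_integral_distr[OF measurable_lebesgue_affine[OF assms(1)], of f v]
  unfolding distr_lebesgue_affine[OF assms(1)]
  using assms by (simp add: nn_integral_density nn_integral_cmult)

lemma
  fixes M :: "real^'n::finite^'n" and f :: "real^'n \<Rightarrow> 'b::{banach,second_countable_topology}"
  assumes det: "det M \<noteq> 0" and f: "f \<in> borel_measurable lebesgue"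
  shows integral_affine: "(LINT t|lebesgue. f (M *v t + v)) = (1 / \<bar>det M\<bar>) *\<^sub>R (LINT t|lebesgue. f t)"
    and integrable_affine: "integrable lebesgue (\<lambda>t. f (M *v t + v)) \<longleftrightarrow> integrable lebesgue f"
    and measurable_affine: "(\<lambda>t. f (M *v t + v)) \<in> borel_measurable lebesgue"
proof -
  note m = measurable_lebesgue_affine[OF det, of v]
  show "(\<lambda>t. f (M *v t + v)) \<in> borel_measurable lebesgue"
    using measurable_compose[OF m f] .
  show "(LINT t|lebesgue. f (M *v t + v)) = (1 / \<bar>det M\<bar>) *\<^sub>R (LINT t|lebesgue. f t)"
    using integral_distr[OF m f] f unfolding distr_lebesgue_affine[OF det]
    by (simp add: integral_density)
  have scaleR_iff: "integrable lebesgue (\<lambda>t. c *\<^sub>R f t) \<longleftrightarrow> integrable lebesgue f" if "c \<noteq> 0" for c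
    using that integrable_scaleR_right[of c lebesgue f] integrable_scaleR_right[of "1/c" lebesgue "\<lambda>t. c *\<^sub>R f t"]
    by auto
  have "(1 / \<bar>det M\<bar>) \<noteq> 0" using det by simp
  note scaleR_iff = scaleR_iff[OF this]
  show "integrable lebesgue (\<lambda>t. f (M *v t + v)) \<longleftrightarrow> integrable lebesgue f"
    using integrable_distr_eq[OF m f] f det unfolding distr_lebesgue_affine[OF det]
    by (simp add: integrable_density scaleR_iff)
qed

lemma AE_affine:
  fixes M :: "real^'n::finite^'n"
  assumes det: "det M \<noteq> 0" and P: "AE t in lebesgue. P t"
  shows "AE t in lebesgue. P (M *v t + v)"
proof -
  from P obtain N where N: "N \<in> null_sets lebesgue" "{t. \<not> P t} \<subseteq> N"
    by (auto simp: eventually_ae_filter)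
  have "{t. M *v t + v \<in> N} \<in> null_sets lebesgue"
    using lebesgue_affine_vimage[OF det, of N v] N(1) by (auto simp: null_sets_def)
  then show ?thesis
    using N(2) by (auto simp: eventually_ae_filter intro!: bexI[of _ "{t. M *v t + v \<in> N}"])
qed

section \<open>Square-integrable functions\<close>

lemma square_integrable_iff_nn_integral:
  "square_integrable f \<longleftrightarrow> f \<in> borel_measurable lebesgue \<and> (\<integral>\<^sup>+ x. ennreal ((cmod (f x))\<^sup>2) \<partial>lebesgue) < \<infinity>"
  by (auto simp: square_integrable_def integrable_iff_bounded)

lemma nn_integral_cmod_sq:
  "square_integrable f \<Longrightarrow> (\<integral>\<^sup>+ x. ennreal ((cmod (f x))\<^sup>2) \<partial>lebesgue) = ennreal (L2_norm_sq f)"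
  unfolding square_integrable_def L2_norm_sq_def by (intro nn_integral_eq_integral) auto

lemma L2_norm_sq_nonneg [simp]: "0 \<le> L2_norm_sq f"
  by (simp add: L2_norm_sq_def)

lemma square_integrable_mult_integrable:
  assumes "square_integrable f" "square_integrable g"
  shows "integrable lebesgue (\<lambda>x. f x * g x)"
proof (rule Bochner_Integration.integrable_bound)
  show "integrable lebesgue (\<lambda>x. (cmod (f x))\<^sup>2 + (cmod (g x))\<^sup>2)"
    using assms by (auto simp: square_integrable_def)
  show "(\<lambda>x. f x * g x) \<in> borel_measurable lebesgue"
    using assms by (auto simp: square_integrable_def)
  have "2 * (a * b) \<le> a\<^sup>2 + b\<^sup>2" for a b :: real using sum_squares_bound[of a b] by simp
  then have "a * b \<le> a\<^sup>2 + b\<^sup>2" if "0 \<le> a" "0 \<le> b" for a b :: real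
    using that by (smt (verit) mult_nonneg_nonneg)
  then show "AE x in lebesgue. norm (f x * g x) \<le> norm ((cmod (f x))\<^sup>2 + (cmod (g x))\<^sup>2)"
    by (auto simp: norm_mult)
qed

lemma square_integrable_cmult:
  "square_integrable f \<Longrightarrow> square_integrable (\<lambda>x. c * f x)"
  unfolding square_integrable_def by (auto simp: norm_mult power_mult_distrib)

lemma square_integrable_cnj:
  "square_integrable f \<Longrightarrow> square_integrable (\<lambda>x. cnj (f x))"
  unfolding square_integrable_def
  by (auto intro: borel_measurable_continuous_on[where f=cnj] continuous_intros)

lemma square_integrable_bound:
  assumes "f \<in> borel_measurable lebesgue" "integrable lebesgue (\<lambda>x. (w x)\<^sup>2)"
    "AE x in lebesgue. cmod (f x) \<le> w x"
  shows "square_integrable f"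
  unfolding square_integrable_def
proof
  show "integrable lebesgue (\<lambda>x. (cmod (f x))\<^sup>2)"
  proof (rule Bochner_Integration.integrable_bound[OF assms(2)])
    show "AE x in lebesgue. norm ((cmod (f x))\<^sup>2) \<le> norm ((w x)\<^sup>2)"
      using assms(3) by eventually_elim (simp add: power_mono)
  qed (use assms(1) in auto)
qed fact

lemma square_integrable_add:
  assumes "square_integrable f" "square_integrable g"
  shows "square_integrable (\<lambda>x. f x + g x)"
  unfolding square_integrable_def
proof
  show "integrable lebesgue (\<lambda>x. (cmod (f x + g x))\<^sup>2)"
  proof (rule Bochner_Integration.integrable_bound)
    show "integrable lebesgue (\<lambda>x. 2 * (cmod (f x))\<^sup>2 + 2 * (cmod (g x))\<^sup>2)"
      using assms by (auto simp: square_integrable_def)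
    have "(cmod (a + b))\<^sup>2 \<le> 2 * (cmod a)\<^sup>2 + 2 * (cmod b)\<^sup>2" for a b
    proof -
      have "(cmod (a + b))\<^sup>2 \<le> (cmod a + cmod b)\<^sup>2" by (simp add: norm_triangle_ineq power_mono)
      also have "\<dots> \<le> 2 * (cmod a)\<^sup>2 + 2 * (cmod b)\<^sup>2"
        using sum_squares_bound[of "cmod a" "cmod b"] by (simp add: power2_sum)
      finally show ?thesis .
    qed
    then show "AE x in lebesgue. norm ((cmod (f x + g x))\<^sup>2) \<le> norm (2 * (cmod (f x))\<^sup>2 + 2 * (cmod (g x))\<^sup>2)"
      by auto
  qed (use assms in \<open>auto simp: square_integrable_def\<close>)
qed (use assms in \<open>auto simp: square_integrable_def\<close>)

lemma square_integrable_diff: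
  assumes "square_integrable f" "square_integrable g"
  shows "square_integrable (\<lambda>x. f x - g x)"
  using square_integrable_add[OF assms(1) square_integrable_cmult[OF assms(2), of "-1"]] by simp

lemma square_integrable_zero [simp]: "square_integrable (\<lambda>x. 0)"
  by (simp add: square_integrable_def)

lemma square_integrable_sum:
  assumes "\<And>i. i \<in> I \<Longrightarrow> square_integrable (f i)"
  shows "square_integrable (\<lambda>x. \<Sum>i\<in>I. f i x)"
  using assms by (induction I rule: infinite_finite_induct) (auto intro: square_integrable_add)

lemma square_integrable_AE_cong:
  assumes "square_integrable f" "AE x in lebesgue. f x = g x"
  shows "square_integrable g" "L2_norm_sq g = L2_norm_sq f"
proof -
  have measurable: "f \<in> borel_measurable lebesgue" "g \<in> borel_measurable lebesgue"
    using assms borel_measurable_AE by (auto simp: square_integrable_def)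
  have "AE x in lebesgue. (cmod (f x))\<^sup>2 = (cmod (g x))\<^sup>2" using assms(2) by eventually_elim simp
  then show "square_integrable g" "L2_norm_sq g = L2_norm_sq f"
    using assms(1) measurable integrable_cong_AE[of "\<lambda>x. (cmod (f x))\<^sup>2" lebesgue "\<lambda>x. (cmod (g x))\<^sup>2"]
      integral_cong_AE[of "\<lambda>x. (cmod (f x))\<^sup>2" lebesgue "\<lambda>x. (cmod (g x))\<^sup>2"]
    by (auto simp: square_integrable_def L2_norm_sq_def)
qed

lemma square_integrable_affine:
  fixes M :: "real^'n::finite^'n"
  assumes "det M \<noteq> 0" "square_integrable f"
  shows "square_integrable (\<lambda>t. f (M *v t + v))"
    "L2_norm_sq (\<lambda>t. f (M *v t + v)) = L2_norm_sq f / \<bar>det M\<bar>"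
proof -
  have measurable: "(\<lambda>t. (cmod (f t))\<^sup>2) \<in> borel_measurable lebesgue"
    using assms(2) by (auto simp: square_integrable_def)
  show "square_integrable (\<lambda>t. f (M *v t + v))"
    using assms measurable_affine[OF assms(1), of f v] integrable_affine[OF assms(1) measurable, of v]
    by (simp add: square_integrable_def)
  show "L2_norm_sq (\<lambda>t. f (M *v t + v)) = L2_norm_sq f / \<bar>det M\<bar>"
    unfolding L2_norm_sq_def using integral_affine[OF assms(1) measurable, of v] by simp
qed

definition L2_norm :: "(real^'d::finite \<Rightarrow> complex) \<Rightarrow> real" where
  "L2_norm f = sqrt (L2_norm_sq f)"

lemma L2_norm_nonneg [simp]: "0 \<le> L2_norm f" and L2_norm_power2 [simp]: "(L2_norm f)\<^sup>2 = L2_norm_sq f"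
  by (simp_all add: L2_norm_def)

lemma L2_dist_sq_eq:
  assumes "square_integrable f" "square_integrable g"
  shows "L2_dist_sq f g = ennreal ((L2_norm (\<lambda>x. f x - g x))\<^sup>2)"
  unfolding L2_dist_sq_def using nn_integral_cmod_sq[OF square_integrable_diff[OF assms]] by simp

lemma Cauchy_Schwarz_abs:
  assumes f: "square_integrable f" and g: "square_integrable g"
  shows "(LINT x|lebesgue. cmod (f x * g x)) \<le> L2_norm f * L2_norm g"
proof -
  have [measurable]: "f \<in> borel_measurable lebesgue" "g \<in> borel_measurable lebesgue"
    using f g by (auto simp: square_integrable_def)
  let ?I = "LINT x|lebesgue. cmod (f x * g x)"
  have "(\<integral>\<^sup>+x. ennreal (cmod (f x)) * ennreal (cmod (g x)) \<partial>lebesgue) = ennreal ?I"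
    using nn_integral_eq_integral[OF integrable_norm[OF square_integrable_mult_integrable[OF f g]]]
    by (simp add: norm_mult ennreal_mult)
  moreover have "(\<integral>\<^sup>+x. ennreal (cmod (f x)) * ennreal (cmod (g x)) \<partial>lebesgue)\<^sup>2
      \<le> (\<integral>\<^sup>+x. (ennreal (cmod (f x)))\<^sup>2 \<partial>lebesgue) * (\<integral>\<^sup>+x. (ennreal (cmod (g x)))\<^sup>2 \<partial>lebesgue)"
    by (rule Cauchy_Schwarz_nn_integral) auto
  ultimately have "ennreal (?I\<^sup>2) \<le> ennreal (L2_norm_sq f * L2_norm_sq g)"
    using nn_integral_cmod_sq[OF f] nn_integral_cmod_sq[OF g]
    by (simp add: ennreal_power ennreal_mult)
  then have "?I\<^sup>2 \<le> (L2_norm f * L2_norm g)\<^sup>2"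
    by (simp add: power_mult_distrib)
  then show ?thesis
    by (rule power2_le_imp_le) simp
qed

lemma Cauchy_Schwarz_integral:
  assumes "square_integrable f" "square_integrable g"
  shows "cmod (LINT x|lebesgue. f x * g x) \<le> L2_norm f * L2_norm g"
  using integral_norm_bound[of lebesgue "\<lambda>x. f x * g x"] Cauchy_Schwarz_abs[OF assms] by linarith

lemma L2_norm_cnj [simp]: "L2_norm (\<lambda>x. cnj (f x)) = L2_norm f"
  by (simp add: L2_norm_def L2_norm_sq_def)

lemma Cauchy_Schwarz_L2_inner:
  assumes "square_integrable f" "square_integrable g"
  shows "cmod (L2_inner f g) \<le> L2_norm f * L2_norm g"
  unfolding L2_inner_def using Cauchy_Schwarz_integral[OF assms(1) square_integrable_cnj[OF assms(2)]] by simp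

lemma L2_inner_self:
  "L2_inner f f = of_real (L2_norm_sq f)"
  by (simp add: L2_inner_def L2_norm_sq_def complex_norm_square[symmetric] integral_complex_of_real[symmetric])

lemma L2_inner_commute: "L2_inner g f = cnj (L2_inner f g)"
  unfolding L2_inner_def using integral_bounded_linear'[OF bounded_linear_cnj bounded_linear_cnj,
      of lebesgue "\<lambda>x. f x * cnj (g x)"]
  by (simp add: mult.commute)

lemma L2_inner_add_left:
  assumes "square_integrable f" "square_integrable g" "square_integrable k"
  shows "L2_inner (\<lambda>x. f x + g x) k = L2_inner f k + L2_inner g k"
  unfolding L2_inner_def
  using square_integrable_mult_integrable[OF assms(1) square_integrable_cnj[OF assms(3)]]
    square_integrable_mult_integrable[OF assms(2) square_integrable_cnj[OF assms(3)]]
  by (simp add: distrib_right)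

lemma L2_inner_cmult_left: "L2_inner (\<lambda>x. c * f x) k = c * L2_inner f k"
  unfolding L2_inner_def by (simp add: mult.assoc)

lemma L2_inner_cmult_right: "L2_inner f (\<lambda>x. c * k x) = cnj c * L2_inner f k"
  by (subst (1 2) L2_inner_commute) (simp add: L2_inner_cmult_left)

lemma L2_inner_diff_left:
  assumes "square_integrable f" "square_integrable g" "square_integrable k"
  shows "L2_inner (\<lambda>x. f x - g x) k = L2_inner f k - L2_inner g k"
  using L2_inner_add_left[OF assms(1) square_integrable_cmult[OF assms(2), of "-1"] assms(3)]
    L2_inner_cmult_left[of "-1" g k] by simp

lemma L2_inner_sum_left:
  assumes "\<And>i. i \<in> I \<Longrightarrow> square_integrable (f i)" "square_integrable k"
  shows "L2_inner (\<lambda>x. \<Sum>i\<in>I. f i x) k = (\<Sum>i\<in>I. L2_inner (f i) k)"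
  using assms(1)
proof (induction I rule: infinite_finite_induct)
  case (insert i I)
  then show ?case
    using L2_inner_add_left[of "f i" "\<lambda>x. \<Sum>i\<in>I. f i x" k] square_integrable_sum[of I f] assms(2) by simp
qed (simp_all add: L2_inner_def)

lemma L2_inner_sum_right:
  assumes "\<And>i. i \<in> I \<Longrightarrow> square_integrable (f i)" "square_integrable k"
  shows "L2_inner k (\<lambda>x. \<Sum>i\<in>I. f i x) = (\<Sum>i\<in>I. L2_inner k (f i))"
  by (subst (1 2) L2_inner_commute) (simp add: L2_inner_sum_left[OF assms])

lemma L2_inner_AE_cong_right:
  assumes "square_integrable f" "square_integrable g" "AE x in lebesgue. g x = g' x"
  shows "L2_inner f g = L2_inner f g'"
proof -
  have "square_integrable g'" using square_integrable_AE_cong(1)[OF assms(2,3)] .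
  then have "(\<lambda>x. f x * cnj (g x)) \<in> borel_measurable lebesgue"
    and "(\<lambda>x. f x * cnj (g' x)) \<in> borel_measurable lebesgue"
    using square_integrable_mult_integrable[OF assms(1) square_integrable_cnj] assms(2)
    by (auto intro: borel_measurable_integrable)
  then show ?thesis unfolding L2_inner_def
    using assms(3) by (intro integral_cong_AE) auto
qed

lemma L2_norm_triangle:
  assumes f: "square_integrable f" and g: "square_integrable g"
  shows "L2_norm (\<lambda>x. f x + g x) \<le> L2_norm f + L2_norm g"
proof -
  let ?fg = "\<lambda>x. f x + g x"
  note fg = square_integrable_add[OF f g]
  have "complex_of_real ((L2_norm ?fg)\<^sup>2) = L2_inner f ?fg + L2_inner g ?fg"
    using L2_inner_add_left[OF f g fg] by (simp add: L2_inner_self)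
  then have "(L2_norm ?fg)\<^sup>2 = cmod (L2_inner f ?fg + L2_inner g ?fg)"
    by (metis norm_of_real abs_power2)
  also have "\<dots> \<le> cmod (L2_inner f ?fg) + cmod (L2_inner g ?fg)"
    by (rule norm_triangle_ineq)
  also have "\<dots> \<le> L2_norm f * L2_norm ?fg + L2_norm g * L2_norm ?fg"
    by (intro add_mono Cauchy_Schwarz_L2_inner f g fg)
  finally have "L2_norm ?fg * L2_norm ?fg \<le> (L2_norm f + L2_norm g) * L2_norm ?fg"
    by (simp only: power2_eq_square distrib_right)
  then show ?thesis
    using L2_norm_nonneg[of ?fg] L2_norm_nonneg[of f] L2_norm_nonneg[of g]
    by (cases "L2_norm ?fg = 0") (auto simp: mult_le_cancel_right simp del: L2_norm_nonneg)
qed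

lemma L2_norm_cmult: "L2_norm (\<lambda>x. c * f x) = cmod c * L2_norm f"
  by (simp add: L2_norm_def L2_norm_sq_def norm_mult power_mult_distrib real_sqrt_mult)

lemma L2_norm_minus_commute: "L2_norm (\<lambda>x. f x - g x) = L2_norm (\<lambda>x. g x - f x)"
  by (simp add: L2_norm_def L2_norm_sq_def norm_minus_commute)

lemma L2_norm_triangle_diff:
  assumes f: "square_integrable f" and g: "square_integrable g" and h: "square_integrable h"
  shows "L2_norm (\<lambda>x. f x - h x) \<le> L2_norm (\<lambda>x. f x - g x) + L2_norm (\<lambda>x. g x - h x)"
  using L2_norm_triangle[OF square_integrable_diff[OF f g] square_integrable_diff[OF g h]] by simp

lemma L2_norm_le_diff:
  assumes f: "square_integrable f" and g: "square_integrable g"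
  shows "L2_norm f \<le> L2_norm g + L2_norm (\<lambda>x. f x - g x)"
  using L2_norm_triangle[OF g square_integrable_diff[OF f g]] by simp

lemma L2_norm_sq_eq_0_AE:
  assumes "square_integrable f" "L2_norm_sq f = 0"
  shows "AE x in lebesgue. f x = 0"
  using integral_nonneg_eq_0_iff_AE[of lebesgue "\<lambda>x. (cmod (f x))\<^sup>2"] assms
  by (auto simp: square_integrable_def L2_norm_sq_def)

lemma L2_dominated_convergence:
  fixes f :: "real^'d::finite \<Rightarrow> complex" and s :: "nat \<Rightarrow> real^'d \<Rightarrow> complex"
  assumes f: "f \<in> borel_measurable lebesgue" and s: "\<And>n. s n \<in> borel_measurable lebesgue"
    and w: "integrable lebesgue (\<lambda>x. (w x)\<^sup>2)"
    and lim: "AE x in lebesgue. (\<lambda>n. s n x) \<longlonglongrightarrow> f x"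
    and dom: "\<And>n. AE x in lebesgue. cmod (s n x) \<le> w x"
  shows "square_integrable f" "\<And>n. square_integrable (s n)" "(\<lambda>n. L2_norm (\<lambda>x. s n x - f x)) \<longlonglongrightarrow> 0"
proof -
  show "square_integrable (s n)" for n by (rule square_integrable_bound[OF s w dom])
  have "AE x in lebesgue. \<forall>n. cmod (s n x) \<le> w x" using dom by (simp add: AE_all_countable)
  with lim have f_dom: "AE x in lebesgue. cmod (f x) \<le> w x"
  proof eventually_elim
    case (elim x)
    then show ?case by (intro tendsto_upperbound[OF tendsto_norm[of "\<lambda>n. s n x"]]) auto
  qed
  show "square_integrable f" by (rule square_integrable_bound[OF f w f_dom])
  have "(\<lambda>n. LINT x|lebesgue. (cmod (s n x - f x))\<^sup>2) \<longlonglongrightarrow> (LINT (x::real^'d)|lebesgue. (0 :: real))"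
  proof (rule integral_dominated_convergence)
    show "integrable lebesgue (\<lambda>x. 4 * (w x)\<^sup>2)" using w by simp
    show "AE x in lebesgue. (\<lambda>n. (cmod (s n x - f x))\<^sup>2) \<longlonglongrightarrow> 0"
      using lim
    proof eventually_elim
      case (elim x)
      then have "(\<lambda>n. (cmod (s n x - f x))\<^sup>2) \<longlonglongrightarrow> (cmod (f x - f x))\<^sup>2"
        by (intro tendsto_intros)
      then show ?case by simp
    qed
    show "AE x in lebesgue. norm ((cmod (s n x - f x))\<^sup>2) \<le> 4 * (w x)\<^sup>2" for n
      using f_dom dom[of n]
    proof eventually_elim
      case (elim x)
      then have "cmod (s n x - f x) \<le> 2 * w x" using norm_triangle_ineq4[of "s n x" "f x"] by linarith
      then have "(cmod (s n x - f x))\<^sup>2 \<le> (2 * w x)\<^sup>2" by (intro power_mono) auto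
      then show ?case by (simp add: power_mult_distrib)
    qed
  qed (use f s in auto)
  then show "(\<lambda>n. L2_norm (\<lambda>x. s n x - f x)) \<longlonglongrightarrow> 0"
    unfolding L2_norm_def L2_norm_sq_def using tendsto_real_sqrt[of _ 0 sequentially] by simp
qed

lemma L2_inner_tendsto_left:
  assumes "\<And>n. square_integrable (s n)" "square_integrable f" "square_integrable g"
    "(\<lambda>n. L2_norm (\<lambda>x. s n x - f x)) \<longlonglongrightarrow> 0"
  shows "(\<lambda>n. L2_inner (s n) g) \<longlonglongrightarrow> L2_inner f g"
proof -
  have "(\<lambda>n. L2_inner (s n) g - L2_inner f g) \<longlonglongrightarrow> 0"
  proof (rule Lim_null_comparison)
    show "\<forall>\<^sub>F n in sequentially. norm (L2_inner (s n) g - L2_inner f g) \<le> L2_norm (\<lambda>x. s n x - f x) * L2_norm g"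
      using Cauchy_Schwarz_L2_inner[OF square_integrable_diff[OF assms(1,2)] assms(3)]
        L2_inner_diff_left[OF assms(1-3)] by simp
    show "(\<lambda>n. L2_norm (\<lambda>x. s n x - f x) * L2_norm g) \<longlonglongrightarrow> 0"
      using tendsto_mult_left_zero[OF assms(4)] by simp
  qed
  then show ?thesis by (simp add: LIM_zero_iff)
qed

lemma L2_norm_tendsto:
  assumes "\<And>n. square_integrable (s n)" "square_integrable f"
    "(\<lambda>n. L2_norm (\<lambda>x. s n x - f x)) \<longlonglongrightarrow> 0"
  shows "(\<lambda>n. L2_norm (s n)) \<longlonglongrightarrow> L2_norm f"
proof -
  have "(\<lambda>n. L2_norm (s n) - L2_norm f) \<longlonglongrightarrow> 0"
  proof (rule Lim_null_comparison[OF _ assms(3)])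
    have "norm (L2_norm (s n) - L2_norm f) \<le> L2_norm (\<lambda>x. s n x - f x)" for n
      using L2_norm_le_diff[OF assms(1)[of n] assms(2)] L2_norm_le_diff[OF assms(2) assms(1)[of n]]
        L2_norm_minus_commute[of f "s n"]
      by (simp add: abs_le_iff)
    then show "\<forall>\<^sub>F n in sequentially. norm (L2_norm (s n) - L2_norm f) \<le> L2_norm (\<lambda>x. s n x - f x)"
      by simp
  qed
  then show ?thesis by (simp add: LIM_zero_iff)
qed

lemma summable_norm_of_weighted_squares:
  fixes d :: "nat \<Rightarrow> 'a::real_normed_vector"
  assumes "summable (\<lambda>k. 2 ^ k * (norm (d k))\<^sup>2)"
  shows "summable (\<lambda>k. norm (d k))"
proof (rule summable_comparison_test'[where N=0])
  show "summable (\<lambda>k. 2 ^ k * (norm (d k))\<^sup>2 + (1/2) ^ k)"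
    by (intro summable_add assms summable_geometric) simp
  fix k
  have inverse: "2 ^ k * (1/2::real) ^ k = 1" by (simp add: power_one_over)
  have "0 \<le> 2 ^ k * (norm (d k) - (1/2) ^ k)\<^sup>2" by simp
  also have "\<dots> = 2 ^ k * (norm (d k))\<^sup>2 - 2 * (2 ^ k * (1/2) ^ k) * norm (d k) + 2 ^ k * (1/2) ^ k * (1/2) ^ k"
    by (simp add: power2_eq_square algebra_simps)
  finally have "2 * norm (d k) \<le> 2 ^ k * (norm (d k))\<^sup>2 + (1/2) ^ k"
    unfolding inverse by simp
  then show "norm (norm (d k)) \<le> 2 ^ k * (norm (d k))\<^sup>2 + (1/2) ^ k"
    using norm_ge_zero[of "d k"] unfolding real_norm_def abs_norm_cancel by linarith
qed

lemma AE_convergent_of_rapidly_Cauchy: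
  fixes s :: "nat \<Rightarrow> real^'d::finite \<Rightarrow> complex"
  assumes s: "\<And>k. square_integrable (s k)"
    and rapid: "\<And>k. L2_norm (\<lambda>x. s (Suc k) x - s k x) \<le> (1/2) ^ k"
  shows "AE x in lebesgue. convergent (\<lambda>k. s k x)"
proof -
  let ?d = "\<lambda>k x. s (Suc k) x - s k x"
  have [measurable]: "s k \<in> borel_measurable lebesgue" for k
    using s by (simp add: square_integrable_def)
  have "(\<integral>\<^sup>+x. (\<Sum>k. ennreal (2 ^ k * (cmod (?d k x))\<^sup>2)) \<partial>lebesgue) =
      (\<Sum>k. \<integral>\<^sup>+x. ennreal (2 ^ k * (cmod (?d k x))\<^sup>2) \<partial>lebesgue)"
    by (rule nn_integral_suminf) auto
  also have "\<dots> \<le> (\<Sum>k. ennreal ((1/2) ^ k))"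
  proof (rule suminf_le)
    fix k
    have "(\<integral>\<^sup>+x. ennreal (2 ^ k * (cmod (?d k x))\<^sup>2) \<partial>lebesgue) = ennreal (2 ^ k * L2_norm_sq (?d k))"
      using nn_integral_cmod_sq[OF square_integrable_diff[OF s s], of "Suc k" k]
      by (simp add: ennreal_mult nn_integral_cmult)
    also have "2 ^ k * L2_norm_sq (?d k) \<le> 2 ^ k * ((1/2) ^ k)\<^sup>2"
      using power_mono[OF rapid[of k], of 2] by simp
    also have "\<dots> = (1/2 :: real) ^ k" by (simp add: power2_eq_square power_divide)
    finally show "(\<integral>\<^sup>+x. ennreal (2 ^ k * (cmod (?d k x))\<^sup>2) \<partial>lebesgue) \<le> ennreal ((1/2) ^ k)"
      by (simp add: ennreal_leI)
  qed auto
  also have "\<dots> < \<infinity>"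
    by (subst suminf_ennreal2) (auto simp: less_top[symmetric])
  finally have "AE x in lebesgue. (\<Sum>k. ennreal (2 ^ k * (cmod (?d k x))\<^sup>2)) \<noteq> \<infinity>"
    by (intro nn_integral_PInf_AE) auto
  then show ?thesis
  proof eventually_elim
    case (elim x)
    then have "summable (\<lambda>k. 2 ^ k * (cmod (?d k x))\<^sup>2)"
      by (intro summable_suminf_not_top) auto
    then have "summable (\<lambda>k. ?d k x)"
      by (rule summable_norm_cancel[OF summable_norm_of_weighted_squares])
    then show "convergent (\<lambda>k. s k x)"
      by (simp only: summable_iff_convergent sum_lessThan_telescope[of "\<lambda>k. s k x"]
          convergent_diff_const_right_iff)
  qed
qed

lemma nn_integral_dist_limit_le:
  assumes f: "square_integrable f" and s: "\<And>k::nat. square_integrable (s k)"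
    and lim: "AE x in lebesgue. (\<lambda>k. s k x) \<longlonglongrightarrow> g x"
    and bound: "\<forall>\<^sub>F k in sequentially. L2_norm (\<lambda>x. f x - s k x) \<le> c"
  shows "(\<integral>\<^sup>+x. ennreal ((cmod (f x - g x))\<^sup>2) \<partial>lebesgue) \<le> ennreal (c\<^sup>2)"
proof -
  have [measurable]: "f \<in> borel_measurable lebesgue" "s k \<in> borel_measurable lebesgue" for k
    using f s by (simp_all add: square_integrable_def)
  have "(\<integral>\<^sup>+x. ennreal ((cmod (f x - g x))\<^sup>2) \<partial>lebesgue) =
      (\<integral>\<^sup>+x. liminf (\<lambda>k. ennreal ((cmod (f x - s k x))\<^sup>2)) \<partial>lebesgue)"
  proof (rule nn_integral_cong_AE)
    show "AE x in lebesgue. ennreal ((cmod (f x - g x))\<^sup>2) = liminf (\<lambda>k. ennreal ((cmod (f x - s k x))\<^sup>2))"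
      using lim
    proof eventually_elim
      case (elim x)
      then have "(\<lambda>k. ennreal ((cmod (f x - s k x))\<^sup>2)) \<longlonglongrightarrow> ennreal ((cmod (f x - g x))\<^sup>2)"
        by (intro tendsto_intros tendsto_ennrealI)
      then show ?case by (rule lim_imp_Liminf[OF sequentially_bot, symmetric])
    qed
  qed
  also have "\<dots> \<le> liminf (\<lambda>k. \<integral>\<^sup>+x. ennreal ((cmod (f x - s k x))\<^sup>2) \<partial>lebesgue)"
    by (rule nn_integral_liminf) auto
  also have "\<dots> \<le> liminf (\<lambda>k::nat. ennreal (c\<^sup>2))"
  proof (rule Liminf_mono)
    show "\<forall>\<^sub>F k in sequentially. (\<integral>\<^sup>+x. ennreal ((cmod (f x - s k x))\<^sup>2) \<partial>lebesgue) \<le> ennreal (c\<^sup>2)"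
      using bound
    proof eventually_elim
      case (elim k)
      then have "(L2_norm (\<lambda>x. f x - s k x))\<^sup>2 \<le> c\<^sup>2" by (intro power_mono) auto
      then show ?case
        using nn_integral_cmod_sq[OF square_integrable_diff[OF f s], of k] by (simp add: ennreal_leI)
    qed
  qed
  also have "\<dots> = ennreal (c\<^sup>2)" by (simp add: Liminf_const)
  finally show ?thesis .
qed

lemma L2_Cauchy_AE_limit:
  fixes f :: "nat \<Rightarrow> real^'d::finite \<Rightarrow> complex"
  assumes f: "\<And>n. square_integrable (f n)"
    and cauchy: "\<And>j m n. m \<ge> N j \<Longrightarrow> n \<ge> N j \<Longrightarrow> L2_norm (\<lambda>x. f m x - f n x) < (1/2) ^ j"
  obtains g where "g \<in> borel_measurable lebesgue"
    "\<And>j n. n \<ge> N j \<Longrightarrow> (\<integral>\<^sup>+x. ennreal ((cmod (f n x - g x))\<^sup>2) \<partial>lebesgue) \<le> ennreal (((1/2) ^ j)\<^sup>2)"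
proof -
  define r where "r k = k + (\<Sum>i\<le>k. N i)" for k
  have r: "r k \<ge> k" "r k \<ge> N k" "r (Suc k) \<ge> N k" for k
    using member_le_sum[of k "{..k}" N] by (simp_all add: r_def)
  have "L2_norm (\<lambda>x. f (r (Suc k)) x - f (r k) x) \<le> (1/2) ^ k" for k
    using cauchy[OF r(3,2)] by (rule less_imp_le)
  then have convergent: "AE x in lebesgue. convergent (\<lambda>k. f (r k) x)"
    by (intro AE_convergent_of_rapidly_Cauchy f)
  define g where "g x = lim (\<lambda>k. f (r k) x)" for x
  have "f n \<in> borel_measurable lebesgue" for n
    using f by (simp add: square_integrable_def)
  then have "g \<in> borel_measurable lebesgue"
    unfolding g_def by (rule borel_measurable_lim_metric)
  moreover have "(\<integral>\<^sup>+x. ennreal ((cmod (f n x - g x))\<^sup>2) \<partial>lebesgue) \<le> ennreal (((1/2) ^ j)\<^sup>2)"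
    if n: "n \<ge> N j" for n j
  proof (rule nn_integral_dist_limit_le[OF f f])
    show "AE x in lebesgue. (\<lambda>k. f (r k) x) \<longlonglongrightarrow> g x"
      using convergent by eventually_elim (simp add: g_def convergent_LIMSEQ_iff)
    show "\<forall>\<^sub>F k in sequentially. L2_norm (\<lambda>x. f n x - f (r k) x) \<le> (1/2) ^ j"
      using cauchy[OF n] r(1) by (intro eventually_sequentiallyI[of "N j"]) (meson less_imp_le order_trans)
  qed
  ultimately show thesis by (rule that)
qed

lemma L2_complete:
  fixes f :: "nat \<Rightarrow> real^'d::finite \<Rightarrow> complex"
  assumes f: "\<And>n. square_integrable (f n)"
    and cauchy: "\<And>e. e > 0 \<Longrightarrow> \<exists>N. \<forall>m\<ge>N. \<forall>n\<ge>N. L2_norm (\<lambda>x. f m x - f n x) < e"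
  obtains g where "square_integrable g" "(\<lambda>n. L2_norm (\<lambda>x. f n x - g x)) \<longlonglongrightarrow> 0"
proof -
  have "\<exists>N. \<forall>m\<ge>N. \<forall>n\<ge>N. L2_norm (\<lambda>x. f m x - f n x) < (1/2) ^ k" for k :: nat
    by (rule cauchy) simp
  then obtain N where N: "\<And>k m n. m \<ge> N k \<Longrightarrow> n \<ge> N k \<Longrightarrow> L2_norm (\<lambda>x. f m x - f n x) < (1/2) ^ k"
    by metis
  obtain g where [measurable]: "g \<in> borel_measurable lebesgue"
    and bound: "\<And>j n. n \<ge> N j \<Longrightarrow> (\<integral>\<^sup>+x. ennreal ((cmod (f n x - g x))\<^sup>2) \<partial>lebesgue) \<le> ennreal (((1/2) ^ j)\<^sup>2)"
    by (rule L2_Cauchy_AE_limit[of f N, OF f]) (rule N, assumption+, rule that)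
  have "square_integrable (\<lambda>x. f (N 0) x - g x)"
    using bound[of 0 "N 0"] f[of "N 0"]
    by (auto simp: square_integrable_iff_nn_integral square_integrable_def intro: le_less_trans)
  then have g: "square_integrable g"
    using square_integrable_diff[OF f, of "\<lambda>x. f (N 0) x - g x" "N 0"] by simp
  have "(\<lambda>n. L2_norm (\<lambda>x. f n x - g x)) \<longlonglongrightarrow> 0"
  proof (rule LIMSEQ_I)
    fix e :: real assume "e > 0"
    then obtain j where j: "(1/2) ^ j < e" using real_arch_pow_inv[of e "1/2"] by auto
    have "L2_norm (\<lambda>x. f n x - g x) < e" if "n \<ge> N j" for n
    proof -
      have "(L2_norm (\<lambda>x. f n x - g x))\<^sup>2 \<le> ((1/2) ^ j)\<^sup>2"
        using bound[OF that] nn_integral_cmod_sq[OF square_integrable_diff[OF f g], of n] by simp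
      then have "L2_norm (\<lambda>x. f n x - g x) \<le> (1/2) ^ j" by (rule power2_le_imp_le) simp
      then show ?thesis using j by simp
    qed
    then show "\<exists>n\<^sub>0. \<forall>n\<ge>n\<^sub>0. norm (L2_norm (\<lambda>x. f n x - g x) - 0) < e" by auto
  qed
  with g show thesis by (rule that)
qed

section \<open>Continuous functions of compact support\<close>

definition Cc :: "('a::real_normed_vector \<Rightarrow> 'b::real_normed_vector) \<Rightarrow> bool" where
  "Cc u \<longleftrightarrow> continuous_on UNIV u \<and> (\<exists>R. \<forall>x. norm x > R \<longrightarrow> u x = 0)"

lemma Cc_bounded:
  fixes u :: "'a::euclidean_space \<Rightarrow> 'b::real_normed_vector"
  assumes "Cc u"
  obtains K R where "K \<ge> 0" "R \<ge> 0" "\<And>x. norm (u x) \<le> K" "\<And>x. norm x > R \<Longrightarrow> u x = 0"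
proof -
  from assms obtain R where cont: "continuous_on UNIV u" and R: "\<And>x. norm x > R \<Longrightarrow> u x = 0"
    by (auto simp: Cc_def)
  have "compact (u ` cball 0 R)"
    by (intro compact_continuous_image continuous_on_subset[OF cont]) auto
  then obtain K where K: "\<And>x. x \<in> cball 0 R \<Longrightarrow> norm (u x) \<le> K"
    using compact_imp_bounded bounded_iff by (metis image_eqI)
  have "norm (u x) \<le> max K 0" for x
    using K[of x] R[of x] by (cases "norm x > R") (auto simp: le_max_iff_disj)
  moreover have "\<And>x. norm x > max R 0 \<Longrightarrow> u x = 0" using R by simp
  ultimately show thesis using that[of "max K 0" "max R 0"] by simp
qed

lemma Cc_measurable: "Cc u \<Longrightarrow> u \<in> borel_measurable borel"
  by (simp add: Cc_def borel_measurable_continuous_onI)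

lemma Cc_measurable_lebesgue:
  fixes u :: "'a::euclidean_space \<Rightarrow> 'b::real_normed_vector"
  shows "Cc u \<Longrightarrow> u \<in> borel_measurable lebesgue"
  by (rule measurable_completion) (simp add: Cc_measurable)

lemma integrable_indicator_cball:
  "integrable lebesgue (\<lambda>x::'a::euclidean_space. c * indicator (cball 0 R) x :: real)"
proof -
  have "emeasure lborel (cball (0::'a) R) < \<infinity>" by (rule emeasure_bounded_finite) simp
  then show ?thesis by (intro integrable_mult_right integrable_real_indicator) auto
qed

lemma indicator_scaled_sq: "(K * indicator S x)\<^sup>2 = (K\<^sup>2 * indicator S x :: real)"
  by (simp add: indicator_def)

lemma bounded_support_square_integrable:
  fixes f :: "real^'d::finite \<Rightarrow> complex"
  assumes "f \<in> borel_measurable lebesgue" "\<And>x. cmod (f x) \<le> K" "\<And>x. norm x > R \<Longrightarrow> f x = 0"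
  shows "square_integrable f" "integrable lebesgue f"
proof -
  have bound: "cmod (f x) \<le> K * indicator (cball 0 R) x" for x
    using assms(2)[of x] assms(3)[of x] by (cases "norm x > R") auto
  have "integrable lebesgue (\<lambda>x::real^'d. (K * indicator (cball 0 R) x)\<^sup>2)"
    using integrable_indicator_cball[of "K\<^sup>2" R]
    by (simp only: indicator_scaled_sq)
  from square_integrable_bound[OF assms(1) this] bound show "square_integrable f" by simp
  show "integrable lebesgue f"
    by (rule Bochner_Integration.integrable_bound[OF integrable_indicator_cball[of K R] assms(1)])
       (intro AE_I2, use bound in \<open>auto intro: order_trans[OF _ abs_ge_self]\<close>)
qed

lemma Cc_square_integrable: "Cc u \<Longrightarrow> square_integrable u"
  and Cc_integrable: "Cc u \<Longrightarrow> integrable lebesgue u"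
  by (metis Cc_bounded Cc_measurable_lebesgue bounded_support_square_integrable)+

lemma Cc_mult_left:
  fixes u v :: "'a::real_normed_vector \<Rightarrow> 'b::real_normed_algebra"
  shows "Cc u \<Longrightarrow> continuous_on UNIV v \<Longrightarrow> Cc (\<lambda>x. v x * u x)"
  unfolding Cc_def by (metis continuous_on_mult mult_zero_right)

lemma Cc_cnj: "Cc u \<Longrightarrow> Cc (\<lambda>x. cnj (u x))"
  by (auto simp: Cc_def intro!: continuous_intros)

definition cutoff :: "real \<Rightarrow> 'a::real_normed_vector \<Rightarrow> complex" where
  "cutoff R x = of_real (max 0 (min 1 (R + 1 - norm x)))"

lemma cutoff_le_1: "cmod (cutoff R x) \<le> 1"
  and cutoff_eq_1: "norm x \<le> R \<Longrightarrow> cutoff R x = 1"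
  and cutoff_eq_0: "norm x > R + 1 \<Longrightarrow> cutoff R x = 0"
  by (auto simp: cutoff_def)

lemma continuous_cutoff: "continuous_on UNIV (cutoff R)"
  unfolding cutoff_def by (intro continuous_intros)

lemma Cc_cutoff: "Cc (cutoff R)"
  using continuous_cutoff cutoff_eq_0 unfolding Cc_def by blast

definition truncation :: "nat \<Rightarrow> ('a::real_normed_vector \<Rightarrow> complex) \<Rightarrow> 'a \<Rightarrow> complex" where
  "truncation k f x = cutoff (real k) x * closest_point (cball 0 (real k)) (f x)"

lemma norm_closest_point_cball_le:
  fixes z :: "'a::euclidean_space"
  assumes "0 \<le> r"
  shows "norm (closest_point (cball 0 r) z) \<le> norm z" "norm (closest_point (cball 0 r) z) \<le> r"
proof -
  have nonempty: "cball (0::'a) r \<noteq> {}" using assms by simp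
  show "norm (closest_point (cball 0 r) z) \<le> norm z"
    using closest_point_lipschitz[OF convex_cball closed_cball nonempty, of z 0] assms
    by (simp add: closest_point_self)
  show "norm (closest_point (cball 0 r) z) \<le> r"
    using closest_point_in_set[OF closed_cball nonempty, of z] by simp
qed

lemma continuous_closest_point_cball: "0 \<le> r \<Longrightarrow> continuous_on UNIV (closest_point (cball (0::complex) r))"
  by (intro continuous_on_closest_point) auto

lemma norm_truncation_le:
  "cmod (truncation k f x) \<le> cmod (f x)"
  "cmod (truncation k f x) \<le> real k * indicator (cball 0 (real k + 1)) x"
proof -
  have product: "cmod (truncation k f x) \<le> 1 * r" if "cmod (closest_point (cball 0 (real k)) (f x)) \<le> r" for r
    unfolding truncation_def norm_mult using that by (intro mult_mono cutoff_le_1) auto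
  show "cmod (truncation k f x) \<le> cmod (f x)"
    using product[OF norm_closest_point_cball_le(1)] by simp
  show "cmod (truncation k f x) \<le> real k * indicator (cball 0 (real k + 1)) x"
    using product[OF norm_closest_point_cball_le(2)] cutoff_eq_0[of "real k" x]
    by (cases "norm x > real k + 1") (auto simp: truncation_def)
qed

lemma measurable_truncation:
  fixes f :: "'a::euclidean_space \<Rightarrow> complex"
  assumes "f \<in> borel_measurable lebesgue"
  shows "truncation k f \<in> borel_measurable lebesgue"
  unfolding truncation_def[abs_def]
  using borel_measurable_continuous_on[OF continuous_closest_point_cball assms]
    Cc_measurable_lebesgue[OF Cc_cutoff]
  by (intro borel_measurable_times) auto

lemma truncation_tendsto: "(\<lambda>k. truncation k f x) \<longlonglongrightarrow> f x"
proof -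
  obtain k\<^sub>0 :: nat where "max (norm x) (cmod (f x)) \<le> real k\<^sub>0" using real_arch_simple by blast
  then have "truncation k f x = f x" if "k \<ge> k\<^sub>0" for k
    using that unfolding truncation_def by (subst cutoff_eq_1, simp, subst closest_point_self) auto
  then show ?thesis by (intro tendsto_eventually eventually_sequentiallyI[of k\<^sub>0])
qed

lemma truncation_L2_tendsto:
  assumes "square_integrable f"
  shows "square_integrable (truncation k f)" "(\<lambda>k. L2_norm (\<lambda>x. truncation k f x - f x)) \<longlonglongrightarrow> 0"
proof -
  have f: "f \<in> borel_measurable lebesgue" "integrable lebesgue (\<lambda>x. (cmod (f x))\<^sup>2)"
    using assms by (simp_all add: square_integrable_def)
  note convergence = L2_dominated_convergence[OF f(1) measurable_truncation[OF f(1)] f(2)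
      AE_I2[OF truncation_tendsto] AE_I2[OF norm_truncation_le(1)]]
  show "square_integrable (truncation k f)" by (rule convergence(2))
  show "(\<lambda>k. L2_norm (\<lambda>x. truncation k f x - f x)) \<longlonglongrightarrow> 0" by (rule convergence(3))
qed

lemma Cc_truncation:
  assumes "continuous_on UNIV (f :: 'a::real_normed_vector \<Rightarrow> complex)"
  shows "Cc (truncation k f)"
proof -
  have "Cc (\<lambda>x. closest_point (cball 0 (real k)) (f x) * cutoff (real k) x)"
    by (intro Cc_mult_left Cc_cutoff continuous_on_compose2[OF continuous_closest_point_cball assms]) auto
  then show ?thesis by (simp add: truncation_def[abs_def] mult.commute)
qed

lemma truncation_Cc_approximation:
  fixes f :: "real^'d::finite \<Rightarrow> complex"
  assumes f: "f \<in> borel_measurable lebesgue"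
  obtains u where "\<And>n. Cc (u n)" "(\<lambda>n. L2_norm (\<lambda>x. u n x - truncation k f x)) \<longlonglongrightarrow> 0"
proof -
  have "f measurable_on UNIV"
    using f measurable_on_iff_borel_measurable[of UNIV f] by simp
  then obtain Z and g :: "nat \<Rightarrow> real^'d \<Rightarrow> complex" where Z: "negligible Z"
    and g: "\<And>n. continuous_on UNIV (g n)" "\<And>x. x \<notin> Z \<Longrightarrow> (\<lambda>n. g n x) \<longlonglongrightarrow> f x"
    by (auto simp: measurable_on_def)
  have "(\<lambda>n. L2_norm (\<lambda>x. truncation k (g n) x - truncation k f x)) \<longlonglongrightarrow> 0"
  proof (rule L2_dominated_convergence(3)[OF measurable_truncation[OF f]])
    show "truncation k (g n) \<in> borel_measurable lebesgue" for n
      by (rule Cc_measurable_lebesgue[OF Cc_truncation[OF g(1)]])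
    show "integrable lebesgue (\<lambda>x::real^'d. (real k * indicator (cball 0 (real k + 1)) x)\<^sup>2)"
      using integrable_indicator_cball[of "(real k)\<^sup>2" "real k + 1"] by (simp only: indicator_scaled_sq)
    have "AE x in lebesgue. (\<lambda>n. g n x) \<longlonglongrightarrow> f x"
      using Z g(2) by (auto simp: negligible_iff_null_sets eventually_ae_filter)
    then show "AE x in lebesgue. (\<lambda>n. truncation k (g n) x) \<longlonglongrightarrow> truncation k f x"
    proof eventually_elim
      case (elim x)
      have "isCont (closest_point (cball 0 (real k))) (f x)"
        using continuous_closest_point_cball by (simp add: continuous_on_eq_continuous_at)
      from isCont_tendsto_compose[OF this elim] show ?case
        unfolding truncation_def by (intro tendsto_intros)
    qed
    show "AE x in lebesgue. cmod (truncation k (g n) x) \<le> real k * indicator (cball 0 (real k + 1)) x" for n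
      by (intro AE_I2 norm_truncation_le)
  qed
  with Cc_truncation[OF g(1)] show thesis by (rule that)
qed

lemma Cc_dense:
  fixes f :: "real^'d::finite \<Rightarrow> complex"
  assumes f: "square_integrable f" and "e > 0"
  obtains u where "Cc u" "L2_norm (\<lambda>x. u x - f x) < e"
proof -
  have half: "e / 2 > 0" using \<open>e > 0\<close> by simp
  obtain k where k: "L2_norm (\<lambda>x. truncation k f x - f x) < e / 2"
    using eventually_happens'[OF _ order_tendstoD(2)[OF truncation_L2_tendsto(2)[OF f] half]] by auto
  have "f \<in> borel_measurable lebesgue" using f by (simp add: square_integrable_def)
  then obtain u where u: "\<And>n. Cc (u n)" "(\<lambda>n. L2_norm (\<lambda>x. u n x - truncation k f x)) \<longlonglongrightarrow> 0"
    using truncation_Cc_approximation[of f k] by blast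
  obtain n where "L2_norm (\<lambda>x. u n x - truncation k f x) < e / 2"
    using eventually_happens'[OF _ order_tendstoD(2)[OF u(2) half]] by auto
  with k have "L2_norm (\<lambda>x. u n x - f x) < e"
    using L2_norm_triangle_diff[OF Cc_square_integrable[OF u(1)] truncation_L2_tendsto(1)[OF f] f, of n k]
    by linarith
  then show thesis using that u(1) by blast
qed

lemma Cc_dense_sequence:
  fixes f :: "real^'d::finite \<Rightarrow> complex"
  assumes f: "square_integrable f"
  obtains u where "\<And>n. Cc (u n)" "(\<lambda>n. L2_norm (\<lambda>x. u n x - f x)) \<longlonglongrightarrow> 0"
proof -
  have "\<exists>u. Cc u \<and> L2_norm (\<lambda>x. u x - f x) < 1 / real (Suc n)" for n
    using Cc_dense[OF f, of "1 / real (Suc n)"]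
    by (metis of_nat_0_less_iff zero_less_Suc zero_less_divide_1_iff)
  then obtain u where u: "\<And>n. Cc (u n)" "\<And>n. L2_norm (\<lambda>x. u n x - f x) < 1 / real (Suc n)" by metis
  have "(\<lambda>n. L2_norm (\<lambda>x. u n x - f x)) \<longlonglongrightarrow> 0"
  proof (rule Lim_null_comparison)
    show "\<forall>\<^sub>F n in sequentially. norm (L2_norm (\<lambda>x. u n x - f x)) \<le> 1 / real (Suc n)"
      using u(2) by (auto intro!: always_eventually less_imp_le)
    show "(\<lambda>n. 1 / real (Suc n)) \<longlonglongrightarrow> 0" by (rule LIMSEQ_Suc) (rule lim_1_over_n)
  qed
  then show thesis using that u by blast
qed

lemma Cc_integral_eq_0_imp_AE:
  fixes w :: "real^'d::finite \<Rightarrow> complex"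
  assumes w: "square_integrable w" and orthogonal: "\<And>u. Cc u \<Longrightarrow> (LINT x|lebesgue. w x * u x) = 0"
  shows "AE x in lebesgue. w x = 0"
proof -
  obtain u where u: "\<And>n. Cc (u n)" "(\<lambda>n. L2_norm (\<lambda>x. u n x - w x)) \<longlonglongrightarrow> 0"
    using Cc_dense_sequence[OF w] by blast
  have "L2_inner (u n) w = 0" for n
    using orthogonal[OF Cc_cnj[OF u(1)], of n] L2_inner_commute[of w "u n"]
    by (metis L2_inner_commute L2_inner_def complex_cnj_zero)
  then have "L2_inner w w = 0"
    using L2_inner_tendsto_left[OF Cc_square_integrable[OF u(1)] w w u(2)] by (simp add: LIMSEQ_const_iff)
  then show ?thesis using L2_norm_sq_eq_0_AE[OF w] by (simp add: L2_inner_self)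
qed

section \<open>Powers of the inverse of an expansive matrix\<close>

lemma summable_norm_recurrence:
  fixes y z :: "nat \<Rightarrow> 'a::real_normed_vector"
  assumes recurrence: "\<And>k. norm (y (Suc k)) \<le> r * norm (y k) + norm (z k)"
    and r: "0 \<le> r" "r < 1" and z: "summable (\<lambda>k. norm (z k))"
  shows "summable (\<lambda>k. norm (y k))"
proof -
  define Z where "Z = (\<Sum>k. norm (z k))"
  have "(\<Sum>k<n. norm (y k)) \<le> (norm (y 0) + Z) / (1 - r)" for n
  proof -
    have "(\<Sum>k<n. norm (y k)) \<le> (\<Sum>k<Suc n. norm (y k))" by simp
    also have "\<dots> = norm (y 0) + (\<Sum>k<n. norm (y (Suc k)))" by (rule sum.lessThan_Suc_shift)
    also have "\<dots> \<le> norm (y 0) + (\<Sum>k<n. r * norm (y k) + norm (z k))"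
      using recurrence by (intro add_left_mono sum_mono)
    also have "\<dots> = norm (y 0) + r * (\<Sum>k<n. norm (y k)) + (\<Sum>k<n. norm (z k))"
      by (simp add: sum.distrib sum_distrib_left)
    also have "\<dots> \<le> norm (y 0) + r * (\<Sum>k<n. norm (y k)) + Z"
      unfolding Z_def by (intro add_left_mono sum_le_suminf[OF z]) auto
    finally show ?thesis using r by (simp add: field_simps)
  qed
  then show ?thesis
    by (intro summableI_nonneg_bounded) auto
qed

lemma norm_scale_complex_vec: "norm (c *s (x::complex^'d::finite)) = cmod c * norm x"
  by (simp add: norm_vec_def norm_mult L2_set_right_distrib)

lemma real_dependent_family:
  fixes w :: "nat \<Rightarrow> 'a::euclidean_space"
  obtains c :: "nat \<Rightarrow> real" and N where "\<exists>i\<le>N. c i \<noteq> 0" "(\<Sum>i\<le>N. c i *\<^sub>R w i) = 0"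
proof (cases "inj_on w {..DIM('a)}")
  case False
  then obtain i j where collision: "i \<le> DIM('a)" "j \<le> DIM('a)" "i \<noteq> j" "w i = w j" by (auto simp: inj_on_def)
  let ?c = "\<lambda>k. if k = i then 1 else if k = j then -1 else (0::real)"
  have "(\<Sum>k\<le>DIM('a). ?c k *\<^sub>R w k) = (\<Sum>k\<in>{i,j}. ?c k *\<^sub>R w k)"
    using collision by (intro sum.mono_neutral_right) auto
  also have "\<dots> = 0" using collision by simp
  finally have "(\<Sum>k\<le>DIM('a). ?c k *\<^sub>R w k) = 0" .
  moreover have "\<exists>k\<le>DIM('a). ?c k \<noteq> 0" using collision(1) by auto
  ultimately show thesis by (intro that[where c="?c" and N="DIM('a)"])
next
  case True
  then have "card (w ` {..DIM('a)}) > DIM('a)" by (simp add: card_image)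
  then have "dependent (w ` {..DIM('a)})" by (intro dependent_biggerset) auto
  then obtain u where u: "\<exists>v\<in>w ` {..DIM('a)}. u v \<noteq> 0" "(\<Sum>v\<in>w ` {..DIM('a)}. u v *\<^sub>R v) = 0"
    using dependent_finite[of "w ` {..DIM('a)}"] by auto
  then show thesis
    by (intro that[where c="u \<circ> w" and N="DIM('a)"]) (use True in \<open>auto simp: sum.reindex\<close>)
qed

context
  fixes C :: "complex^'d::finite^'d"
begin

definition poly_act :: "complex poly \<Rightarrow> complex^'d \<Rightarrow> complex^'d" where
  "poly_act p v = fold_coeffs (\<lambda>a w. a *s v + C *v w) p 0"

lemma poly_act_0 [simp]: "poly_act 0 v = 0"
  by (simp add: poly_act_def)

lemma poly_act_pCons [simp]: "poly_act (pCons a p) v = a *s v + C *v poly_act p v"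
  by (cases "p = 0 \<and> a = 0")
     (auto simp: poly_act_def fold_coeffs_pCons_coeff_not_0_eq fold_coeffs_pCons_not_0_0_eq)

lemma poly_act_add: "poly_act (p + q) v = poly_act p v + poly_act q v"
  by (induction p q rule: poly_induct2)
     (auto simp: matrix_vector_right_distrib vector_sadd_rdistrib algebra_simps)

lemma poly_act_smult: "poly_act (smult c p) v = c *s poly_act p v"
  by (induction p) (auto simp: vector_scalar_commute[symmetric] vector_add_ldistrib vector_smult_assoc)

lemma poly_act_linear_factor: "poly_act ([:-c, 1:] * q) v = C *v poly_act q v - c *s poly_act q v"
proof -
  have "[:-c, 1:] * q = smult (-c) q + pCons 0 q" by (simp add: mult_pCons_left)
  then show ?thesis by (simp only: poly_act_add poly_act_smult poly_act_pCons) (simp add: vec_eq_iff)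
qed

lemma poly_act_diff: "poly_act p (v - w) = poly_act p v - poly_act p w"
  by (induction p) (auto simp: matrix_vector_mult_diff_distrib vector_ssub_ldistrib)

lemma poly_act_scale: "poly_act p (c *s v) = c *s poly_act p v"
  by (induction p)
     (auto simp: vector_scalar_commute[symmetric] vector_add_ldistrib vector_smult_assoc mult.commute)

lemma poly_act_mat: "poly_act p (C *v v) = C *v poly_act p v"
  by (induction p) (auto simp: vector_scalar_commute matrix_vector_right_distrib)

lemma poly_act_monom: "poly_act (monom a i) v = a *s (((*v) C ^^ i) v)"
  by (induction i) (auto simp: monom_0 monom_Suc vector_scalar_commute)

lemma poly_act_sum: "poly_act (\<Sum>i\<in>I. p i) v = (\<Sum>i\<in>I. poly_act (p i) v)"
  by (induction I rule: infinite_finite_induct) (auto simp: poly_act_add)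

lemma annihilating_poly_exists: "\<exists>p. p \<noteq> 0 \<and> poly_act p v = 0"
proof -
  obtain c :: "nat \<Rightarrow> real" and N where c: "\<exists>i\<le>N. c i \<noteq> 0" "(\<Sum>i\<le>N. c i *\<^sub>R (((*v) C ^^ i) v)) = 0"
    by (rule real_dependent_family)
  let ?p = "\<Sum>i\<le>N. monom (complex_of_real (c i)) i"
  obtain i where i: "i \<le> N" "c i \<noteq> 0" using c by blast
  have "coeff ?p i = complex_of_real (c i)"
    using i by (simp add: coeff_sum)
  then have "?p \<noteq> 0" using i by (metis coeff_0 of_real_eq_0_iff)
  moreover have "c i *\<^sub>R x = complex_of_real (c i) *s x" for i and x :: "complex^'d"
    unfolding vec_eq_iff vector_scaleR_component vector_smult_component by (simp add: scaleR_conv_of_real)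
  then have "poly_act ?p v = 0" using c(2) by (simp add: poly_act_sum poly_act_monom)
  ultimately show ?thesis by blast
qed

lemma poly_root_factor:
  fixes p :: "complex poly"
  assumes "p \<noteq> 0" "poly p c = 0"
  obtains q where "p = [:-c, 1:] * q" "q \<noteq> 0" "degree q < degree p"
proof -
  from assms(2) obtain q where q: "p = [:-c, 1:] * q" by (auto simp: poly_eq_0_iff_dvd dvd_def)
  then have "q \<noteq> 0" using assms by auto
  then have "degree p = Suc (degree q)" unfolding q by (subst degree_mult_eq) auto
  then show thesis using that q \<open>q \<noteq> 0\<close> by auto
qed

text \<open>Splitting off one linear factor of the annihilating polynomial at a time avoids the Jordan normal form.\<close>

lemma summable_powers_of_annihilated:
  assumes "p \<noteq> 0" "\<And>c. poly p c = 0 \<Longrightarrow> cmod c < 1" "poly_act p v = 0"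
  shows "summable (\<lambda>k. norm (((*v) C ^^ k) v))"
  using assms
proof (induction "degree p" arbitrary: p v rule: less_induct)
  case less
  show ?case
  proof (cases "degree p = 0")
    case True
    then obtain a where "p = [:a:]" by (metis degree_eq_zeroE)
    with less have "v = 0" by (auto simp: vector_mul_eq_0)
    moreover have "((*v) C ^^ k) 0 = 0" for k by (induction k) auto
    ultimately show ?thesis by simp
  next
    case False
    then obtain c where c: "poly p c = 0"
      using fundamental_theorem_of_algebra[of p] by (auto simp: constant_degree)
    obtain q where q: "p = [:-c, 1:] * q" "q \<noteq> 0" "degree q < degree p"
      using poly_root_factor[OF less.prems(1) c] by blast
    let ?w = "C *v v - c *s v"
    have "poly_act q ?w = 0"
      using less.prems(3)
      by (simp add: q(1) poly_act_linear_factor poly_act_diff poly_act_mat poly_act_scale del: mult_pCons_left)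
    then have w: "summable (\<lambda>k. norm (((*v) C ^^ k) ?w))"
      using less.hyps[OF q(3) q(2)] less.prems(2) q(1) by auto
    have lin: "((*v) C ^^ k) (x - c *s y) = ((*v) C ^^ k) x - c *s ((*v) C ^^ k) y" for k x y
      by (induction k) (auto simp: matrix_vector_mult_diff_distrib vector_scalar_commute)
    have "((*v) C ^^ Suc k) v = c *s ((*v) C ^^ k) v + ((*v) C ^^ k) ?w" for k
      unfolding lin by (simp add: funpow_swap1)
    then have "norm (((*v) C ^^ Suc k) v) \<le> cmod c * norm (((*v) C ^^ k) v) + norm (((*v) C ^^ k) ?w)" for k
      using norm_triangle_ineq[of "c *s ((*v) C ^^ k) v" "((*v) C ^^ k) ?w"]
      by (simp add: norm_scale_complex_vec del: funpow.simps)
    then show ?thesis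
      by (rule summable_norm_recurrence) (use less.prems(2)[OF c] w in auto)
  qed
qed

lemma summable_powers_of_spectral_radius_less_1:
  assumes spectral_radius: "\<And>c w. w \<noteq> 0 \<Longrightarrow> C *v w = c *s w \<Longrightarrow> cmod c < 1"
  shows "summable (\<lambda>k. norm (((*v) C ^^ k) v))"
proof -
  define p where "p = arg_min degree (\<lambda>p. p \<noteq> 0 \<and> poly_act p v = 0)"
  have p: "p \<noteq> 0" "poly_act p v = 0"
    using arg_min_natI[of "\<lambda>p. p \<noteq> 0 \<and> poly_act p v = 0"] annihilating_poly_exists[of v]
    unfolding p_def by blast+
  have min: "degree p \<le> degree q" if "q \<noteq> 0" "poly_act q v = 0" for q
    using arg_min_nat_le[of "\<lambda>p. p \<noteq> 0 \<and> poly_act p v = 0" q degree] that unfolding p_def by blast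
  have "cmod c < 1" if c: "poly p c = 0" for c
  proof -
    obtain q where q: "p = [:-c, 1:] * q" "q \<noteq> 0" "degree q < degree p"
      using poly_root_factor[OF p(1) c] by blast
    then have "poly_act q v \<noteq> 0" using min[of q] by auto
    moreover have "C *v poly_act q v = c *s poly_act q v"
      using p(2) by (simp add: q(1) poly_act_linear_factor del: mult_pCons_left)
    ultimately show ?thesis by (rule spectral_radius)
  qed
  then show ?thesis using summable_powers_of_annihilated p by blast
qed

end

lemma mat_pow_0 [simp]: "mat_pow B 0 = mat 1"
  and mat_pow_Suc: "mat_pow B (Suc k) = B ** mat_pow B k"
  by (simp_all add: mat_pow_def)

lemma mat_pow_vec: "mat_pow B k *v x = ((*v) B ^^ k) x"
  by (induction k) (auto simp: mat_pow_Suc matrix_vector_mul_assoc[symmetric])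

lemma mat_pow_Suc_vec: "mat_pow M (Suc k) *v x = mat_pow M k *v (M *v x)"
  by (simp add: mat_pow_vec funpow_swap1)

lemma det_mat_pow: "det (mat_pow B k) = det B ^ k"
  by (induction k) (auto simp: mat_pow_Suc det_mul)

lemma mat_pow_inverse:
  fixes B :: "real^'d::finite^'d"
  assumes det: "det B \<noteq> 0"
  shows "mat_pow (matrix_inv B) k *v (mat_pow B k *v x) = x"
    "mat_pow B k *v (mat_pow (matrix_inv B) k *v x) = x"
proof -
  have cancel: "(g ^^ k) ((f ^^ k) x) = x" if "\<And>x. g (f x) = x" for f g :: "real^'d \<Rightarrow> real^'d" and x
    by (induction k arbitrary: x) (auto simp: funpow_swap1 that)
  show "mat_pow (matrix_inv B) k *v (mat_pow B k *v x) = x" "mat_pow B k *v (mat_pow (matrix_inv B) k *v x) = x"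
    unfolding mat_pow_vec by (rule cancel, simp add: matrix_inv_invertible[OF det])+
qed

definition cvec :: "real^'d::finite \<Rightarrow> complex^'d" where
  "cvec x = (\<chi> i. complex_of_real (x $ i))"

lemma norm_cvec: "norm (cvec x) = norm x"
  by (simp add: norm_vec_def cvec_def)

lemma map_matrix_of_real_mult:
  "map_matrix complex_of_real (A ** B) = map_matrix complex_of_real A ** map_matrix complex_of_real B"
  by (simp add: vec_eq_iff map_matrix_def matrix_matrix_mult_def)

lemma map_matrix_of_real_vec: "map_matrix complex_of_real A *v cvec x = cvec (A *v x)"
  by (simp add: vec_eq_iff map_matrix_def matrix_vector_mult_def cvec_def)

lemma summable_inverse_powers:
  fixes B :: "real^'d::finite^'d"
  assumes expansive: "expansive B" and det: "det B \<noteq> 0"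
  shows "summable (\<lambda>k. norm (mat_pow (matrix_inv B) k *v x))"
proof -
  let ?B = "map_matrix complex_of_real B" and ?C = "map_matrix complex_of_real (matrix_inv B)"
  have inverse: "?B ** ?C = mat 1"
    unfolding map_matrix_of_real_mult[symmetric] matrix_inv_invertible(1)[OF det]
    by (simp add: vec_eq_iff map_matrix_def mat_def)
  have eigenvalue: "cmod c < 1" if w: "w \<noteq> 0" "?C *v w = c *s w" for c w
  proof -
    have w_eq: "w = c *s (?B *v w)"
      using arg_cong[OF w(2), of "(*v) ?B"] by (simp add: matrix_vector_mul_assoc inverse vector_scalar_commute)
    then have c: "c \<noteq> 0" using w(1) by auto
    have "?B *v w = (1 / c) *s w"
      by (subst (2) w_eq) (simp add: vector_smult_assoc c)
    then have "1 < cmod (1 / c)" using expansive w(1) unfolding expansive_def by blast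
    then show ?thesis using c by (simp add: norm_divide field_simps)
  qed
  have "((*v) ?C ^^ k) (cvec x) = cvec (((*v) (matrix_inv B) ^^ k) x)" for k
    by (induction k) (auto simp: map_matrix_of_real_vec)
  then show ?thesis
    using summable_powers_of_spectral_radius_less_1[of ?C "cvec x", OF eigenvalue]
    by (simp add: norm_cvec mat_pow_vec)
qed

lemma summable_onorm_inverse_powers:
  fixes B :: "real^'d::finite^'d"
  assumes "expansive B" "det B \<noteq> 0"
  shows "summable (\<lambda>k. onorm ((*v) (mat_pow (matrix_inv B) k)))"
proof (rule summable_comparison_test'[where N=0])
  show "summable (\<lambda>k. \<Sum>b\<in>Basis. norm (mat_pow (matrix_inv B) k *v b))"
    by (intro summable_sum summable_inverse_powers assms)
  show "norm (onorm ((*v) (mat_pow (matrix_inv B) k))) \<le> (\<Sum>b\<in>Basis. norm (mat_pow (matrix_inv B) k *v b))" for k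
    using onorm_componentwise[OF matrix_vector_mul_bounded_linear, of "mat_pow (matrix_inv B) k"]
      onorm_pos_le[OF matrix_vector_mul_bounded_linear, of "mat_pow (matrix_inv B) k"] by simp
qed

lemma expansive_similar:
  fixes S B B' :: "real^'d::finite^'d"
  assumes expansive: "expansive B'" and det: "det S \<noteq> 0" and similar: "S ** B' = B ** S"
  shows "expansive B"
  unfolding expansive_def
proof (intro allI impI)
  fix c :: complex assume "\<exists>v. v \<noteq> 0 \<and> map_matrix complex_of_real B *v v = c *s v"
  then obtain v where v: "v \<noteq> 0" "map_matrix complex_of_real B *v v = c *s v" by blast
  let ?T = "map_matrix complex_of_real (matrix_inv S)"
  have "B' ** matrix_inv S = matrix_inv S ** (S ** B') ** matrix_inv S"
    by (simp add: matrix_mul_assoc matrix_inv_invertible[OF det])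
  also have "\<dots> = matrix_inv S ** B"
    unfolding similar by (simp add: matrix_mul_assoc[symmetric] matrix_inv_invertible[OF det])
  finally have "map_matrix complex_of_real B' *v (?T *v v) = c *s (?T *v v)"
    by (simp add: matrix_vector_mul_assoc map_matrix_of_real_mult[symmetric])
       (simp add: map_matrix_of_real_mult matrix_vector_mul_assoc[symmetric] v(2) vector_scalar_commute)
  moreover have "map_matrix complex_of_real S ** ?T = mat 1"
    unfolding map_matrix_of_real_mult[symmetric] matrix_inv_invertible(1)[OF det]
    by (simp add: vec_eq_iff map_matrix_def mat_def)
  then have "map_matrix complex_of_real S *v (?T *v v) = v"
    by (simp add: matrix_vector_mul_assoc)
  then have "?T *v v \<noteq> 0" using v(1) by auto
  ultimately show "1 < cmod c" using expansive unfolding expansive_def by blast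
qed

lemma norm_matrix_vector_le_onorm:
  "norm (M *v x) \<le> onorm ((*v) M) * norm x" for M :: "real^'n::finite^'m::finite"
  by (rule onorm) (rule matrix_vector_mul_bounded_linear)

lemma onorm_matrix_nonneg [simp]: "0 \<le> onorm ((*v) M)" for M :: "real^'n::finite^'m::finite"
  by (rule onorm_pos_le) (rule matrix_vector_mul_bounded_linear)

lemma onorm_powers_bounded:
  fixes C :: "real^'d::finite^'d"
  assumes "summable (\<lambda>k. onorm ((*v) (mat_pow C k)))"
  obtains D where "D \<ge> 0" "\<And>k. onorm ((*v) (mat_pow C k)) \<le> D"
proof -
  obtain D where D: "\<forall>k. norm (onorm ((*v) (mat_pow C k))) \<le> D"
    using summable_imp_Bseq[OF assms] by (rule BseqE)
  have "onorm ((*v) (mat_pow C k)) \<le> D" for k using D[rule_format, of k] by simp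
  moreover from this[of 0] have "D \<ge> 0" by (rule order_trans[OF onorm_matrix_nonneg])
  ultimately show thesis by (rule that[rotated])
qed

lemma mat_pow_vec_tendsto_0:
  fixes C :: "real^'d::finite^'d"
  assumes "summable (\<lambda>k. onorm ((*v) (mat_pow C k)))"
  shows "(\<lambda>k. mat_pow C k *v x) \<longlonglongrightarrow> 0"
proof (rule Lim_null_comparison)
  show "\<forall>\<^sub>F k in sequentially. norm (mat_pow C k *v x) \<le> onorm ((*v) (mat_pow C k)) * norm x"
    by (simp add: norm_matrix_vector_le_onorm)
  show "(\<lambda>k. onorm ((*v) (mat_pow C k)) * norm x) \<longlonglongrightarrow> 0"
    using summable_LIMSEQ_zero[OF assms] by (rule tendsto_mult_left_zero)
qed

section \<open>Extending Bessel and Parseval identities from a dense class\<close>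

lemma Bessel_extend:
  fixes e :: "'i \<Rightarrow> real^'d::finite \<Rightarrow> complex"
  assumes e: "\<And>i. i \<in> F \<Longrightarrow> square_integrable (e i)" and F: "finite F"
    and Bessel_Cc: "\<And>u. Cc u \<Longrightarrow> (\<Sum>i\<in>F. (cmod (L2_inner u (e i)))\<^sup>2) \<le> L2_norm_sq u"
    and f: "square_integrable f"
  shows "(\<Sum>i\<in>F. (cmod (L2_inner f (e i)))\<^sup>2) \<le> L2_norm_sq f"
proof -
  obtain u where u: "\<And>n. Cc (u n)" "(\<lambda>n. L2_norm (\<lambda>x. u n x - f x)) \<longlonglongrightarrow> 0"
    using Cc_dense_sequence[OF f] by blast
  note su = Cc_square_integrable[OF u(1)]
  have "(\<lambda>n. \<Sum>i\<in>F. (cmod (L2_inner (u n) (e i)))\<^sup>2) \<longlonglongrightarrow> (\<Sum>i\<in>F. (cmod (L2_inner f (e i)))\<^sup>2)"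
    by (intro tendsto_sum tendsto_power tendsto_norm L2_inner_tendsto_left[OF su f e u(2)])
  moreover have "(\<lambda>n. (L2_norm (u n))\<^sup>2) \<longlonglongrightarrow> (L2_norm f)\<^sup>2"
    by (intro tendsto_power L2_norm_tendsto[OF su f u(2)])
  ultimately show ?thesis
    using Bessel_Cc[OF u(1)] by (intro LIMSEQ_le[where X="\<lambda>n. \<Sum>i\<in>F. (cmod (L2_inner (u n) (e i)))\<^sup>2"]) auto
qed

lemma Bessel_L2_set_diff_le:
  fixes e :: "'i \<Rightarrow> real^'d::finite \<Rightarrow> complex"
  assumes e: "\<And>i. i \<in> F \<Longrightarrow> square_integrable (e i)"
    and Bessel: "\<And>g. square_integrable g \<Longrightarrow> (\<Sum>i\<in>F. (cmod (L2_inner g (e i)))\<^sup>2) \<le> L2_norm_sq g"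
    and f: "square_integrable f" and g: "square_integrable g"
  shows "L2_set (\<lambda>i. cmod (L2_inner g (e i))) F
    \<le> L2_set (\<lambda>i. cmod (L2_inner f (e i))) F + L2_norm (\<lambda>x. g x - f x)"
proof -
  let ?d = "\<lambda>x. g x - f x"
  have "L2_set (\<lambda>i. cmod (L2_inner g (e i))) F
      \<le> L2_set (\<lambda>i. cmod (L2_inner f (e i)) + cmod (L2_inner ?d (e i))) F"
  proof (rule L2_set_mono)
    fix i assume "i \<in> F"
    then have "L2_inner g (e i) = L2_inner f (e i) + L2_inner ?d (e i)"
      using L2_inner_diff_left[OF g f e] by simp
    then show "cmod (L2_inner g (e i)) \<le> cmod (L2_inner f (e i)) + cmod (L2_inner ?d (e i))"
      by (simp add: norm_triangle_ineq)
  qed simp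
  also have "\<dots> \<le> L2_set (\<lambda>i. cmod (L2_inner f (e i))) F + L2_set (\<lambda>i. cmod (L2_inner ?d (e i))) F"
    by (rule L2_set_triangle_ineq)
  also have "L2_set (\<lambda>i. cmod (L2_inner ?d (e i))) F \<le> L2_norm ?d"
    unfolding L2_set_def L2_norm_def using Bessel[OF square_integrable_diff[OF g f]] by simp
  finally show ?thesis by simp
qed

lemma Parseval_norm_le:
  fixes e :: "'i \<Rightarrow> real^'d::finite \<Rightarrow> complex"
  assumes e: "\<And>i. i \<in> I \<Longrightarrow> square_integrable (e i)"
    and Bessel: "\<And>F g. finite F \<Longrightarrow> F \<subseteq> I \<Longrightarrow> square_integrable g \<Longrightarrow>
      (\<Sum>i\<in>F. (cmod (L2_inner g (e i)))\<^sup>2) \<le> L2_norm_sq g"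
    and Parseval: "((\<lambda>i. (cmod (L2_inner u (e i)))\<^sup>2) has_sum L2_norm_sq u) I"
    and u: "square_integrable u" and f: "square_integrable f"
    and summable: "(\<lambda>i. (cmod (L2_inner f (e i)))\<^sup>2) summable_on I"
  shows "L2_norm u \<le> sqrt (\<Sum>\<^sub>\<infinity>i\<in>I. (cmod (L2_inner f (e i)))\<^sup>2) + L2_norm (\<lambda>x. u x - f x)"
    (is "_ \<le> sqrt ?Q + _")
proof (rule power2_le_imp_le)
  have "(\<Sum>i\<in>F. (cmod (L2_inner u (e i)))\<^sup>2) \<le> (sqrt ?Q + L2_norm (\<lambda>x. u x - f x))\<^sup>2"
    if F: "finite F" "F \<subseteq> I" for F
  proof -
    have "L2_set (\<lambda>i. cmod (L2_inner u (e i))) F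
        \<le> L2_set (\<lambda>i. cmod (L2_inner f (e i))) F + L2_norm (\<lambda>x. u x - f x)"
      using e F Bessel[OF F] by (intro Bessel_L2_set_diff_le f u) auto
    also have "L2_set (\<lambda>i. cmod (L2_inner f (e i))) F \<le> sqrt ?Q"
      unfolding L2_set_def by (intro real_sqrt_le_mono finite_sum_le_infsum summable F) simp
    finally have "(L2_set (\<lambda>i. cmod (L2_inner u (e i))) F)\<^sup>2 \<le> (sqrt ?Q + L2_norm (\<lambda>x. u x - f x))\<^sup>2"
      by (intro power_mono) auto
    then show ?thesis by (simp add: L2_set_def sum_nonneg)
  qed
  then show "(L2_norm u)\<^sup>2 \<le> (sqrt ?Q + L2_norm (\<lambda>x. u x - f x))\<^sup>2"
    unfolding L2_norm_power2 by (rule has_sum_le_finite_sums[OF Parseval])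
qed (intro add_nonneg_nonneg real_sqrt_ge_zero infsum_nonneg L2_norm_nonneg, simp)

lemma Parseval_extend:
  fixes e :: "'i \<Rightarrow> real^'d::finite \<Rightarrow> complex"
  assumes e: "\<And>i. i \<in> I \<Longrightarrow> square_integrable (e i)"
    and Parseval_Cc: "\<And>u. Cc u \<Longrightarrow> ((\<lambda>i. (cmod (L2_inner u (e i)))\<^sup>2) has_sum L2_norm_sq u) I"
    and f: "square_integrable f"
  shows "((\<lambda>i. (cmod (L2_inner f (e i)))\<^sup>2) has_sum L2_norm_sq f) I"
proof -
  let ?sq = "\<lambda>g i. (cmod (L2_inner g (e i)))\<^sup>2"
  have Bessel: "(\<Sum>i\<in>F. ?sq g i) \<le> L2_norm_sq g" if F: "finite F" "F \<subseteq> I" and g: "square_integrable g" for F g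
  proof (rule Bessel_extend[OF _ F(1) _ g])
    show "square_integrable (e i)" if "i \<in> F" for i using e F(2) that by blast
    show "(\<Sum>i\<in>F. ?sq u i) \<le> L2_norm_sq u" if "Cc u" for u
      by (rule finite_sum_le_has_sum[OF Parseval_Cc[OF that] F]) simp
  qed
  have summable: "?sq f summable_on I"
    using Bessel[OF _ _ f]
    by (intro nonneg_bdd_above_summable_on) (auto intro!: bdd_aboveI[of _ "L2_norm_sq f"])
  define Q where "Q = infsum (?sq f) I"
  have Q_le: "Q \<le> L2_norm_sq f"
    unfolding Q_def by (rule infsum_le_finite_sums[OF summable Bessel[OF _ _ f]])
  have Q_nonneg: "0 \<le> Q" unfolding Q_def by (rule infsum_nonneg) simp
  obtain u where u: "\<And>n. Cc (u n)" "(\<lambda>n. L2_norm (\<lambda>x. u n x - f x)) \<longlonglongrightarrow> 0"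
    using Cc_dense_sequence[OF f] by blast
  note u_sq = Cc_square_integrable[OF u(1)]
  have "L2_norm (u n) \<le> sqrt Q + L2_norm (\<lambda>x. u n x - f x)" for n
    unfolding Q_def by (rule Parseval_norm_le[OF e Bessel Parseval_Cc[OF u(1)] u_sq f summable])
  moreover have "(\<lambda>n. sqrt Q + L2_norm (\<lambda>x. u n x - f x)) \<longlonglongrightarrow> sqrt Q + 0"
    by (intro tendsto_intros u(2))
  ultimately have "L2_norm f \<le> sqrt Q"
    using LIMSEQ_le[OF L2_norm_tendsto[OF u_sq f u(2)]] by auto
  then have "(L2_norm f)\<^sup>2 \<le> (sqrt Q)\<^sup>2" by (intro power_mono) auto
  with Q_le Q_nonneg have "Q = L2_norm_sq f" by simp
  then show ?thesis using has_sum_infsum[OF summable] unfolding Q_def by simp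
qed

text \<open>The synthesis operator of a Bessel family is a contraction, since it is adjoint to the analysis operator.\<close>

lemma Bessel_synthesis_contraction:
  fixes e :: "'i \<Rightarrow> real^'d::finite \<Rightarrow> complex" and c :: "'i \<Rightarrow> complex"
  assumes e: "\<And>i. i \<in> F \<Longrightarrow> square_integrable (e i)"
    and Bessel: "\<And>g. square_integrable g \<Longrightarrow> (\<Sum>i\<in>F. (cmod (L2_inner g (e i)))\<^sup>2) \<le> L2_norm_sq g"
  shows "L2_norm_sq (\<lambda>x. \<Sum>i\<in>F. c i * e i x) \<le> (\<Sum>i\<in>F. (cmod (c i))\<^sup>2)"
proof -
  let ?u = "\<lambda>x. \<Sum>i\<in>F. c i * e i x" and ?S = "\<Sum>i\<in>F. (cmod (c i))\<^sup>2"
  have u: "square_integrable ?u" by (intro square_integrable_sum square_integrable_cmult e)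
  have "L2_inner ?u ?u = (\<Sum>i\<in>F. cnj (c i) * L2_inner ?u (e i))"
    unfolding L2_inner_cmult_right[symmetric] by (intro L2_inner_sum_right square_integrable_cmult e u)
  from arg_cong[OF this, of cmod]
  have "(L2_norm ?u)\<^sup>2 = cmod (\<Sum>i\<in>F. cnj (c i) * L2_inner ?u (e i))"
    unfolding L2_inner_self L2_norm_power2 norm_of_real abs_of_nonneg[OF L2_norm_sq_nonneg] .
  also have "\<dots> \<le> (\<Sum>i\<in>F. cmod (c i) * cmod (L2_inner ?u (e i)))"
    by (rule sum_norm_le) (simp add: norm_mult)
  also have "\<dots> \<le> L2_set (\<lambda>i. cmod (c i)) F * L2_set (\<lambda>i. cmod (L2_inner ?u (e i))) F"
    using L2_set_mult_ineq[of "\<lambda>i. cmod (c i)" "\<lambda>i. cmod (L2_inner ?u (e i))" F] by simp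
  also have "\<dots> \<le> sqrt ?S * L2_norm ?u"
    unfolding L2_set_def L2_norm_def using Bessel[OF u] by (intro mult_left_mono) (auto intro: sum_nonneg)
  finally have "L2_norm ?u * L2_norm ?u \<le> sqrt ?S * L2_norm ?u" by (simp only: power2_eq_square)
  then have "L2_norm ?u \<le> sqrt ?S \<or> L2_norm ?u = 0"
    using L2_norm_nonneg[of ?u] unfolding mult_le_cancel_right by linarith
  then have "L2_norm ?u \<le> sqrt ?S" by (auto simp: sum_nonneg)
  then show ?thesis by (simp add: L2_norm_def)
qed

lemma L2_norm_sq_diff:
  assumes f: "square_integrable f" and g: "square_integrable g"
  shows "L2_norm_sq (\<lambda>x. f x - g x) = L2_norm_sq f - 2 * Re (L2_inner f g) + L2_norm_sq g"
proof -
  let ?d = "\<lambda>x. f x - g x"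
  note d = square_integrable_diff[OF f g]
  have inner_diff: "L2_inner k ?d = L2_inner k f - L2_inner k g" if "square_integrable k" for k
    using arg_cong[OF L2_inner_diff_left[OF f g that], of cnj] unfolding L2_inner_commute[of _ k] by simp
  have "of_real (L2_norm_sq ?d) = (L2_inner f f - L2_inner f g) - (L2_inner g f - L2_inner g g)"
    unfolding L2_inner_self[symmetric] L2_inner_diff_left[OF f g d] inner_diff[OF f] inner_diff[OF g] ..
  from arg_cong[OF this, of Re] show ?thesis
    using arg_cong[OF L2_inner_commute[of g f], of Re] by (simp add: L2_inner_self)
qed

lemma Bessel_approximation:
  fixes e :: "'i \<Rightarrow> real^'d::finite \<Rightarrow> complex"
  assumes e: "\<And>i. i \<in> F \<Longrightarrow> square_integrable (e i)"
    and Bessel: "\<And>g. square_integrable g \<Longrightarrow> (\<Sum>i\<in>F. (cmod (L2_inner g (e i)))\<^sup>2) \<le> L2_norm_sq g"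
    and f: "square_integrable f"
  shows "L2_norm_sq (\<lambda>x. f x - (\<Sum>i\<in>F. L2_inner f (e i) * e i x))
      \<le> L2_norm_sq f - (\<Sum>i\<in>F. (cmod (L2_inner f (e i)))\<^sup>2)"
proof -
  let ?u = "\<lambda>x. \<Sum>i\<in>F. L2_inner f (e i) * e i x" and ?S = "\<Sum>i\<in>F. (cmod (L2_inner f (e i)))\<^sup>2"
  have u: "square_integrable ?u" by (intro square_integrable_sum square_integrable_cmult e)
  have "L2_inner f ?u = (\<Sum>i\<in>F. cnj (L2_inner f (e i)) * L2_inner f (e i))"
    unfolding L2_inner_cmult_right[symmetric] by (intro L2_inner_sum_right square_integrable_cmult e f)
  then have "L2_inner f ?u = of_real ?S"
    by (simp only: of_real_sum complex_norm_square mult.commute)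
  then show ?thesis
    using Bessel_synthesis_contraction[where e=e and F=F and c="\<lambda>i. L2_inner f (e i)", OF e Bessel]
    unfolding L2_norm_sq_diff[OF f u] by simp
qed

section \<open>The integer lattice\<close>

lemma Zd_0 [simp]: "0 \<in> Zd" and Zd_add: "x \<in> Zd \<Longrightarrow> y \<in> Zd \<Longrightarrow> x + y \<in> Zd"
  and Zd_diff: "x \<in> Zd \<Longrightarrow> y \<in> Zd \<Longrightarrow> x - y \<in> Zd"
  by (auto simp: Zd_def)

lemma Zd_integral_matrix:
  assumes "integral_matrix B" "x \<in> Zd"
  shows "B *v x \<in> Zd"
  using assms by (auto simp: Zd_def integral_matrix_def matrix_vector_mult_def intro!: Ints_sum Ints_mult)

lemma finite_Zd_bounded: "finite {l::real^'d::finite. l \<in> Zd \<and> (\<forall>i. \<bar>l $ i\<bar> \<le> r)}"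
proof -
  let ?X = "real_of_int ` {- \<lceil>r\<rceil>..\<lceil>r\<rceil>}"
  have "{l::real^'d. l \<in> Zd \<and> (\<forall>i. \<bar>l $ i\<bar> \<le> r)} \<subseteq> (\<lambda>f. \<chi> i. f i) ` (PiE UNIV (\<lambda>_. ?X))"
  proof
    fix l :: "real^'d" assume l: "l \<in> {l. l \<in> Zd \<and> (\<forall>i. \<bar>l $ i\<bar> \<le> r)}"
    have "l $ i \<in> ?X" for i
    proof -
      obtain k :: int where k: "l $ i = of_int k" using l by (auto simp: Zd_def Ints_def)
      have "\<bar>of_int k :: real\<bar> \<le> r" using l k by (metis (mono_tags, lifting) mem_Collect_eq)
      then have "k \<in> {- \<lceil>r\<rceil>..\<lceil>r\<rceil>}" by (auto simp: abs_le_iff) linarith+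
      then show ?thesis using k by blast
    qed
    then show "l \<in> (\<lambda>f. \<chi> i. f i) ` (PiE UNIV (\<lambda>_. ?X))"
      by (intro image_eqI[of _ _ "\<lambda>i. l $ i"]) (auto simp: vec_eq_iff)
  qed
  then show ?thesis by (rule finite_subset) (intro finite_imageI finite_PiE, auto)
qed

lemma finite_Zd_cball: "finite {l::real^'d::finite. l \<in> Zd \<and> norm l \<le> r}"
  by (rule finite_subset[OF _ finite_Zd_bounded[of r]]) (use component_le_norm_cart order_trans in blast)

definition vec_floor :: "real^'d::finite \<Rightarrow> real^'d" where
  "vec_floor t = (\<chi> i. of_int \<lfloor>t $ i\<rfloor>)"

lemma vec_floor_Zd [simp]: "vec_floor t \<in> Zd"
  by (simp add: vec_floor_def Zd_def)

lemma norm_diff_vec_floor_le: "norm (t - vec_floor t) \<le> CARD('d)" for t :: "real^'d::finite"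
proof -
  have "\<bar>(t - vec_floor t) $ i\<bar> \<le> 1" for i
    by (simp add: vec_floor_def abs_le_iff) linarith
  then have "(\<Sum>i\<in>UNIV. \<bar>(t - vec_floor t) $ i\<bar>) \<le> (\<Sum>i\<in>(UNIV::'d set). 1)"
    by (intro sum_mono)
  then show ?thesis using norm_le_l1_cart[of "t - vec_floor t"] by simp
qed

lemma refined_lattice_dist_le:
  fixes B :: "real^'d::finite^'d"
  assumes "det B \<noteq> 0"
  shows "norm (t - mat_pow (matrix_inv B) k *v vec_floor (mat_pow B k *v t))
    \<le> onorm ((*v) (mat_pow (matrix_inv B) k)) * CARD('d)"
proof -
  let ?C = "mat_pow (matrix_inv B) k" and ?s = "mat_pow B k *v t"
  have "t - ?C *v vec_floor ?s = ?C *v (?s - vec_floor ?s)"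
    by (simp add: matrix_vector_mult_diff_distrib mat_pow_inverse[OF assms])
  also have "norm \<dots> \<le> onorm ((*v) ?C) * norm (?s - vec_floor ?s)"
    by (rule norm_matrix_vector_le_onorm)
  also have "\<dots> \<le> onorm ((*v) ?C) * CARD('d)"
    by (intro mult_left_mono norm_diff_vec_floor_le onorm_matrix_nonneg)
  finally show ?thesis .
qed

lemma vec_floor_eq_iff:
  assumes "l \<in> Zd"
  shows "vec_floor t = l \<longleftrightarrow> (\<forall>i. l $ i \<le> t $ i \<and> t $ i < l $ i + 1)"
proof -
  have "real_of_int \<lfloor>t $ i\<rfloor> = l $ i \<longleftrightarrow> l $ i \<le> t $ i \<and> t $ i < l $ i + 1" for i
  proof -
    obtain k :: int where k: "l $ i = of_int k" using assms by (auto simp: Zd_def Ints_def)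
    show ?thesis unfolding k using floor_eq_iff[of "t $ i" k] by auto
  qed
  then show ?thesis by (simp add: vec_floor_def vec_eq_iff)
qed

lemma vec_floor_cell:
  fixes l :: "real^'d::finite"
  assumes l: "l \<in> Zd"
  shows "{t. vec_floor t = l} \<in> sets lebesgue" "emeasure lebesgue {t. vec_floor t = l} = 1"
proof -
  let ?cell = "{t. vec_floor t = l}" and ?u = "l + (\<chi> i. 1)"
  have inclusions: "box l ?u \<subseteq> ?cell" "?cell \<subseteq> cbox l ?u"
    by (auto simp: vec_floor_eq_iff[OF l] mem_box_cart less_imp_le)
  have "?cell = (\<Inter>i\<in>UNIV. {t. l $ i \<le> t $ i} \<inter> {t. t $ i < l $ i + 1})"
    by (auto simp: vec_floor_eq_iff[OF l])
  also have "\<dots> \<in> sets borel"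
    by (intro sets.finite_INT sets.Int)
       (auto intro!: borel_closed borel_open closed_halfspace_component_ge_cart open_halfspace_component_lt_cart)
  finally have borel: "?cell \<in> sets borel" .
  then show "?cell \<in> sets lebesgue" by simp
  have "measure lborel (cbox l ?u) = 1" by (simp add: content_cbox_if_cart interval_eq_empty_cart)
  then have cbox: "emeasure lborel (cbox l ?u) = 1"
    using emeasure_eq_ennreal_measure[of lborel "cbox l ?u"] emeasure_lborel_cbox_finite[of l ?u]
    by (simp add: less_top)
  then have box: "emeasure lborel (box l ?u) = 1"
    by (simp add: emeasure_lborel_box_eq emeasure_lborel_cbox_eq)
  have "emeasure lborel ?cell = 1"
  proof (rule antisym)
    show "emeasure lborel ?cell \<le> 1" using emeasure_mono[OF inclusions(2), of lborel] cbox by simp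
    show "1 \<le> emeasure lborel ?cell" using emeasure_mono[OF inclusions(1), of lborel] box borel by simp
  qed
  then show "emeasure lebesgue ?cell = 1" using borel by simp
qed

lemma integral_step_function:
  fixes F :: "real^'d::finite \<Rightarrow> real"
  assumes K: "finite K" "K \<subseteq> Zd" and support: "\<And>l. l \<in> Zd \<Longrightarrow> l \<notin> K \<Longrightarrow> F l = 0"
  shows "integrable lebesgue (\<lambda>t. F (vec_floor t))" "(LINT t|lebesgue. F (vec_floor t)) = (\<Sum>l\<in>K. F l)"
proof -
  let ?cell = "\<lambda>l. {t. vec_floor t = l}"
  have step: "F (vec_floor t) = (\<Sum>l\<in>K. F l * indicator (?cell l) t)" for t
  proof -
    have "(\<Sum>l\<in>K. F l * indicator (?cell l) t) = (\<Sum>l\<in>K. if l = vec_floor t then F l else 0)"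
      by (intro sum.cong) auto
    then show ?thesis using K support[of "vec_floor t"] by simp
  qed
  have cell: "?cell l \<in> sets lebesgue" "emeasure lebesgue (?cell l) = 1" if "l \<in> K" for l
    using vec_floor_cell that K by blast+
  have integrable: "integrable lebesgue (\<lambda>t. F l * indicator (?cell l) t)" if "l \<in> K" for l
    using cell[OF that] by (intro integrable_mult_right integrable_real_indicator) auto
  show "integrable lebesgue (\<lambda>t. F (vec_floor t))"
    unfolding step by (intro Bochner_Integration.integrable_sum integrable)
  have "(LINT t|lebesgue. F (vec_floor t)) = (\<Sum>l\<in>K. LINT t|lebesgue. F l * indicator (?cell l) t)"
    unfolding step by (rule Bochner_Integration.integral_sum[OF integrable])
  also have "\<dots> = (\<Sum>l\<in>K. F l)"
  proof (intro sum.cong refl)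
    fix l assume "l \<in> K"
    then have "measure lebesgue (?cell l) = 1" unfolding measure_def by (simp only: cell) simp
    then show "(LINT t|lebesgue. F l * indicator (?cell l) t) = F l" by simp
  qed
  finally show "(LINT t|lebesgue. F (vec_floor t)) = (\<Sum>l\<in>K. F l)" .
qed

section \<open>Dilations and translations\<close>

lemma square_integrable_transl: "square_integrable f \<Longrightarrow> square_integrable (transl l f)"
  using square_integrable_affine(1)[of "mat 1" f "- l"] by (simp add: transl_def)

lemma AE_transl:
  assumes "AE t in lebesgue. f t = g t"
  shows "AE t in lebesgue. transl l f t = transl l g t"
  using AE_affine[of "mat 1" "\<lambda>t. f t = g t" "- l"] assms by (simp add: transl_def)

lemma transl_dil:
  fixes B :: "real^'d::finite^'d"
  shows "transl l (dil B f) = dil B (transl (B *v l) f)"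
  by (simp add: transl_def dil_def matrix_vector_mult_diff_distrib)

lemma transl_transl: "transl l (transl n f) = transl (l + n) f"
  by (simp add: transl_def diff_diff_eq)

lemma dil_pow_0 [simp]: "dil_pow B 0 f = f"
  by (simp add: dil_pow_def)

lemma dil_pow_induct:
  assumes "P f" "\<And>g. P g \<Longrightarrow> P (dil B g)" "\<And>g. P g \<Longrightarrow> P (dil_inv B g)"
  shows "P (dil_pow B n f)"
proof -
  have "P ((dil B ^^ k) f)" "P ((dil_inv B ^^ k) f)" for k
    by (induction k) (auto intro: assms)
  then show ?thesis by (simp add: dil_pow_def)
qed

lemma dil_pow_nat: "dil_pow B (int n) f t = complex_of_real (sqrt 2) ^ n * f (mat_pow B n *v t)"
proof -
  have "(dil B ^^ n) f t = complex_of_real (sqrt 2) ^ n * f (mat_pow B n *v t)"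
    by (induction n arbitrary: t) (auto simp: dil_def mat_pow_vec funpow_swap1[of "(*v) B"])
  then show ?thesis by (simp add: dil_pow_def)
qed

lemma dil_pow_neg_nat:
  "dil_pow B (- int n) f t = f (mat_pow (matrix_inv B) n *v t) / complex_of_real (sqrt 2) ^ n"
proof -
  have "(dil_inv B ^^ n) f t = f (mat_pow (matrix_inv B) n *v t) / complex_of_real (sqrt 2) ^ n"
    by (induction n arbitrary: t) (auto simp: dil_inv_def mat_pow_vec funpow_swap1[of "(*v) (matrix_inv B)"])
  then show ?thesis by (auto simp: dil_pow_def)
qed

lemma Cc_linear_compose:
  fixes M :: "real^'d::finite^'d" and u :: "real^'d \<Rightarrow> complex"
  assumes "Cc u" "det M \<noteq> 0"
  shows "Cc (\<lambda>t. c * u (M *v t))"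
proof -
  obtain R where R: "\<And>x. norm x > R \<Longrightarrow> u x = 0" and cont: "continuous_on UNIV u"
    using assms(1) by (auto simp: Cc_def)
  obtain K where K: "K > 0" "\<And>x. norm (matrix_inv M *v x) \<le> norm x * K"
    using bounded_linear.pos_bounded[OF matrix_vector_mul_bounded_linear[of "matrix_inv M"]] by blast
  have "u (M *v t) = 0" if "norm t > R * K" for t
  proof (rule R)
    have "norm t \<le> norm (M *v t) * K" using K(2)[of "M *v t"] by (simp add: matrix_inv_invertible[OF assms(2)])
    then show "norm (M *v t) > R" using that K(1) by (meson less_le_trans mult_less_cancel_right_pos)
  qed
  then show ?thesis
    unfolding Cc_def
    by (auto intro!: continuous_intros continuous_on_compose2[OF cont] exI[of _ "R * K"]
        matrix_vector_mult_linear_continuous_on)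
qed

context
  fixes B :: "real^'d::finite^'d"
  assumes det: "det B \<noteq> 0"
begin

lemma det_matrix_inv_nonzero: "det (matrix_inv B) \<noteq> 0"
  using det by (simp add: det_matrix_inv)

lemma dil_dil_inv: "dil B (dil_inv B f) = f"
  and dil_inv_dil: "dil_inv B (dil B f) = f"
  by (simp_all add: dil_def dil_inv_def matrix_inv_invertible[OF det])

lemma dil_pow_Suc: "dil_pow B (n + 1) f = dil B (dil_pow B n f)"
proof (cases "n \<ge> 0")
  case True
  then have "nat (n + 1) = Suc (nat n)" by simp
  with True show ?thesis by (simp add: dil_pow_def)
next
  case False
  then have "nat (- n) = Suc (nat (- (n + 1)))" by simp
  then have "dil_pow B n f = dil_inv B ((dil_inv B ^^ nat (- (n + 1))) f)"
    using False by (simp add: dil_pow_def)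
  moreover have "dil_pow B (n + 1) f = (dil_inv B ^^ nat (- (n + 1))) f"
    using False by (cases "n = -1") (auto simp: dil_pow_def)
  ultimately show ?thesis by (simp add: dil_dil_inv)
qed

lemma dil_pow_minus_1: "dil_pow B (n - 1) f = dil_inv B (dil_pow B n f)"
  using dil_pow_Suc[of "n - 1" f] by (simp add: dil_inv_dil)

lemma dil_pow_Suc': "dil_pow B (n + 1) f = dil_pow B n (dil B f)"
proof (induction n rule: int_induct[of _ 0])
  case base
  show ?case using dil_pow_Suc[of 0 f] by simp
next
  case (step1 i)
  then show ?case using dil_pow_Suc[of "i + 1" f] dil_pow_Suc[of i "dil B f"] by simp
next
  case (step2 i)
  then show ?case using dil_pow_minus_1[of "i + 1" f] dil_pow_minus_1[of i "dil B f"] by simp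
qed

lemma dil_pow_uminus_Suc: "dil_pow B (- (n + 1)) f = dil_inv B (dil_pow B (- n) f)"
  using dil_pow_minus_1[of "- n" f] by simp

lemma square_integrable_dil: "square_integrable f \<Longrightarrow> square_integrable (dil B f)"
  using square_integrable_cmult[OF square_integrable_affine(1)[OF det, of f 0], of "complex_of_real (sqrt 2)"]
  by (simp add: dil_def)

lemma square_integrable_dil_inv: "square_integrable f \<Longrightarrow> square_integrable (dil_inv B f)"
  using square_integrable_cmult[OF square_integrable_affine(1)[OF det_matrix_inv_nonzero, of f 0],
      of "1 / complex_of_real (sqrt 2)"]
  by (simp add: dil_inv_def)

lemma square_integrable_dil_pow: "square_integrable f \<Longrightarrow> square_integrable (dil_pow B n f)"
  by (rule dil_pow_induct) (auto intro: square_integrable_dil square_integrable_dil_inv)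

lemma Cc_dil_pow: "Cc u \<Longrightarrow> Cc (dil_pow B n u)"
proof (rule dil_pow_induct[where P=Cc])
  show "Cc (dil B g)" if "Cc g" for g
    unfolding dil_def by (rule Cc_linear_compose[OF that det])
  show "Cc (dil_inv B g)" if "Cc g" for g
    using Cc_linear_compose[OF that det_matrix_inv_nonzero, of "1 / complex_of_real (sqrt 2)"]
    by (simp add: dil_inv_def)
qed

lemma dil_pow_sum: "dil_pow B n (\<lambda>t. \<Sum>l\<in>F. c l * f l t) = (\<lambda>t. \<Sum>l\<in>F. c l * dil_pow B n (f l) t)"
proof (induction n rule: int_induct[of _ 0])
  case (step1 i)
  then show ?case unfolding dil_pow_Suc by (simp add: dil_def sum_distrib_left mult_ac)
next
  case (step2 i)
  then show ?case unfolding dil_pow_minus_1 by (simp add: dil_inv_def sum_divide_distrib)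
qed simp

end

context
  fixes B :: "real^'d::finite^'d"
  assumes abs_det: "\<bar>det B\<bar> = 2"
begin

lemma det_nonzero: "det B \<noteq> 0"
  using abs_det by auto

lemma L2_norm_sq_dil:
  assumes "square_integrable f"
  shows "L2_norm_sq (dil B f) = L2_norm_sq f"
proof -
  have "(L2_norm (dil B f))\<^sup>2 = L2_norm_sq f"
    unfolding dil_def L2_norm_cmult power_mult_distrib
    using square_integrable_affine(2)[OF det_nonzero assms, of 0] abs_det by (simp add: norm_mult)
  then show ?thesis by simp
qed

lemma L2_norm_sq_dil_inv: "square_integrable f \<Longrightarrow> L2_norm_sq (dil_inv B f) = L2_norm_sq f"
  using L2_norm_sq_dil[OF square_integrable_dil_inv[OF det_nonzero]] by (simp add: dil_dil_inv[OF det_nonzero])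

lemma L2_norm_sq_dil_pow:
  assumes "square_integrable f"
  shows "L2_norm_sq (dil_pow B n f) = L2_norm_sq f"
proof -
  have "square_integrable (dil_pow B n f) \<and> L2_norm_sq (dil_pow B n f) = L2_norm_sq f"
    by (rule dil_pow_induct)
       (use assms square_integrable_dil square_integrable_dil_inv det_nonzero L2_norm_sq_dil
          L2_norm_sq_dil_inv in auto)
  then show ?thesis ..
qed

lemma L2_inner_dil:
  assumes f: "square_integrable f" and g: "square_integrable g"
  shows "L2_inner f (dil B g) = L2_inner (dil_inv B f) g"
proof -
  define F where "F s = dil_inv B f s * cnj (g s)" for s
  have "integrable lebesgue F"
    unfolding F_def
    by (intro square_integrable_mult_integrable square_integrable_dil_inv square_integrable_cnj det_nonzero f g)
  then have change: "(LINT t|lebesgue. F (B *v t + 0)) = (1 / \<bar>det B\<bar>) *\<^sub>R (LINT s|lebesgue. F s)"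
    by (intro integral_affine[OF det_nonzero]) auto
  have "complex_of_real (sqrt 2) * complex_of_real (sqrt 2) = 2"
    by (simp flip: of_real_mult)
  then have "f t * cnj (dil B g t) = 2 * F (B *v t + 0)" for t
    by (simp add: F_def dil_def dil_inv_def matrix_inv_invertible[OF det_nonzero] field_simps)
  then show ?thesis
    unfolding L2_inner_def using change by (simp add: abs_det F_def[symmetric])
qed

lemma L2_inner_dil_pow:
  assumes f: "square_integrable f" and g: "square_integrable g"
  shows "L2_inner f (dil_pow B n g) = L2_inner (dil_pow B (- n) f) g"
  using f
proof (induction n arbitrary: f rule: int_induct[of _ 0])
  case (step1 i)
  have "L2_inner f (dil_pow B (i + 1) g) = L2_inner (dil_inv B f) (dil_pow B i g)"
    unfolding dil_pow_Suc[OF det_nonzero]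
    by (intro L2_inner_dil square_integrable_dil_pow det_nonzero step1.prems g)
  also have "\<dots> = L2_inner (dil_pow B (- i) (dil_inv B f)) g"
    by (intro step1.IH square_integrable_dil_inv det_nonzero step1.prems)
  also have "dil_pow B (- i) (dil_inv B f) = dil_pow B (- (i + 1)) f"
    using dil_pow_Suc'[OF det_nonzero, of "- (i + 1)" "dil_inv B f"] by (simp add: dil_dil_inv[OF det_nonzero])
  finally show ?case .
next
  case (step2 i)
  have "L2_inner f (dil_pow B (i - 1) g) = L2_inner (dil_inv B (dil B f)) (dil_pow B (i - 1) g)"
    by (simp add: dil_inv_dil[OF det_nonzero])
  also have "\<dots> = L2_inner (dil B f) (dil B (dil_pow B (i - 1) g))"
    by (intro L2_inner_dil[symmetric] square_integrable_dil square_integrable_dil_pow det_nonzero step2.prems g)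
  also have "dil B (dil_pow B (i - 1) g) = dil_pow B i g"
    using dil_pow_Suc[OF det_nonzero, of "i - 1" g] by simp
  also have "L2_inner (dil B f) (dil_pow B i g) = L2_inner (dil_pow B (- i) (dil B f)) g"
    by (intro step2.IH square_integrable_dil det_nonzero step2.prems)
  also have "dil_pow B (- i) (dil B f) = dil_pow B (- (i - 1)) f"
    using dil_pow_Suc'[OF det_nonzero, of "- i" f] by simp
  finally show ?case .
qed simp

end

section \<open>Translation spans and closures\<close>

definition translation_span :: "(real^'d::finite \<Rightarrow> complex) \<Rightarrow> (real^'d \<Rightarrow> complex) set" where
  "translation_span f = {(\<lambda>t. \<Sum>l\<in>F. c l * transl l f t) | F c. finite F \<and> F \<subseteq> Zd}"

lemma V0_eq_L2_closure: "V0 f = L2_closure (translation_span f)"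
  by (simp add: V0_def translation_span_def)

lemma sum_transl_in_translation_span:
  assumes "finite I" "\<And>i. i \<in> I \<Longrightarrow> q i \<in> Zd"
  shows "(\<lambda>t. \<Sum>i\<in>I. c i * transl (q i) f t) \<in> translation_span f"
proof -
  define c' where "c' p = (\<Sum>i\<in>{i\<in>I. q i = p}. c i)" for p
  have "(\<Sum>i\<in>I. c i * transl (q i) f t) = (\<Sum>p\<in>q ` I. c' p * transl p f t)" for t
    unfolding c'_def sum_distrib_right
    by (subst sum.image_gen[OF assms(1), of _ q]) (auto intro!: sum.cong)
  then have "(\<lambda>t. \<Sum>i\<in>I. c i * transl (q i) f t) = (\<lambda>t. \<Sum>p\<in>q ` I. c' p * transl p f t)"
    by (rule ext)
  moreover have "finite (q ` I)" "q ` I \<subseteq> Zd" using assms by auto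
  ultimately show ?thesis unfolding translation_span_def by blast
qed

lemma translation_span_square_integrable:
  "square_integrable f \<Longrightarrow> x \<in> translation_span f \<Longrightarrow> square_integrable x"
  unfolding translation_span_def
  by (auto intro!: square_integrable_sum square_integrable_cmult square_integrable_transl)

lemma L2_closure_superset:
  assumes "\<And>x. x \<in> X \<Longrightarrow> square_integrable x"
  shows "X \<subseteq> L2_closure X"
proof
  fix x assume "x \<in> X"
  moreover have "L2_dist_sq x x = 0" by (simp add: L2_dist_sq_def)
  ultimately show "x \<in> L2_closure X"
    using assms unfolding L2_closure_def by force
qed

lemma L2_closure_map:
  assumes y: "y \<in> L2_closure X" and sq: "square_integrable y'"
    and dist: "\<And>x. x \<in> X \<Longrightarrow> \<exists>x'\<in>X'. L2_dist_sq y' x' \<le> L2_dist_sq y x"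
  shows "y' \<in> L2_closure X'"
proof -
  have "\<exists>x'\<in>X'. L2_dist_sq y' x' < ennreal \<epsilon>" if pos: "\<epsilon> > 0" for \<epsilon>
  proof -
    have "\<forall>\<epsilon>>0. \<exists>x\<in>X. L2_dist_sq y x < ennreal \<epsilon>" using y by (simp add: L2_closure_def)
    then obtain x where x: "x \<in> X" "L2_dist_sq y x < ennreal \<epsilon>" using pos by blast
    obtain x' where "x' \<in> X'" "L2_dist_sq y' x' \<le> L2_dist_sq y x" using dist[OF x(1)] by blast
    with x(2) show ?thesis by (auto intro: le_less_trans)
  qed
  with sq show ?thesis unfolding L2_closure_def by blast
qed

section \<open>The frame property of a refinable function\<close>

lemma has_sum_telescope_int:
  fixes e :: "int \<Rightarrow> real"
  assumes mono: "\<And>n. e n \<le> e (n + 1)"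
    and top: "(\<lambda>n. e (int n)) \<longlonglongrightarrow> U" and bot: "(\<lambda>n. e (- int n)) \<longlonglongrightarrow> V"
  shows "((\<lambda>n. e (n + 1) - e n) has_sum (U - V)) UNIV"
proof -
  let ?d = "\<lambda>n. e (n + 1) - e n" and ?neg = "\<lambda>k. - int (Suc k)"
  have "(\<lambda>k. ?d (int k)) sums (U - e 0)"
    using telescope_sums[OF top] by (simp add: add.commute)
  then have "((?d \<circ> int) has_sum (U - e 0)) UNIV"
    unfolding o_def by (rule sums_nonneg_imp_has_sum) (simp add: mono)
  then have "(?d has_sum (U - e 0)) (range int)"
    by (subst has_sum_reindex) simp_all
  moreover have "(\<lambda>k. ?d (?neg k)) sums (e 0 - V)"
    using telescope_sums'[OF bot] by simp
  then have "((?d \<circ> ?neg) has_sum (e 0 - V)) UNIV"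
    unfolding o_def by (rule sums_nonneg_imp_has_sum) (use mono[of "?neg _"] in simp)
  then have "(?d has_sum (e 0 - V)) (range ?neg)"
    by (subst has_sum_reindex) (auto simp: inj_def)
  moreover have "range int \<inter> range ?neg = {}" by auto
  ultimately have "(?d has_sum ((U - e 0) + (e 0 - V))) (range int \<union> range ?neg)"
    by (rule has_sum_Un_disjoint)
  moreover have "range int \<union> range ?neg = UNIV"
  proof (intro equalityI UNIV_I subsetI)
    fix n :: int
    show "n \<in> range int \<union> range ?neg" by (cases n) auto
  qed
  ultimately show ?thesis by simp
qed

lemma infsum_finite_support:
  fixes g :: "'a \<Rightarrow> 'b::{comm_monoid_add,t2_space}"
  assumes "finite K" "K \<subseteq> Z" "\<And>l. l \<in> Z \<Longrightarrow> l \<notin> K \<Longrightarrow> g l = 0"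
  shows "(\<Sum>\<^sub>\<infinity>l\<in>Z. g l) = sum g K" "(g has_sum sum g K) Z"
proof -
  show has_sum: "(g has_sum sum g K) Z"
    using has_sum_cong_neutral[of K Z g g] has_sum_finite[OF assms(1), of g] assms(2,3) by auto
  show "(\<Sum>\<^sub>\<infinity>l\<in>Z. g l) = sum g K" by (rule infsumI[OF has_sum])
qed

lemma L2_norm_indicator_shrinking_ball:
  assumes g: "square_integrable g" and r: "r \<longlonglongrightarrow> 0"
  shows "square_integrable (\<lambda>t. indicator (cball 0 (r n)) t * g t)"
    "(\<lambda>n. L2_norm (\<lambda>t::real^'d::finite. indicator (cball 0 (r n)) t * g t)) \<longlonglongrightarrow> 0"
proof -
  let ?g = "\<lambda>n t. indicator (cball 0 (r n)) t * g t"
  have dom: "integrable lebesgue (\<lambda>t. (cmod (g t))\<^sup>2)" "AE t in lebesgue. cmod (?g n t) \<le> cmod (g t)" for n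
    using g by (auto simp: square_integrable_def indicator_def)
  have measurable: "?g n \<in> borel_measurable lebesgue" for n
    using g by (intro borel_measurable_times borel_measurable_indicator) (auto simp: square_integrable_def)
  have "AE t in lebesgue. t \<noteq> (0::real^'d)"
    by (rule AE_completion) (simp add: AE_lborel_singleton)
  then have lim: "AE t in lebesgue. (\<lambda>n. ?g n t) \<longlonglongrightarrow> 0"
  proof eventually_elim
    case (elim t)
    then have "\<forall>\<^sub>F n in sequentially. r n < norm t"
      using order_tendstoD(2)[OF r, of "norm t"] by simp
    then have "\<forall>\<^sub>F n in sequentially. ?g n t = 0"
      by eventually_elim (simp add: indicator_def)
    then show ?case by (rule tendsto_eventually)
  qed
  show "square_integrable (?g n)"
    by (rule L2_dominated_convergence(2)[OF _ measurable dom(1) lim dom(2)]) simp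
  have "(\<lambda>n. L2_norm (\<lambda>t. ?g n t - 0)) \<longlonglongrightarrow> 0"
    by (rule L2_dominated_convergence(3)[OF _ measurable dom(1) lim dom(2)]) simp
  then show "(\<lambda>n. L2_norm (?g n)) \<longlonglongrightarrow> 0" by simp
qed

definition Zd_ball :: "real \<Rightarrow> (real^'d::finite) set" where
  "Zd_ball r = {l \<in> Zd. norm l \<le> r}"

lemma Zd_ball: "finite (Zd_ball r)" "Zd_ball r \<subseteq> Zd" "l \<in> Zd \<Longrightarrow> l \<notin> Zd_ball r \<Longrightarrow> norm l > r"
  by (auto simp: Zd_ball_def finite_Zd_cball)

locale refinable_pair =
  fixes B :: "real^'d::finite^'d" and a b :: "real^'d \<Rightarrow> complex" and L :: "(real^'d) set"
    and phi psi :: "real^'d \<Rightarrow> complex" and R :: real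
  assumes abs_det: "\<bar>det B\<bar> = 2"
    and B_Zd: "\<And>x. x \<in> Zd \<Longrightarrow> B *v x \<in> Zd"
    and decay: "summable (\<lambda>k. onorm ((*v) (mat_pow (matrix_inv B) k)))"
    and L: "finite L" "L \<subseteq> Zd"
    and a_support: "\<And>n. n \<notin> L \<Longrightarrow> a n = 0" and b_support: "\<And>n. n \<notin> L \<Longrightarrow> b n = 0"
    and perfect_reconstruction: "\<And>p q K. p \<in> Zd \<Longrightarrow> q \<in> Zd \<Longrightarrow> finite K \<Longrightarrow> K \<subseteq> Zd \<Longrightarrow>
      {l\<in>Zd. p - B *v l \<in> L} \<subseteq> K \<Longrightarrow>
      (\<Sum>l\<in>K. a (p - B *v l) * cnj (a (q - B *v l)) + b (p - B *v l) * cnj (b (q - B *v l))) = of_bool (p = q)"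
    and phi: "square_integrable phi" and phi_support: "AE t in lebesgue. norm t > R \<longrightarrow> phi t = 0"
    and phi_integral: "(LINT t|lebesgue. phi t) = 1" and R_nonneg: "R \<ge> 0"
    and phi_refinement: "AE t in lebesgue. phi t = (\<Sum>n\<in>L. a n * dil B (transl n phi) t)"
    and psi_refinement: "AE t in lebesgue. psi t = (\<Sum>n\<in>L. b n * dil B (transl n phi) t)"
begin

abbreviation C :: "nat \<Rightarrow> real^'d^'d" where
  "C k \<equiv> mat_pow (matrix_inv B) k"

lemma det_B: "det B \<noteq> 0"
  by (rule det_nonzero[OF abs_det])

lemma det_C: "det (C k) \<noteq> 0"
  using det_matrix_inv_nonzero[OF det_B] by (simp add: det_mat_pow)

lemma square_integrable_two_scale:
  assumes "AE t in lebesgue. w t = (\<Sum>n\<in>L. c n * dil B (transl n phi) t)"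
  shows "square_integrable w"
proof (rule square_integrable_AE_cong(1))
  show "square_integrable (\<lambda>t. \<Sum>n\<in>L. c n * dil B (transl n phi) t)"
    by (intro square_integrable_sum square_integrable_cmult square_integrable_dil[OF det_B]
        square_integrable_transl phi)
  show "AE t in lebesgue. (\<Sum>n\<in>L. c n * dil B (transl n phi) t) = w t"
    using assms by eventually_elim simp
qed

lemma square_integrable_psi: "square_integrable psi"
  by (rule square_integrable_two_scale[OF psi_refinement])

lemma integrable_phi: "integrable lebesgue phi"
proof -
  have "square_integrable (\<lambda>t. indicator (cball 0 R) t :: complex)"
    by (rule bounded_support_square_integrable[of _ 1 R])
       (auto split: split_indicator intro!: borel_measurable_indicator)
  from square_integrable_mult_integrable[OF phi this]
  have "integrable lebesgue (\<lambda>t. phi t * indicator (cball 0 R) t)" .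
  moreover have "phi \<in> borel_measurable lebesgue" using phi by (simp add: square_integrable_def)
  moreover have "AE t in lebesgue. phi t * indicator (cball 0 R) t = phi t"
    using phi_support by eventually_elim (auto simp: indicator_def)
  ultimately show ?thesis by (rule integrable_cong_AE_imp)
qed

subsection \<open>The filter bank is an isometry\<close>

definition analysis :: "(real^'d \<Rightarrow> complex) \<Rightarrow> (real^'d \<Rightarrow> complex) \<Rightarrow> real^'d \<Rightarrow> complex" where
  "analysis c x l = (\<Sum>n\<in>L. cnj (c n) * x (B *v l + n))"

lemma analysis_eq_sum:
  assumes l: "l \<in> Zd" and c: "\<And>n. n \<notin> L \<Longrightarrow> c n = 0"
    and K: "finite K" and x: "\<And>p. p \<in> Zd \<Longrightarrow> p \<notin> K \<Longrightarrow> x p = 0"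
  shows "analysis c x l = (\<Sum>p\<in>K. cnj (c (p - B *v l)) * x p)"
proof -
  let ?g = "\<lambda>n. B *v l + n" and ?f = "\<lambda>p. cnj (c (p - B *v l)) * x p"
  have "analysis c x l = sum ?f (?g ` L)"
    unfolding analysis_def by (subst sum.reindex) (auto simp: inj_on_def)
  also have "\<dots> = sum ?f (?g ` L \<union> K)"
  proof (rule sum.mono_neutral_left)
    show "\<forall>p\<in>?g ` L \<union> K - ?g ` L. ?f p = 0"
    proof
      fix p assume "p \<in> ?g ` L \<union> K - ?g ` L"
      then have "p - B *v l \<notin> L" by (force simp: image_iff)
      then show "?f p = 0" using c by simp
    qed
  qed (use L K in auto)
  also have "\<dots> = sum ?f K"
  proof (rule sum.mono_neutral_right)
    show "\<forall>p\<in>?g ` L \<union> K - K. ?f p = 0"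
      using x Zd_add[OF B_Zd[OF l]] L(2) by auto
  qed (use L K in auto)
  finally show ?thesis .
qed

lemma norm_power2_analysis:
  assumes "l \<in> Zd" "\<And>n. n \<notin> L \<Longrightarrow> c n = 0" "finite K" "\<And>p. p \<in> Zd \<Longrightarrow> p \<notin> K \<Longrightarrow> x p = 0"
  shows "complex_of_real ((cmod (analysis c x l))\<^sup>2) =
    (\<Sum>q\<in>K. \<Sum>p\<in>K. x q * cnj (x p) * (c (p - B *v l) * cnj (c (q - B *v l))))"
proof -
  have "analysis c x l = (\<Sum>p\<in>K. cnj (c (p - B *v l)) * x p)"
    by (rule analysis_eq_sum) (use assms in auto)
  then show ?thesis unfolding complex_norm_square by (simp add: sum_product mult_ac)
qed

lemma analysis_isometry:
  assumes K: "finite K" "K \<subseteq> Zd" and x: "\<And>p. p \<in> Zd \<Longrightarrow> p \<notin> K \<Longrightarrow> x p = 0"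
    and K': "finite K'" "K' \<subseteq> Zd" "\<And>l n. l \<in> Zd \<Longrightarrow> n \<in> L \<Longrightarrow> B *v l + n \<in> K \<Longrightarrow> l \<in> K'"
  shows "(\<Sum>l\<in>K'. (cmod (analysis a x l))\<^sup>2 + (cmod (analysis b x l))\<^sup>2) = (\<Sum>p\<in>K. (cmod (x p))\<^sup>2)"
proof -
  define T where "T l p q =
    a (p - B *v l) * cnj (a (q - B *v l)) + b (p - B *v l) * cnj (b (q - B *v l))" for l p q
  have "complex_of_real (\<Sum>l\<in>K'. (cmod (analysis a x l))\<^sup>2 + (cmod (analysis b x l))\<^sup>2)
     = (\<Sum>l\<in>K'. \<Sum>q\<in>K. \<Sum>p\<in>K. x q * cnj (x p) * T l p q)"
    unfolding of_real_sum
  proof (intro sum.cong refl)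
    fix l assume "l \<in> K'"
    then have "l \<in> Zd" using K' by blast
    show "complex_of_real ((cmod (analysis a x l))\<^sup>2 + (cmod (analysis b x l))\<^sup>2) =
        (\<Sum>q\<in>K. \<Sum>p\<in>K. x q * cnj (x p) * T l p q)"
      using norm_power2_analysis[where x=x, OF \<open>l \<in> Zd\<close> a_support K(1) x]
        norm_power2_analysis[where x=x, OF \<open>l \<in> Zd\<close> b_support K(1) x]
      unfolding T_def by (simp add: distrib_left sum.distrib)
  qed
  also have "\<dots> = (\<Sum>q\<in>K. \<Sum>p\<in>K. \<Sum>l\<in>K'. x q * cnj (x p) * T l p q)"
    by (subst sum.swap, rule sum.cong[OF refl], rule sum.swap)
  also have "\<dots> = (\<Sum>q\<in>K. \<Sum>p\<in>K. x q * cnj (x p) * of_bool (p = q))"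
  proof (intro sum.cong refl)
    fix q p assume pq: "q \<in> K" "p \<in> K"
    have "{l \<in> Zd. p - B *v l \<in> L} \<subseteq> K'"
      using K'(3)[where n="p - B *v _"] pq by auto
    then have "(\<Sum>l\<in>K'. T l p q) = of_bool (p = q)"
      unfolding T_def using pq K K' by (intro perfect_reconstruction) auto
    then show "(\<Sum>l\<in>K'. x q * cnj (x p) * T l p q) = x q * cnj (x p) * of_bool (p = q)"
      by (simp only: sum_distrib_left[symmetric])
  qed
  also have "\<dots> = (\<Sum>q\<in>K. x q * cnj (x q))"
    using K(1) by (simp add: of_bool_def if_distrib cong: if_cong)
  also have "\<dots> = complex_of_real (\<Sum>q\<in>K. (cmod (x q))\<^sup>2)"
    by (simp only: of_real_sum complex_norm_square)
  finally show ?thesis by (simp only: of_real_eq_iff)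
qed

subsection \<open>Energies at a given scale\<close>

definition phi_coeff :: "(real^'d \<Rightarrow> complex) \<Rightarrow> real^'d \<Rightarrow> complex" where
  "phi_coeff f l = L2_inner f (transl l phi)"

definition psi_coeff :: "(real^'d \<Rightarrow> complex) \<Rightarrow> real^'d \<Rightarrow> complex" where
  "psi_coeff f l = L2_inner f (transl l psi)"

definition phi_energy :: "(real^'d \<Rightarrow> complex) \<Rightarrow> real" where
  "phi_energy f = (\<Sum>\<^sub>\<infinity>l\<in>Zd. (cmod (phi_coeff f l))\<^sup>2)"

definition psi_energy :: "(real^'d \<Rightarrow> complex) \<Rightarrow> real" where
  "psi_energy f = (\<Sum>\<^sub>\<infinity>l\<in>Zd. (cmod (psi_coeff f l))\<^sup>2)"

lemma psi_energy_nonneg: "0 \<le> psi_energy f"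
  unfolding psi_energy_def by (rule infsum_nonneg) simp

lemma L2_inner_transl_two_scale:
  assumes f: "square_integrable f" and w: "AE t in lebesgue. w t = (\<Sum>n\<in>L. c n * dil B (transl n phi) t)"
  shows "L2_inner f (transl l w) = analysis c (phi_coeff (dil_inv B f)) l"
proof -
  have sq: "square_integrable (dil B (transl (B *v l + n) phi))" for n
    by (intro square_integrable_dil[OF det_B] square_integrable_transl phi)
  have "L2_inner f (transl l w) = L2_inner f (transl l (\<lambda>t. \<Sum>n\<in>L. c n * dil B (transl n phi) t))"
    by (rule L2_inner_AE_cong_right[OF f square_integrable_transl[OF square_integrable_two_scale[OF w]]
        AE_transl[OF w]])
  also have "transl l (\<lambda>t. \<Sum>n\<in>L. c n * dil B (transl n phi) t)
      = (\<lambda>t. \<Sum>n\<in>L. c n * dil B (transl (B *v l + n) phi) t)"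
    unfolding transl_transl[symmetric] transl_dil[symmetric] by (simp add: transl_def)
  also have "L2_inner f \<dots> = (\<Sum>n\<in>L. L2_inner f (\<lambda>t. c n * dil B (transl (B *v l + n) phi) t))"
    by (intro L2_inner_sum_right square_integrable_cmult sq f)
  also have "\<dots> = analysis c (phi_coeff (dil_inv B f)) l"
    unfolding L2_inner_cmult_right analysis_def phi_coeff_def
    using L2_inner_dil[OF abs_det f square_integrable_transl[OF phi]] by simp
  finally show ?thesis .
qed

lemma phi_coeff_eq_0:
  assumes support: "\<And>x. norm x > r \<Longrightarrow> f x = 0" and l: "norm l > R + r"
  shows "phi_coeff f l = 0"
proof -
  have "AE t in lebesgue. norm (t - l) > R \<longrightarrow> phi (t - l) = 0"
    using AE_affine[of "mat 1" "\<lambda>t. norm t > R \<longrightarrow> phi t = 0" "- l"] phi_support by simp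
  then have "AE t in lebesgue. f t * cnj (transl l phi t) = 0"
  proof eventually_elim
    case (elim t)
    show ?case
    proof (cases "norm t > r")
      case False
      have "norm l \<le> norm t + norm (t - l)" using norm_triangle_ineq4[of t "t - l"] by simp
      then show ?thesis using elim False l by (simp add: transl_def)
    qed (simp add: support)
  qed
  then show ?thesis
    unfolding phi_coeff_def L2_inner_def by (rule integral_eq_zero_AE)
qed

lemma phi_coeff_outside_Zd_ball:
  assumes "\<And>x. norm x > r \<Longrightarrow> f x = 0" "l \<in> Zd" "l \<notin> Zd_ball (R + r)"
  shows "phi_coeff f l = 0"
  using assms(1) Zd_ball(3)[OF assms(2,3)] by (rule phi_coeff_eq_0)

lemma phi_energy_has_sum:
  assumes "\<And>x. norm x > r \<Longrightarrow> f x = 0"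
  shows "((\<lambda>l. (cmod (phi_coeff f l))\<^sup>2) has_sum (\<Sum>l\<in>Zd_ball (R + r). (cmod (phi_coeff f l))\<^sup>2)) Zd"
proof (rule infsum_finite_support(2)[OF Zd_ball(1,2)])
  fix l :: "real^'d" assume "l \<in> Zd" "l \<notin> Zd_ball (R + r)"
  with assms have "phi_coeff f l = 0" by (rule phi_coeff_outside_Zd_ball)
  then show "(cmod (phi_coeff f l))\<^sup>2 = 0" by simp
qed

lemma phi_energy_eq_sum:
  assumes "\<And>x. norm x > r \<Longrightarrow> f x = 0"
  shows "phi_energy f = (\<Sum>l\<in>Zd_ball (R + r). (cmod (phi_coeff f l))\<^sup>2)"
  unfolding phi_energy_def using phi_energy_has_sum[of r f] assms by (intro infsumI) auto

lemma sum_phi_coeff_le_phi_energy: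
  assumes "Cc f" "finite K" "K \<subseteq> Zd"
  shows "(\<Sum>l\<in>K. (cmod (phi_coeff f l))\<^sup>2) \<le> phi_energy f"
proof -
  obtain r where r: "\<And>x. norm x > r \<Longrightarrow> f x = 0" using assms(1) by (auto simp: Cc_def)
  have "((\<lambda>l. (cmod (phi_coeff f l))\<^sup>2) has_sum (\<Sum>l\<in>Zd_ball (R + r). (cmod (phi_coeff f l))\<^sup>2)) Zd"
    by (rule phi_energy_has_sum) (rule r)
  also have "(\<Sum>l\<in>Zd_ball (R + r). (cmod (phi_coeff f l))\<^sup>2) = phi_energy f"
    by (rule phi_energy_eq_sum[symmetric]) (rule r)
  finally show ?thesis using assms by (intro finite_sum_le_has_sum) auto
qed

lemma finite_coarse_support:
  assumes "finite K"
  shows "finite {l\<in>Zd. \<exists>n\<in>L. B *v l + n \<in> K}"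
proof (rule finite_subset)
  show "{l\<in>Zd. \<exists>n\<in>L. B *v l + n \<in> K} \<subseteq> (\<lambda>(p, n). matrix_inv B *v (p - n)) ` (K \<times> L)"
  proof
    fix l assume "l \<in> {l\<in>Zd. \<exists>n\<in>L. B *v l + n \<in> K}"
    then obtain n where n: "n \<in> L" "B *v l + n \<in> K" by blast
    have "l = (\<lambda>(p, n). matrix_inv B *v (p - n)) (B *v l + n, n)" by (simp add: matrix_inv_invertible[OF det_B])
    then show "l \<in> (\<lambda>(p, n). matrix_inv B *v (p - n)) ` (K \<times> L)" using n by blast
  qed
qed (use assms L in simp)

lemma energy_step:
  assumes f: "Cc f"
  shows "phi_energy (dil_inv B f) = phi_energy f + psi_energy f"
    "((\<lambda>l. (cmod (psi_coeff f l))\<^sup>2) has_sum psi_energy f) Zd"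
proof -
  have "Cc (dil_inv B f)" using Cc_dil_pow[OF det_B f, of "-1"] by (simp add: dil_pow_def)
  then obtain r where r: "\<And>x. norm x > r \<Longrightarrow> dil_inv B f x = 0" by (auto simp: Cc_def)
  define K where "K = (Zd_ball (R + r) :: (real^'d) set)"
  define K' where "K' = {l\<in>Zd. \<exists>n\<in>L. B *v l + n \<in> K}"
  have K: "finite K" "K \<subseteq> Zd" unfolding K_def by (simp_all add: Zd_ball)
  then have K': "finite K'" "K' \<subseteq> Zd" unfolding K'_def by (auto intro: finite_coarse_support)
  let ?x = "phi_coeff (dil_inv B f)"
  have x: "?x p = 0" if "p \<in> Zd" "p \<notin> K" for p
    by (rule phi_coeff_outside_Zd_ball[OF r that[unfolded K_def]])
  have coeffs: "phi_coeff f l = analysis a ?x l" "psi_coeff f l = analysis b ?x l" for l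
    using L2_inner_transl_two_scale[OF Cc_square_integrable[OF f]] phi_refinement psi_refinement
    unfolding phi_coeff_def[of f] psi_coeff_def by auto
  have "analysis c ?x l = 0" if "l \<in> Zd" "l \<notin> K'" for c l
    unfolding analysis_def using that x Zd_add[OF B_Zd] L(2)
    by (intro sum.neutral ballI) (auto simp: K'_def)
  then have vanish: "phi_coeff f l = 0" "psi_coeff f l = 0" if "l \<in> Zd" "l \<notin> K'" for l
    unfolding coeffs using that by simp_all
  have psi: "((\<lambda>l. (cmod (psi_coeff f l))\<^sup>2) has_sum (\<Sum>l\<in>K'. (cmod (psi_coeff f l))\<^sup>2)) Zd"
    by (rule infsum_finite_support(2)[OF K']) (simp add: vanish)
  then have psi_energy: "psi_energy f = (\<Sum>l\<in>K'. (cmod (psi_coeff f l))\<^sup>2)"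
    unfolding psi_energy_def by (rule infsumI)
  with psi show "((\<lambda>l. (cmod (psi_coeff f l))\<^sup>2) has_sum psi_energy f) Zd" by simp
  have "phi_energy f = (\<Sum>l\<in>K'. (cmod (phi_coeff f l))\<^sup>2)"
    unfolding phi_energy_def by (rule infsum_finite_support(1)[OF K']) (simp add: vanish)
  with psi_energy have "phi_energy f + psi_energy f
      = (\<Sum>l\<in>K'. (cmod (phi_coeff f l))\<^sup>2 + (cmod (psi_coeff f l))\<^sup>2)"
    by (simp add: sum.distrib)
  also have "\<dots> = (\<Sum>p\<in>K. (cmod (?x p))\<^sup>2)"
    unfolding coeffs by (rule analysis_isometry[OF K x K']) (auto simp: K'_def)
  also have "\<dots> = phi_energy (dil_inv B f)"
    unfolding K_def by (rule phi_energy_eq_sum[where f="dil_inv B f" and r=r, OF r, symmetric])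
  finally show "phi_energy (dil_inv B f) = phi_energy f + psi_energy f" ..
qed

subsection \<open>The energy at fine scales\<close>

definition average :: "nat \<Rightarrow> (real^'d \<Rightarrow> complex) \<Rightarrow> real^'d \<Rightarrow> complex" where
  "average n f l = (LINT s|lebesgue. f (C n *v (s + l)) * cnj (phi s))"

definition node :: "nat \<Rightarrow> real^'d \<Rightarrow> real^'d" where
  "node n t = vec_floor (mat_pow B n *v t)"

lemma integrable_average:
  assumes "Cc f"
  shows "integrable lebesgue (\<lambda>s. f (C n *v (s + l)) * cnj (phi s))"
  using square_integrable_mult_integrable[OF
      square_integrable_affine(1)[OF det_C Cc_square_integrable[OF assms]] square_integrable_cnj[OF phi]]
  by (simp add: matrix_vector_right_distrib)

lemma phi_coeff_dil_pow_neg: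
  assumes "Cc f"
  shows "phi_coeff (dil_pow B (- int n) f) l = average n f l / complex_of_real (sqrt 2) ^ n"
proof -
  let ?H = "\<lambda>s. f (C n *v (s + l)) * cnj (phi s)"
  have "(LINT t|lebesgue. ?H (mat 1 *v t + - l)) = (LINT s|lebesgue. ?H s)"
    using integral_affine[of "mat 1" ?H "- l"] borel_measurable_integrable[OF integrable_average[OF assms]]
    by simp
  then show ?thesis
    unfolding phi_coeff_def L2_inner_def dil_pow_neg_nat transl_def average_def by simp
qed

lemma norm_average_le:
  assumes f: "Cc f" and K: "\<And>x. cmod (f x) \<le> K"
  shows "cmod (average n f l) \<le> K * (LINT s|lebesgue. cmod (phi s))"
proof -
  have "cmod (average n f l) \<le> (LINT s|lebesgue. K * cmod (phi s))"
    unfolding average_def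
  proof (rule Bochner_Integration.integral_norm_bound_integral[OF integrable_average[OF f]])
    show "integrable lebesgue (\<lambda>s. K * cmod (phi s))" using integrable_phi by simp
  qed (auto simp: norm_mult intro!: mult_right_mono K)
  then show ?thesis by simp
qed

lemma lattice_point_tendsto: "(\<lambda>n. C n *v node n t) \<longlonglongrightarrow> t"
proof -
  have "(\<lambda>n. t - C n *v node n t) \<longlonglongrightarrow> 0"
  proof (rule Lim_null_comparison)
    show "\<forall>\<^sub>F n in sequentially. norm (t - C n *v node n t) \<le> onorm ((*v) (C n)) * CARD('d)"
      unfolding node_def using refined_lattice_dist_le[OF det_B] by simp
    show "(\<lambda>n. onorm ((*v) (C n)) * CARD('d)) \<longlonglongrightarrow> 0"
      using summable_LIMSEQ_zero[OF decay] by (rule tendsto_mult_left_zero)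
  qed
  from tendsto_diff[OF tendsto_const[of t] this] show ?thesis by simp
qed

text \<open>Since \<open>\<phi>\<close> has integral one and the averaging region shrinks to a point, the averages tend to
  the values of \<open>f\<close>.\<close>

lemma average_tendsto:
  assumes f: "Cc f"
  shows "(\<lambda>n. average n f (node n t)) \<longlonglongrightarrow> f t"
proof -
  obtain K where K: "\<And>x. cmod (f x) \<le> K" using Cc_bounded[OF f] by metis
  have "(\<lambda>n. average n f (node n t)) \<longlonglongrightarrow> (LINT s|lebesgue. f t * cnj (phi s))"
    unfolding average_def
  proof (rule integral_dominated_convergence[where w="\<lambda>s. K * cmod (phi s)"])
    show "integrable lebesgue (\<lambda>s. K * cmod (phi s))" using integrable_phi by simp
    show "(\<lambda>s. f t * cnj (phi s)) \<in> borel_measurable lebesgue"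
      using square_integrable_cnj[OF phi] unfolding square_integrable_def
      by (intro borel_measurable_times borel_measurable_const) simp
    show "(\<lambda>s. f (C n *v (s + node n t)) * cnj (phi s)) \<in> borel_measurable lebesgue" for n
      using integrable_average[OF f] by auto
    show "AE s in lebesgue. (\<lambda>n. f (C n *v (s + node n t)) * cnj (phi s)) \<longlonglongrightarrow> f t * cnj (phi s)"
    proof (intro AE_I2 tendsto_mult tendsto_const)
      fix s :: "real^'d"
      have "(\<lambda>n. C n *v (s + node n t)) \<longlonglongrightarrow> 0 + t"
        unfolding matrix_vector_right_distrib
        by (intro tendsto_add mat_pow_vec_tendsto_0[OF decay] lattice_point_tendsto)
      moreover have "isCont f t" using f by (simp add: Cc_def continuous_on_eq_continuous_at)
      ultimately show "(\<lambda>n. f (C n *v (s + node n t))) \<longlonglongrightarrow> f t"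
        by (intro isCont_tendsto_compose[of t f]) simp_all
    qed
    show "AE s in lebesgue. norm (f (C n *v (s + node n t)) * cnj (phi s)) \<le> K * cmod (phi s)" for n
      by (intro AE_I2) (auto simp: norm_mult intro!: mult_right_mono K)
  qed
  moreover have "(LINT s|lebesgue. cnj (phi s)) = 1"
    using integral_bounded_linear[OF bounded_linear_cnj integrable_phi] phi_integral by simp
  ultimately show ?thesis by simp
qed

lemma average_eq_0:
  assumes support: "\<And>x. norm x > r \<Longrightarrow> f x = 0"
    and D: "\<And>k. onorm ((*v) (C k)) \<le> D" and t: "norm t > r + D * (CARD('d) + R)"
  shows "average n f (node n t) = 0"
proof -
  have "AE s in lebesgue. f (C n *v (s + node n t)) * cnj (phi s) = 0"
    using phi_support
  proof eventually_elim
    case (elim s)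
    show ?case
    proof (cases "norm s > R")
      case False
      let ?p = "C n *v node n t"
      have "norm (C n *v s) \<le> onorm ((*v) (C n)) * norm s" by (rule norm_matrix_vector_le_onorm)
      also have "\<dots> \<le> D * R" using False by (intro mult_mono D order_trans[OF onorm_matrix_nonneg D]) auto
      finally have "norm (C n *v s) \<le> D * R" .
      moreover have "norm (t - ?p) \<le> D * CARD('d)"
        unfolding node_def
        by (rule order_trans[OF refined_lattice_dist_le[OF det_B] mult_right_mono[OF D]]) simp
      moreover have "norm t \<le> norm (t - ?p) + norm (C n *v s) + norm (C n *v s + ?p)"
        using norm_triangle_ineq[of "t - ?p" ?p] norm_triangle_ineq4[of "C n *v s + ?p" "C n *v s"] by simp
      ultimately have "norm (C n *v (s + node n t)) > r"
        using t by (simp add: matrix_vector_right_distrib distrib_left)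
      then show ?thesis by (simp add: support)
    qed (use elim in simp)
  qed
  then show ?thesis unfolding average_def by (rule integral_eq_zero_AE)
qed

lemma phi_energy_eq_integral:
  assumes f: "Cc f"
  shows "integrable lebesgue (\<lambda>t. (cmod (average n f (node n t)))\<^sup>2)"
    "phi_energy (dil_pow B (- int n) f) = (LINT t|lebesgue. (cmod (average n f (node n t)))\<^sup>2)"
proof -
  obtain r where r: "\<And>x. norm x > r \<Longrightarrow> dil_pow B (- int n) f x = 0"
    using Cc_dil_pow[OF det_B f] by (auto simp: Cc_def)
  let ?K = "Zd_ball (R + r) :: (real^'d) set" and ?F = "\<lambda>l. (cmod (average n f l))\<^sup>2"
  have support: "?F l = 0" if "l \<in> Zd" "l \<notin> ?K" for l
  proof -
    have "phi_coeff (dil_pow B (- int n) f) l = 0" by (rule phi_coeff_outside_Zd_ball[OF r that])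
    then show ?thesis unfolding phi_coeff_dil_pow_neg[OF f] by simp
  qed
  have step: "integrable lebesgue (\<lambda>t. ?F (vec_floor t))" "(LINT t|lebesgue. ?F (vec_floor t)) = sum ?F ?K"
    using integral_step_function[OF Zd_ball(1,2), of "R + r" ?F] support by blast+
  have det_pow: "det (mat_pow B n) \<noteq> 0" "\<bar>det (mat_pow B n)\<bar> = 2 ^ n"
    using det_B abs_det by (auto simp: det_mat_pow power_abs)
  show "integrable lebesgue (\<lambda>t. ?F (node n t))"
    unfolding node_def
    using integrable_affine[OF det_pow(1) borel_measurable_integrable[OF step(1)], of 0] step(1) by simp
  have "(cmod (complex_of_real (sqrt 2) ^ n))\<^sup>2 = ((sqrt 2)\<^sup>2) ^ n"
    by (simp only: norm_power norm_of_real power_mult[symmetric] mult.commute) simp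
  then have "phi_energy (dil_pow B (- int n) f) = (\<Sum>l\<in>?K. ?F l / 2 ^ n)"
    unfolding phi_energy_eq_sum[where r=r, of "dil_pow B (- int n) f", OF r, simplified]
    by (simp add: phi_coeff_dil_pow_neg[OF f] norm_divide power_divide)
  also have "\<dots> = (1 / \<bar>det (mat_pow B n)\<bar>) *\<^sub>R (LINT t|lebesgue. ?F (vec_floor t))"
    unfolding step(2) det_pow(2) by (simp add: sum_divide_distrib)
  also have "\<dots> = (LINT t|lebesgue. ?F (node n t))"
    using integral_affine[OF det_pow(1) borel_measurable_integrable[OF step(1)], of 0] by (simp add: node_def)
  finally show "phi_energy (dil_pow B (- int n) f) = (LINT t|lebesgue. ?F (node n t))" .
qed

lemma phi_energy_fine_limit:
  assumes f: "Cc f"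
  shows "(\<lambda>n. phi_energy (dil_pow B (- int n) f)) \<longlonglongrightarrow> L2_norm_sq f"
proof -
  obtain K r where K: "\<And>x. cmod (f x) \<le> K" and r: "\<And>x. norm x > r \<Longrightarrow> f x = 0"
    using Cc_bounded[OF f] by metis
  obtain D where D: "\<And>k. onorm ((*v) (C k)) \<le> D" using onorm_powers_bounded[OF decay] by metis
  let ?F = "\<lambda>n t. (cmod (average n f (node n t)))\<^sup>2"
  let ?ball = "cball 0 (r + D * (CARD('d) + R)) :: (real^'d) set"
  let ?bound = "(K * (LINT s|lebesgue. cmod (phi s)))\<^sup>2"
  have "(\<lambda>n. LINT t|lebesgue. ?F n t) \<longlonglongrightarrow> (LINT t|lebesgue. (cmod (f t))\<^sup>2)"
  proof (rule integral_dominated_convergence)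
    show "integrable lebesgue (\<lambda>t. ?bound * indicator ?ball t)" by (rule integrable_indicator_cball)
    show "AE t in lebesgue. norm (?F n t) \<le> ?bound * indicator ?ball t" for n
    proof (rule AE_I2)
      fix t
      show "norm (?F n t) \<le> ?bound * indicator ?ball t"
        using average_eq_0[of r f D t n, OF r D] power_mono[OF norm_average_le[OF f K], of n "node n t" 2]
        by (cases "norm t > r + D * (CARD('d) + R)") (auto simp: indicator_def)
    qed
    show "AE t in lebesgue. (\<lambda>n. ?F n t) \<longlonglongrightarrow> (cmod (f t))\<^sup>2"
      by (intro AE_I2 tendsto_power tendsto_norm average_tendsto f)
    show "?F n \<in> borel_measurable lebesgue" for n using phi_energy_eq_integral(1)[OF f] by auto
    show "(\<lambda>t. (cmod (f t))\<^sup>2) \<in> borel_measurable lebesgue" using Cc_measurable_lebesgue[OF f] by simp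
  qed
  then show ?thesis unfolding phi_energy_eq_integral(2)[OF f] L2_norm_sq_def .
qed

subsection \<open>The energy at coarse scales\<close>

lemma dil_pow_support:
  assumes support: "\<And>x. norm x > r \<Longrightarrow> f x = 0" and t: "norm t > r * onorm ((*v) (C n))"
  shows "dil_pow B (int n) f t = 0"
proof -
  have "norm (mat_pow B n *v t) > r"
  proof (rule ccontr)
    assume "\<not> norm (mat_pow B n *v t) > r"
    then have "onorm ((*v) (C n)) * norm (mat_pow B n *v t) \<le> onorm ((*v) (C n)) * r"
      by (intro mult_left_mono) auto
    then show False
      using norm_matrix_vector_le_onorm[of "C n" "mat_pow B n *v t"] t
      by (simp add: mat_pow_inverse[OF det_B] mult.commute)
  qed
  then show ?thesis unfolding dil_pow_nat by (simp add: support)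
qed

text \<open>The functions \<open>D\<^sup>n f\<close> have constant norm, but their supports shrink to a point.\<close>

lemma phi_coeff_coarse_limit:
  assumes f: "Cc f"
  shows "(\<lambda>n. phi_coeff (dil_pow B (int n) f) l) \<longlonglongrightarrow> 0"
proof -
  obtain r where r: "\<And>x. norm x > r \<Longrightarrow> f x = 0" using f by (auto simp: Cc_def)
  let ?f = "\<lambda>n. dil_pow B (int n) f" and ?\<rho> = "\<lambda>n. r * onorm ((*v) (C n))"
  let ?T = "\<lambda>n t. indicator (cball 0 (?\<rho> n)) t * transl l phi t"
  have "?\<rho> \<longlonglongrightarrow> 0"
    using summable_LIMSEQ_zero[OF decay] by (rule tendsto_mult_right_zero)
  note T = L2_norm_indicator_shrinking_ball[OF square_integrable_transl[OF phi] this]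
  have restrict: "phi_coeff (?f n) l = L2_inner (?f n) (?T n)" for n
    unfolding phi_coeff_def L2_inner_def
  proof (rule Bochner_Integration.integral_cong[OF refl])
    fix t show "?f n t * cnj (transl l phi t) = ?f n t * cnj (?T n t)"
      using dil_pow_support[of r f n t, OF r] by (cases "norm t > ?\<rho> n") (auto simp: indicator_def)
  qed
  show ?thesis
  proof (rule Lim_null_comparison)
    have "cmod (phi_coeff (?f n) l) \<le> L2_norm f * L2_norm (?T n)" for n
      unfolding restrict
      using Cauchy_Schwarz_L2_inner[OF square_integrable_dil_pow[OF det_B Cc_square_integrable[OF f]] T(1)]
        L2_norm_sq_dil_pow[OF abs_det Cc_square_integrable[OF f]] by (simp add: L2_norm_def)
    then show "\<forall>\<^sub>F n in sequentially. norm (phi_coeff (?f n) l) \<le> L2_norm f * L2_norm (?T n)" by simp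
    show "(\<lambda>n. L2_norm f * L2_norm (?T n)) \<longlonglongrightarrow> 0"
      using T(2) by (rule tendsto_mult_right_zero)
  qed
qed

lemma phi_energy_coarse_limit:
  assumes f: "Cc f"
  shows "(\<lambda>n. phi_energy (dil_pow B (int n) f)) \<longlonglongrightarrow> 0"
proof -
  obtain r where r: "r \<ge> 0" "\<And>x. norm x > r \<Longrightarrow> f x = 0" using Cc_bounded[OF f] by metis
  obtain D where D: "\<And>k. onorm ((*v) (C k)) \<le> D" using onorm_powers_bounded[OF decay] by metis
  let ?K = "Zd_ball (R + r * D) :: (real^'d) set"
  let ?E = "\<lambda>n. \<Sum>l\<in>?K. (cmod (phi_coeff (dil_pow B (int n) f) l))\<^sup>2"
  have "dil_pow B (int n) f t = 0" if "norm t > r * D" for n t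
    using that by (intro dil_pow_support[of r f] r(2) le_less_trans[OF mult_left_mono[OF D r(1)]])
  then have "phi_energy (dil_pow B (int n) f) = ?E n" for n
    by (intro phi_energy_eq_sum) auto
  moreover have "?E \<longlonglongrightarrow> (\<Sum>l\<in>?K. (cmod 0)\<^sup>2)"
    by (intro tendsto_sum tendsto_power tendsto_norm phi_coeff_coarse_limit f)
  ultimately show ?thesis by simp
qed

subsection \<open>The Parseval identity\<close>

definition scale_energy :: "(real^'d \<Rightarrow> complex) \<Rightarrow> int \<Rightarrow> real" where
  "scale_energy f n = phi_energy (dil_pow B (- n) f)"

lemma scale_energy_Suc:
  "Cc f \<Longrightarrow> scale_energy f (n + 1) = scale_energy f n + psi_energy (dil_pow B (- n) f)"
  unfolding scale_energy_def dil_pow_uminus_Suc[OF det_B] by (rule energy_step(1)[OF Cc_dil_pow[OF det_B]])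

lemma scale_energy_mono_Suc: "Cc f \<Longrightarrow> scale_energy f n \<le> scale_energy f (n + 1)"
  by (simp add: scale_energy_Suc psi_energy_nonneg)

lemma scale_energy_le:
  assumes f: "Cc f"
  shows "scale_energy f n \<le> L2_norm_sq f"
proof (rule LIMSEQ_le_const)
  show "(\<lambda>k. scale_energy f (int k)) \<longlonglongrightarrow> L2_norm_sq f"
    unfolding scale_energy_def by (rule phi_energy_fine_limit[OF f])
  have "scale_energy f n \<le> scale_energy f m" if "n \<le> m" for m
    using that by (induction m rule: int_ge_induct) (auto intro: order_trans scale_energy_mono_Suc[OF f])
  then show "\<exists>N. \<forall>k\<ge>N. scale_energy f n \<le> scale_energy f (int k)"
    by (intro exI[of _ "nat n"]) auto
qed

lemma Bessel_phi:
  assumes K: "finite K" "K \<subseteq> Zd" and f: "square_integrable f"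
  shows "(\<Sum>l\<in>K. (cmod (L2_inner f (dil_pow B n (transl l phi))))\<^sup>2) \<le> L2_norm_sq f"
proof (rule Bessel_extend[OF _ K(1) _ f])
  note sq = square_integrable_transl[OF phi]
  show "square_integrable (dil_pow B n (transl l phi))" for l
    by (rule square_integrable_dil_pow[OF det_B sq])
  fix u :: "real^'d \<Rightarrow> complex" assume u: "Cc u"
  have "(\<Sum>l\<in>K. (cmod (L2_inner u (dil_pow B n (transl l phi))))\<^sup>2)
      = (\<Sum>l\<in>K. (cmod (phi_coeff (dil_pow B (- n) u) l))\<^sup>2)"
    unfolding phi_coeff_def using L2_inner_dil_pow[OF abs_det Cc_square_integrable[OF u] sq] by simp
  also have "\<dots> \<le> scale_energy u n"
    unfolding scale_energy_def by (rule sum_phi_coeff_le_phi_energy[OF Cc_dil_pow[OF det_B u] K])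
  also have "\<dots> \<le> L2_norm_sq u" by (rule scale_energy_le[OF u])
  finally show "(\<Sum>l\<in>K. (cmod (L2_inner u (dil_pow B n (transl l phi))))\<^sup>2) \<le> L2_norm_sq u" .
qed

lemma psi_energy_has_sum:
  assumes u: "Cc u"
  shows "((\<lambda>n. psi_energy (dil_pow B (- n) u)) has_sum L2_norm_sq u) UNIV"
proof -
  have "((\<lambda>n. scale_energy u (n + 1) - scale_energy u n) has_sum (L2_norm_sq u - 0)) UNIV"
  proof (rule has_sum_telescope_int)
    show "(\<lambda>n. scale_energy u (int n)) \<longlonglongrightarrow> L2_norm_sq u"
      unfolding scale_energy_def by (rule phi_energy_fine_limit[OF u])
    show "(\<lambda>n. scale_energy u (- int n)) \<longlonglongrightarrow> 0"
      unfolding scale_energy_def minus_minus by (rule phi_energy_coarse_limit[OF u])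
  qed (rule scale_energy_mono_Suc[OF u])
  then show ?thesis by (simp add: scale_energy_Suc[OF u])
qed

theorem parseval_psi: "parseval_frame_wavelet B psi"
  unfolding parseval_frame_wavelet_def
proof (intro conjI allI impI)
  show "square_integrable psi" by (rule square_integrable_psi)
  fix f :: "real^'d \<Rightarrow> complex" assume f: "square_integrable f"
  let ?e = "\<lambda>(n, l). dil_pow B n (transl l psi)"
  note sq = square_integrable_transl[OF square_integrable_psi]
  have "((\<lambda>i. (cmod (L2_inner f (?e i)))\<^sup>2) has_sum L2_norm_sq f) (UNIV \<times> Zd)"
  proof (rule Parseval_extend[OF _ _ f])
    show "square_integrable (?e i)" for i
      by (cases i) (simp add: square_integrable_dil_pow[OF det_B sq])
    fix u :: "real^'d \<Rightarrow> complex" assume u: "Cc u"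
    have "L2_inner u (?e (n, l)) = psi_coeff (dil_pow B (- n) u) l" for n l
      unfolding psi_coeff_def using L2_inner_dil_pow[OF abs_det Cc_square_integrable[OF u] sq] by simp
    then have scale: "((\<lambda>l. (cmod (L2_inner u (?e (n, l))))\<^sup>2) has_sum psi_energy (dil_pow B (- n) u)) Zd" for n
      using energy_step(2)[OF Cc_dil_pow[OF det_B u]] by simp
    show "((\<lambda>i. (cmod (L2_inner u (?e i)))\<^sup>2) has_sum L2_norm_sq u) (UNIV \<times> Zd)"
    proof (rule has_sum_SigmaI[OF scale psi_energy_has_sum[OF u]])
      have "(\<lambda>n. psi_energy (dil_pow B (- n) u)) summable_on UNIV"
        using psi_energy_has_sum[OF u] by (rule has_sum_imp_summable)
      then show "(\<lambda>i. (cmod (L2_inner u (?e i)))\<^sup>2) summable_on (UNIV \<times> Zd)"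
        by (rule summable_on_SigmaI[OF scale]) simp
    qed
  qed
  then show "((\<lambda>(n::int, l). (cmod (L2_inner f (dil_pow B n (transl l psi))))\<^sup>2)
      has_sum L2_norm_sq f) (UNIV \<times> Zd)"
    by (simp add: case_prod_unfold)
qed

subsection \<open>The multiresolution spaces\<close>

lemma dil_inv_transl_phi:
  "AE t in lebesgue. dil_inv B (transl l phi) t = (\<Sum>n\<in>L. a n * transl (B *v l + n) phi t)"
proof -
  have "AE t in lebesgue. transl l phi t = (\<Sum>n\<in>L. a n * dil B (transl (B *v l + n) phi) t)"
    using AE_transl[OF phi_refinement, of l] unfolding transl_transl[symmetric] transl_dil[symmetric]
    by (simp add: transl_def)
  from AE_affine[OF det_matrix_inv_nonzero[OF det_B] this, of 0] show ?thesis
    by eventually_elim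
       (simp add: dil_inv_def dil_def matrix_inv_invertible[OF det_B] sum_divide_distrib)
qed

lemma dil_inv_translation_span:
  assumes "x \<in> translation_span phi"
  obtains x' where "x' \<in> translation_span phi" "AE t in lebesgue. dil_inv B x t = x' t"
proof -
  from assms obtain F c where x: "x = (\<lambda>t. \<Sum>l\<in>F. c l * transl l phi t)" and F: "finite F" "F \<subseteq> Zd"
    unfolding translation_span_def by blast
  define x' where "x' t = (\<Sum>i\<in>F \<times> L. c (fst i) * a (snd i) * transl (B *v fst i + snd i) phi t)" for t
  have x'_eq: "x' t = (\<Sum>l\<in>F. c l * (\<Sum>n\<in>L. a n * transl (B *v l + n) phi t))" for t
    by (simp add: x'_def sum.cartesian_product sum_distrib_left case_prod_unfold mult.assoc)
  have "AE t in lebesgue. \<forall>l\<in>F. dil_inv B (transl l phi) t = (\<Sum>n\<in>L. a n * transl (B *v l + n) phi t)"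
    using F(1) dil_inv_transl_phi by (simp add: AE_finite_all)
  then have "AE t in lebesgue. dil_inv B x t = x' t"
  proof eventually_elim
    case (elim t)
    have "dil_inv B x t = (\<Sum>l\<in>F. c l * dil_inv B (transl l phi) t)"
      by (simp add: x dil_inv_def sum_divide_distrib)
    also have "\<dots> = x' t" unfolding x'_eq using elim by simp
    finally show ?case .
  qed
  moreover have "x' \<in> translation_span phi"
    unfolding x'_def[abs_def]
    using F L by (intro sum_transl_in_translation_span) (auto intro!: Zd_add B_Zd dest: subsetD)
  ultimately show thesis using that by blast
qed

lemma dil_inv_V0:
  assumes "y \<in> V0 phi"
  shows "dil_inv B y \<in> V0 phi"
  using assms unfolding V0_eq_L2_closure
proof (rule L2_closure_map)
  have y: "square_integrable y" using assms by (simp add: V0_def L2_closure_def)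
  then show "square_integrable (dil_inv B y)" by (rule square_integrable_dil_inv[OF det_B])
  fix x assume x: "x \<in> translation_span phi"
  obtain x' where x': "x' \<in> translation_span phi" "AE t in lebesgue. dil_inv B x t = x' t"
    using dil_inv_translation_span[OF x] by blast
  note sq = translation_span_square_integrable[OF phi]
  note diff = square_integrable_diff[OF y sq[OF x]]
  have "AE t in lebesgue. dil_inv B (\<lambda>t. y t - x t) t = dil_inv B y t - x' t"
    using x'(2) by eventually_elim (simp add: dil_inv_def diff_divide_distrib)
  from square_integrable_AE_cong(2)[OF square_integrable_dil_inv[OF det_B diff] this]
  have "L2_norm_sq (\<lambda>t. dil_inv B y t - x' t) = L2_norm_sq (\<lambda>t. y t - x t)"
    using L2_norm_sq_dil_inv[OF abs_det diff] by simp
  then have "L2_dist_sq (dil_inv B y) x' = L2_dist_sq y x"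
    using L2_dist_sq_eq[OF y sq[OF x]] L2_dist_sq_eq[OF square_integrable_dil_inv[OF det_B y] sq[OF x'(1)]]
    by simp
  with x'(1) show "\<exists>x'\<in>translation_span phi. L2_dist_sq (dil_inv B y) x' \<le> L2_dist_sq y x" by force
qed

theorem Vn_nested: "Vn B n phi \<subseteq> Vn B (n + 1) phi"
proof
  fix z assume "z \<in> Vn B n phi"
  then obtain y where y: "y \<in> V0 phi" "z = dil_pow B n y" unfolding Vn_def by blast
  have "z = dil_pow B (n + 1) (dil_inv B y)"
    unfolding dil_pow_Suc'[OF det_B] dil_dil_inv[OF det_B] by (rule y(2))
  then show "z \<in> Vn B (n + 1) phi" unfolding Vn_def using dil_inv_V0[OF y(1)] by blast
qed

lemma Vn_approximates_Cc:
  assumes u: "Cc u" and \<delta>: "\<delta> > 0"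
  obtains n x where "x \<in> Vn B n phi" "square_integrable x" "L2_norm (\<lambda>t. u t - x t) < \<delta>"
proof -
  have "\<forall>\<^sub>F n in sequentially. phi_energy (dil_pow B (- int n) u) > L2_norm_sq u - \<delta>\<^sup>2"
    using order_tendstoD(1)[OF phi_energy_fine_limit[OF u], of "L2_norm_sq u - \<delta>\<^sup>2"] \<delta> by simp
  then obtain n where n: "phi_energy (dil_pow B (- int n) u) > L2_norm_sq u - \<delta>\<^sup>2"
    using eventually_happens'[OF sequentially_bot] by blast
  obtain r where r: "\<And>x. norm x > r \<Longrightarrow> dil_pow B (- int n) u x = 0"
    using Cc_dil_pow[OF det_B u] by (auto simp: Cc_def)
  let ?K = "Zd_ball (R + r)" and ?e = "\<lambda>l. dil_pow B (int n) (transl l phi)"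
  let ?y = "\<lambda>t. \<Sum>l\<in>?K. L2_inner u (?e l) * transl l phi t" and ?x = "\<lambda>t. \<Sum>l\<in>?K. L2_inner u (?e l) * ?e l t"
  note u_sq = Cc_square_integrable[OF u] and transl_sq = square_integrable_transl[OF phi]
  have e_sq: "square_integrable (?e l)" for l by (rule square_integrable_dil_pow[OF det_B transl_sq])
  have x_sq: "square_integrable ?x" by (intro square_integrable_sum square_integrable_cmult e_sq)
  have "?y \<in> V0 phi"
    unfolding V0_eq_L2_closure using translation_span_square_integrable[OF phi] Zd_ball(1,2)
    by (intro subsetD[OF L2_closure_superset] sum_transl_in_translation_span) auto
  moreover have "?x = dil_pow B (int n) ?y" by (rule dil_pow_sum[OF det_B, symmetric])
  ultimately have "?x \<in> Vn B (int n) phi" unfolding Vn_def by blast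
  moreover have "phi_energy (dil_pow B (- int n) u) = (\<Sum>l\<in>?K. (cmod (phi_coeff (dil_pow B (- int n) u) l))\<^sup>2)"
    by (rule phi_energy_eq_sum) (rule r)
  then have "phi_energy (dil_pow B (- int n) u) = (\<Sum>l\<in>?K. (cmod (L2_inner u (?e l)))\<^sup>2)"
    unfolding phi_coeff_def using L2_inner_dil_pow[OF abs_det u_sq transl_sq] by simp
  then have "(L2_norm (\<lambda>t. u t - ?x t))\<^sup>2 < \<delta>\<^sup>2"
    using Bessel_approximation[where F="?K" and e="?e", OF e_sq Bessel_phi[OF Zd_ball(1,2)] u_sq] n by simp
  then have "L2_norm (\<lambda>t. u t - ?x t) < \<delta>"
    using \<delta> by (intro power_less_imp_less_base[of _ 2 \<delta>]) auto
  ultimately show thesis using x_sq by (intro that)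
qed

theorem Vn_dense: "L2_closure (\<Union>n::int. Vn B n phi) = {f. square_integrable f}"
proof (intro equalityI subsetI)
  fix f assume "f \<in> {f. square_integrable (f :: real^'d \<Rightarrow> complex)}"
  then have f: "square_integrable f" by simp
  have "\<exists>x\<in>(\<Union>n::int. Vn B n phi). L2_dist_sq f x < ennreal \<epsilon>" if "\<epsilon> > 0" for \<epsilon>
  proof -
    define \<delta> where "\<delta> = sqrt \<epsilon> / 2"
    have \<delta>: "\<delta> > 0" "(2 * \<delta>)\<^sup>2 = \<epsilon>" using that by (auto simp: \<delta>_def)
    obtain u where u: "Cc u" "L2_norm (\<lambda>x. u x - f x) < \<delta>" using Cc_dense[OF f \<delta>(1)] by blast
    obtain n x where x: "x \<in> Vn B n phi" "square_integrable x" "L2_norm (\<lambda>t. u t - x t) < \<delta>"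
      using Vn_approximates_Cc[OF u(1) \<delta>(1)] by blast
    have "L2_norm (\<lambda>t. f t - x t) < 2 * \<delta>"
      using L2_norm_triangle_diff[OF f Cc_square_integrable[OF u(1)] x(2)] u(2) x(3)
          L2_norm_minus_commute[of f u]
      by linarith
    then have "(L2_norm (\<lambda>t. f t - x t))\<^sup>2 < (2 * \<delta>)\<^sup>2" by (intro power_strict_mono) auto
    then have "L2_dist_sq f x < ennreal \<epsilon>"
      unfolding L2_dist_sq_eq[OF f x(2)] \<delta>(2) using that by (simp add: ennreal_less_iff)
    then show ?thesis using x(1) by blast
  qed
  then show "f \<in> L2_closure (\<Union>n::int. Vn B n phi)" using f unfolding L2_closure_def by simp
qed (simp add: L2_closure_def)

end

section \<open>Gaussian integrals\<close>

lemma
  fixes f :: "'a::euclidean_space \<Rightarrow> real \<Rightarrow> 'b::{real_normed_field,banach,second_countable_topology}"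
  assumes f: "\<And>b. b \<in> Basis \<Longrightarrow> integrable lborel (f b)"
  shows integrable_prod_Basis: "integrable lborel (\<lambda>x. \<Prod>b\<in>Basis. f b (x \<bullet> b))"
    and integral_prod_Basis: "(LINT x|lborel. (\<Prod>b\<in>Basis. f b (x \<bullet> b))) = (\<Prod>b\<in>Basis. LINT y|lborel. f b y)"
proof -
  interpret product_sigma_finite "\<lambda>_::'a. lborel :: real measure" by standard
  let ?T = "\<lambda>y. \<Sum>b\<in>(Basis :: 'a set). y b *\<^sub>R b" and ?P = "\<Pi>\<^sub>M b\<in>(Basis :: 'a set). (lborel :: real measure)"
  have product: "(\<Prod>b\<in>Basis. f b (?T y \<bullet> b)) = (\<Prod>b\<in>Basis. f b (y b))" for y
    by (intro prod.cong refl) (simp add: inner_sum_left inner_Basis if_distrib cong: if_cong)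
  have [measurable]: "f b \<in> borel_measurable borel" if "b \<in> Basis" for b
    using f[OF that] by auto
  have measurable_product: "(\<lambda>x::'a. \<Prod>b\<in>Basis. f b (x \<bullet> b)) \<in> borel_measurable borel" by measurable
  have measurable_T: "?T \<in> measurable ?P borel" by measurable
  have "integrable ?P (\<lambda>y. \<Prod>b\<in>Basis. f b (y b))"
    by (rule product_integrable_prod) (use f in auto)
  then show "integrable lborel (\<lambda>x. \<Prod>b\<in>Basis. f b (x \<bullet> b))"
    by (subst lborel_eq) (simp only: integrable_distr_eq[OF measurable_T measurable_product] product)
  have "(LINT x|lborel. (\<Prod>b\<in>Basis. f b (x \<bullet> b))) = (LINT y|?P. (\<Prod>b\<in>Basis. f b (y b)))"
    by (subst lborel_eq) (simp only: integral_distr[OF measurable_T measurable_product] product)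
  also have "\<dots> = (\<Prod>b\<in>Basis. LINT y|lborel. f b y)"
    by (rule product_integral_prod) (use f in auto)
  finally show "(LINT x|lborel. (\<Prod>b\<in>Basis. f b (x \<bullet> b))) = (\<Prod>b\<in>Basis. LINT y|lborel. f b y)" .
qed

lemma
  assumes r: "r > 0"
  shows integrable_gaussian_1d: "integrable lborel (\<lambda>x. iexp (t * x) * complex_of_real (exp (- (r * x)\<^sup>2 / 2)))"
    and integral_gaussian_1d: "(LINT x|lborel. iexp (t * x) * complex_of_real (exp (- (r * x)\<^sup>2 / 2)))
       = complex_of_real (sqrt (2 * pi) / r * exp (- (t / r)\<^sup>2 / 2))"
proof -
  define f where "f y = std_normal_density y *\<^sub>R iexp (t / r * y)" for y
  have "integrable lborel std_normal_density"
    using integrable_std_normal_moment[of 0] by simp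
  then have f: "integrable lborel f"
    unfolding f_def[abs_def] by (rule Bochner_Integration.integrable_bound) (auto simp: normal_density_nonneg)
  have "(LINT y|lborel. f y) = (CLINT y|std_normal_distribution. iexp (t / r * y))"
    unfolding f_def by (subst integral_density) (auto simp: normal_density_nonneg)
  also have "\<dots> = complex_of_real (exp (- (t / r)\<^sup>2 / 2))"
    using fun_cong[OF char_std_normal_distribution, of "t / r"] by (simp add: char_def)
  finally have integral_f: "(LINT y|lborel. f y) = complex_of_real (exp (- (t / r)\<^sup>2 / 2))" .
  have rescale: "iexp (t * x) * complex_of_real (exp (- (r * x)\<^sup>2 / 2))
      = complex_of_real (sqrt (2 * pi)) * f (0 + r * x)" for x
    using r by (simp add: f_def std_normal_density_def scaleR_conv_of_real)
  have "integrable lborel (\<lambda>x. f (0 + r * x))"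
    using lborel_integrable_real_affine_iff[of r f 0] r f by simp
  then show "integrable lborel (\<lambda>x. iexp (t * x) * complex_of_real (exp (- (r * x)\<^sup>2 / 2)))"
    unfolding rescale by (intro integrable_mult_right)
  have "(LINT y|lborel. f y) = r *\<^sub>R (LINT x|lborel. f (0 + r * x))"
    using lborel_integral_real_affine[of r f 0] r by simp
  then have "(LINT x|lborel. f (0 + r * x)) = complex_of_real (exp (- (t / r)\<^sup>2 / 2) / r)"
    unfolding integral_f using r by (simp add: scaleR_conv_of_real field_simps)
  then show "(LINT x|lborel. iexp (t * x) * complex_of_real (exp (- (r * x)\<^sup>2 / 2)))
       = complex_of_real (sqrt (2 * pi) / r * exp (- (t / r)\<^sup>2 / 2))"
    unfolding rescale by simp
qed

definition gaussian :: "real \<Rightarrow> 'a::real_normed_vector \<Rightarrow> real" where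
  "gaussian r s = exp (- (r * norm s)\<^sup>2 / 2)"

lemma gaussian_pos: "gaussian r s > 0" and gaussian_le_1: "gaussian r s \<le> 1"
  by (simp_all add: gaussian_def)

lemma abs_gaussian [simp]: "\<bar>gaussian r s\<bar> = gaussian r s" and gaussian_nonneg [simp]: "0 \<le> gaussian r s"
  using gaussian_pos[of r s] by simp_all

lemma gaussian_power2_le: "(gaussian r s)\<^sup>2 \<le> gaussian r s"
  by (simp add: power2_eq_square mult_left_le gaussian_le_1)

lemma gaussian_minus_commute: "gaussian r (s - t) = gaussian r (t - s)"
  by (simp add: gaussian_def norm_minus_commute)

lemma continuous_gaussian: "continuous_on UNIV (gaussian r)"
  unfolding gaussian_def by (intro continuous_intros) auto

lemma measurable_gaussian [measurable]: "gaussian r \<in> borel_measurable borel"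
  by (rule borel_measurable_continuous_onI[OF continuous_gaussian])

lemma gaussian_eq_prod: "gaussian r s = (\<Prod>b\<in>Basis. exp (- (r * (s \<bullet> b))\<^sup>2 / 2))"
proof -
  have "(norm s)\<^sup>2 = (\<Sum>b\<in>Basis. (s \<bullet> b)\<^sup>2)"
    unfolding power2_norm_eq_inner euclidean_inner[of s s] by (simp add: power2_eq_square)
  then have "- (r * norm s)\<^sup>2 / 2 = (\<Sum>b\<in>Basis. - (r * (s \<bullet> b))\<^sup>2 / 2)"
    by (simp add: power_mult_distrib sum_distrib_left sum_negf sum_divide_distrib)
  then show ?thesis unfolding gaussian_def by (simp add: exp_sum)
qed

lemma iexp_inner_eq_prod: "iexp (s \<bullet> t) = (\<Prod>b\<in>Basis. iexp ((t \<bullet> b) * (s \<bullet> b)))" for s t :: "'a::euclidean_space"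
proof -
  have "\<i> * complex_of_real (s \<bullet> t) = (\<Sum>b\<in>Basis. \<i> * complex_of_real ((t \<bullet> b) * (s \<bullet> b)))"
    unfolding euclidean_inner[of s t] by (simp add: sum_distrib_left mult_ac)
  then show ?thesis by (simp only: exp_sum finite_Basis)
qed

definition fourier_integral :: "('a::euclidean_space \<Rightarrow> complex) \<Rightarrow> 'a \<Rightarrow> complex" where
  "fourier_integral f t = (LINT s|lborel. iexp (s \<bullet> t) * f s)"

definition gaussian_transform :: "real \<Rightarrow> 'a::euclidean_space \<Rightarrow> real" where
  "gaussian_transform r t = (sqrt (2 * pi) / r) ^ DIM('a) * gaussian (1 / r) t"

lemma
  fixes t :: "'a::euclidean_space"
  assumes r: "r > 0"
  shows integrable_iexp_gaussian: "integrable lborel (\<lambda>s. iexp (s \<bullet> t) * complex_of_real (gaussian r s))"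
    and fourier_integral_gaussian:
      "fourier_integral (\<lambda>s. complex_of_real (gaussian r s)) t = complex_of_real (gaussian_transform r t)"
proof -
  let ?f = "\<lambda>b x. iexp ((t \<bullet> b) * x) * complex_of_real (exp (- (r * x)\<^sup>2 / 2))"
  have product: "iexp (s \<bullet> t) * complex_of_real (gaussian r s) = (\<Prod>b\<in>Basis. ?f b (s \<bullet> b))" for s
    unfolding iexp_inner_eq_prod gaussian_eq_prod by (simp add: prod.distrib)
  show "integrable lborel (\<lambda>s. iexp (s \<bullet> t) * complex_of_real (gaussian r s))"
    unfolding product by (rule integrable_prod_Basis) (rule integrable_gaussian_1d[OF r])
  have "fourier_integral (\<lambda>s. complex_of_real (gaussian r s)) t = (\<Prod>b\<in>Basis. LINT x|lborel. ?f b x)"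
    unfolding fourier_integral_def product by (rule integral_prod_Basis) (rule integrable_gaussian_1d[OF r])
  also have "\<dots> = (\<Prod>b\<in>(Basis :: 'a set). complex_of_real (sqrt (2 * pi) / r * exp (- (t \<bullet> b / r)\<^sup>2 / 2)))"
    unfolding integral_gaussian_1d[OF r] ..
  also have "\<dots> = complex_of_real (gaussian_transform r t)"
    unfolding gaussian_transform_def gaussian_eq_prod of_real_prod[symmetric] prod.distrib by simp
  finally show "fourier_integral (\<lambda>s. complex_of_real (gaussian r s)) t
      = complex_of_real (gaussian_transform r t)" .
qed

definition gaussian_mass :: "'a::euclidean_space itself \<Rightarrow> real" where
  "gaussian_mass _ = sqrt (2 * pi) ^ DIM('a)"

lemma gaussian_mass_pos: "gaussian_mass TYPE('a::euclidean_space) > 0"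
  by (simp add: gaussian_mass_def)

lemma gaussian_mass_power2: "(gaussian_mass TYPE('a::euclidean_space))\<^sup>2 = (2 * pi) ^ DIM('a)"
  unfolding gaussian_mass_def power2_eq_square power_mult_distrib[symmetric] by simp

lemma gaussian_transform_eq:
  "gaussian_transform r t
    = gaussian_mass TYPE('a) / r ^ DIM('a) * gaussian (1 / r) t" for t :: "'a::euclidean_space"
  by (simp add: gaussian_transform_def gaussian_mass_def power_divide)

lemma
  assumes r: "r > 0"
  shows integrable_gaussian: "integrable lborel (gaussian r :: 'a::euclidean_space \<Rightarrow> real)"
    and integral_gaussian: "(LINT s|lborel. gaussian r (s::'a)) = gaussian_mass TYPE('a) / r ^ DIM('a)"
proof -
  have "integrable lborel (\<lambda>s::'a. complex_of_real (gaussian r s))"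
    using integrable_iexp_gaussian[OF r, of "0::'a"] by simp
  then show "integrable lborel (gaussian r :: 'a \<Rightarrow> real)"
    using complex_of_real_integrable_eq by blast
  have "complex_of_real (LINT s|lborel. gaussian r (s::'a))
      = complex_of_real (gaussian_mass TYPE('a) / r ^ DIM('a))"
    using fourier_integral_gaussian[OF r, of "0::'a"]
    by (simp add: fourier_integral_def gaussian_transform_eq gaussian_def)
  then show "(LINT s|lborel. gaussian r (s::'a)) = gaussian_mass TYPE('a) / r ^ DIM('a)"
    by (simp only: of_real_eq_iff)
qed

section \<open>The Plancherel inequality\<close>

lemma Fubini_bounded_kernel:
  fixes f w :: "'a::euclidean_space \<Rightarrow> complex" and k :: "'a \<Rightarrow> 'a \<Rightarrow> complex"
  assumes f: "integrable lborel f" and w: "integrable lborel w"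
    and k [measurable]: "(\<lambda>(s, t). k s t) \<in> borel_measurable (borel \<Otimes>\<^sub>M borel)"
    and norm_k: "\<And>s t. cmod (k s t) \<le> 1"
  shows "(LINT t|lborel. (LINT s|lborel. k s t * f s) * w t)
    = (LINT s|lborel. f s * (LINT t|lborel. k s t * w t))"
proof -
  have [measurable]: "f \<in> borel_measurable borel" "w \<in> borel_measurable borel" using f w by auto
  have "integrable (lborel \<Otimes>\<^sub>M lborel) (\<lambda>(s, t). f s * w t)"
    by (rule lborel_pair.Fubini_integrable)
       (use f w in \<open>auto simp: norm_mult intro!: integrable_mult_left integrable_norm\<close>)
  then have "integrable (lborel \<Otimes>\<^sub>M lborel) (\<lambda>(s, t). k s t * f s * w t)"
  proof (rule Bochner_Integration.integrable_bound)
    show "(\<lambda>(s, t). k s t * f s * w t) \<in> borel_measurable (lborel \<Otimes>\<^sub>M lborel)" by measurable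
    have "cmod (k s t * f s * w t) \<le> cmod (f s * w t)" for s t
      using mult_right_mono[OF norm_k[of s t], of "cmod (f s * w t)"] by (simp add: norm_mult mult.assoc)
    then show "AE p in lborel \<Otimes>\<^sub>M lborel.
        norm (case p of (s, t) \<Rightarrow> k s t * f s * w t) \<le> norm (case p of (s, t) \<Rightarrow> f s * w t)"
      by (intro AE_I2) (simp add: case_prod_unfold)
  qed
  from lborel_pair.Fubini_integral[OF this]
  have "(LINT t|lborel. LINT s|lborel. k s t * f s * w t)
      = (LINT s|lborel. LINT t|lborel. k s t * f s * w t)" by simp
  moreover have "(LINT s|lborel. k s t * f s * w t) = (LINT s|lborel. k s t * f s) * w t" for t by simp
  moreover have "(LINT t|lborel. k s t * f s * w t) = f s * (LINT t|lborel. k s t * w t)" for s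
    by (simp add: mult_ac flip: integral_mult_right_zero)
  ultimately show ?thesis by simp
qed

lemma measurable_iexp_inner [measurable]:
  "(\<lambda>(s::'a::euclidean_space, t). iexp (s \<bullet> t)) \<in> borel_measurable (borel \<Otimes>\<^sub>M borel)"
  "(\<lambda>(s::'a::euclidean_space, t). iexp (- (s \<bullet> t))) \<in> borel_measurable (borel \<Otimes>\<^sub>M borel)"
  by measurable

lemma measurable_fourier_integral [measurable]:
  assumes [measurable]: "f \<in> borel_measurable borel"
  shows "fourier_integral f \<in> borel_measurable borel"
  unfolding fourier_integral_def by measurable

lemma integrable_iexp_mult:
  fixes f :: "'a::euclidean_space \<Rightarrow> complex"
  assumes "integrable lborel f"
  shows "integrable lborel (\<lambda>s. iexp (s \<bullet> t) * f s)" "integrable lborel (\<lambda>s. iexp (- (s \<bullet> t)) * f s)"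
proof -
  have [measurable]: "f \<in> borel_measurable borel" using assms by auto
  show "integrable lborel (\<lambda>s. iexp (s \<bullet> t) * f s)" "integrable lborel (\<lambda>s. iexp (- (s \<bullet> t)) * f s)"
    by (rule Bochner_Integration.integrable_bound[OF assms]; simp add: norm_mult)+
qed

lemma norm_fourier_integral_le: "cmod (fourier_integral f t) \<le> (LINT s|lborel. cmod (f s))"
proof -
  have "cmod (fourier_integral f t) \<le> (LINT s|lborel. cmod (iexp (s \<bullet> t) * f s))"
    unfolding fourier_integral_def by (rule integral_norm_bound)
  then show ?thesis by (simp add: norm_mult)
qed

lemma cnj_fourier_integral:
  assumes "integrable lborel f"
  shows "cnj (fourier_integral f t) = (LINT s|lborel. iexp (- (s \<bullet> t)) * cnj (f s))"
proof -
  have "cnj (fourier_integral f t) = (LINT s|lborel. cnj (iexp (s \<bullet> t) * f s))"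
    unfolding fourier_integral_def
    by (rule integral_bounded_linear[OF bounded_linear_cnj integrable_iexp_mult(1)[OF assms], symmetric])
  then show ?thesis by (simp add: exp_cnj)
qed

lemma measurable_cnj [measurable]: "cnj \<in> borel_measurable borel"
  by (rule borel_measurable_continuous_onI) (intro continuous_intros)

lemma norm_integral_le_nn_integral:
  fixes f :: "_ \<Rightarrow> 'b::{banach,second_countable_topology}"
  shows "ennreal (norm (integral\<^sup>L M f)) \<le> (\<integral>\<^sup>+ x. ennreal (norm (f x)) \<partial>M)"
  by (cases "integrable M f") (simp_all add: integral_norm_bound_ennreal not_integrable_integral_eq)

lemma nn_integral_lborel_translation:
  fixes x :: "'a::euclidean_space"
  assumes "f \<in> borel_measurable borel"
  shows "(\<integral>\<^sup>+ t. f (x + t) \<partial>lborel) = (\<integral>\<^sup>+ t. f t \<partial>lborel)"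
  using nn_integral_distr[of "(+) x" lborel borel f] assms by (simp add: lborel_distr_plus)

lemma integral_lborel_translation:
  fixes x :: "'a::euclidean_space" and f :: "'a \<Rightarrow> 'b::{banach,second_countable_topology}"
  assumes "f \<in> borel_measurable borel"
  shows "(LINT t|lborel. f (x + t)) = (LINT t|lborel. f t)"
  using integral_distr[of "(+) x" lborel borel f] assms by (simp add: lborel_distr_plus)

lemma measurable_gaussian_transform [measurable]: "gaussian_transform r \<in> borel_measurable borel"
  unfolding gaussian_transform_def by measurable

lemma gaussian_transform_nonneg: "r > 0 \<Longrightarrow> gaussian_transform r x \<ge> 0"
  by (simp add: gaussian_transform_def)

lemma gaussian_transform_minus_commute: "gaussian_transform r (s - t) = gaussian_transform r (t - s)"
  by (simp add: gaussian_transform_def gaussian_minus_commute)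

lemma integral_modulated_gaussian:
  fixes s u :: "'a::euclidean_space"
  assumes r: "r > 0"
  shows "(LINT t|lborel. iexp (- (u \<bullet> t)) * (iexp (s \<bullet> t) * complex_of_real (gaussian r t)))
    = complex_of_real (gaussian_transform r (s - u))"
proof -
  have "iexp (- (u \<bullet> t)) * iexp (s \<bullet> t) = iexp (t \<bullet> (s - u))" for t
    by (simp add: inner_diff_right inner_commute[of t] right_diff_distrib flip: exp_add)
  then show ?thesis
    using fourier_integral_gaussian[OF r, of "s - u"]
    by (simp only: fourier_integral_def mult.assoc[symmetric])
qed

lemma nn_integral_gaussian_transform:
  fixes s :: "'a::euclidean_space"
  assumes r: "r > 0"
  shows "(\<integral>\<^sup>+ u. ennreal (gaussian_transform r (s - u)) \<partial>lborel) = ennreal ((2 * pi) ^ DIM('a))"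
proof -
  have "(\<integral>\<^sup>+ u. ennreal (gaussian_transform r (s - u)) \<partial>lborel)
      = (\<integral>\<^sup>+ u. ennreal (gaussian_transform r (- s + u)) \<partial>lborel)"
    by (simp add: gaussian_transform_minus_commute[of r s])
  also have "\<dots> = (\<integral>\<^sup>+ u. ennreal (gaussian_transform r (u :: 'a)) \<partial>lborel)"
    by (rule nn_integral_lborel_translation) measurable
  also have "\<dots> = ennreal (LINT u|lborel. gaussian_transform r (u :: 'a))"
  proof (rule nn_integral_eq_integral)
    show "integrable lborel (gaussian_transform r :: 'a \<Rightarrow> real)"
      unfolding gaussian_transform_def using r by (intro integrable_mult_right integrable_gaussian) simp
  qed (simp add: gaussian_transform_nonneg[OF r])
  also have "(LINT u|lborel. gaussian_transform r (u :: 'a)) = (gaussian_mass TYPE('a))\<^sup>2"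
    unfolding gaussian_transform_eq using r integral_gaussian[of "1 / r", where 'a='a]
    by (simp add: power2_eq_square power_divide)
  finally show ?thesis by (simp add: gaussian_mass_power2)
qed

lemma nn_integral_kernel_le:
  fixes f :: "'a \<Rightarrow> ennreal" and k :: "'a \<Rightarrow> 'b \<Rightarrow> ennreal"
  assumes f: "f \<in> borel_measurable M" and k: "\<And>x. x \<in> space M \<Longrightarrow> k x \<in> borel_measurable N"
    and row: "\<And>x. (\<integral>\<^sup>+ y. k x y \<partial>N) \<le> c"
  shows "(\<integral>\<^sup>+ x. \<integral>\<^sup>+ y. f x * k x y \<partial>N \<partial>M) \<le> c * (\<integral>\<^sup>+ x. f x \<partial>M)"
proof -
  have "(\<integral>\<^sup>+ x. \<integral>\<^sup>+ y. f x * k x y \<partial>N \<partial>M) = (\<integral>\<^sup>+ x. f x * (\<integral>\<^sup>+ y. k x y \<partial>N) \<partial>M)"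
    by (auto intro!: nn_integral_cong nn_integral_cmult k)
  also have "\<dots> \<le> (\<integral>\<^sup>+ x. c * f x \<partial>M)"
    by (intro nn_integral_mono) (subst mult.commute, intro mult_right_mono row, simp)
  also have "\<dots> = c * (\<integral>\<^sup>+ x. f x \<partial>M)" by (rule nn_integral_cmult[OF f])
  finally show ?thesis .
qed

lemma Schur_test:
  fixes f :: "'a \<Rightarrow> ennreal" and k :: "'a \<Rightarrow> 'a \<Rightarrow> ennreal"
  assumes "sigma_finite_measure M"
    and [measurable]: "f \<in> borel_measurable M" "(\<lambda>(x, y). k x y) \<in> borel_measurable (M \<Otimes>\<^sub>M M)"
    and row: "\<And>x. (\<integral>\<^sup>+ y. k x y \<partial>M) \<le> c" and col: "\<And>y. (\<integral>\<^sup>+ x. k x y \<partial>M) \<le> c"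
  shows "(\<integral>\<^sup>+ x. \<integral>\<^sup>+ y. f x * f y * k x y \<partial>M \<partial>M) \<le> c * (\<integral>\<^sup>+ x. (f x)\<^sup>2 \<partial>M)"
proof -
  interpret pair_sigma_finite M M by (intro pair_sigma_finite.intro assms(1))
  let ?Q = "\<integral>\<^sup>+ x. (f x)\<^sup>2 \<partial>M"
  have row_part: "(\<integral>\<^sup>+ x. \<integral>\<^sup>+ y. (f x)\<^sup>2 * k x y \<partial>M \<partial>M) \<le> c * ?Q"
    by (rule nn_integral_kernel_le[OF _ _ row]) measurable
  have "(\<integral>\<^sup>+ x. \<integral>\<^sup>+ y. (f y)\<^sup>2 * k x y \<partial>M \<partial>M) = (\<integral>\<^sup>+ y. \<integral>\<^sup>+ x. (f y)\<^sup>2 * k x y \<partial>M \<partial>M)"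
    by (rule Fubini'[symmetric]) measurable
  also have "\<dots> \<le> c * ?Q" by (rule nn_integral_kernel_le[OF _ _ col]) measurable
  finally have col_part: "(\<integral>\<^sup>+ x. \<integral>\<^sup>+ y. (f y)\<^sup>2 * k x y \<partial>M \<partial>M) \<le> c * ?Q" .
  have "2 * (\<integral>\<^sup>+ x. \<integral>\<^sup>+ y. f x * f y * k x y \<partial>M \<partial>M) = (\<integral>\<^sup>+ x. 2 * (\<integral>\<^sup>+ y. f x * f y * k x y \<partial>M) \<partial>M)"
    by (rule nn_integral_cmult[symmetric]) measurable
  also have "\<dots> = (\<integral>\<^sup>+ x. \<integral>\<^sup>+ y. 2 * (f x * f y * k x y) \<partial>M \<partial>M)"
    by (intro nn_integral_cong nn_integral_cmult[symmetric]) measurable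
  also have "\<dots> = (\<integral>\<^sup>+ x. \<integral>\<^sup>+ y. 2 * f x * f y * k x y \<partial>M \<partial>M)"
    by (simp only: mult.assoc)
  also have "\<dots> \<le> (\<integral>\<^sup>+ x. \<integral>\<^sup>+ y. (f x)\<^sup>2 * k x y + (f y)\<^sup>2 * k x y \<partial>M \<partial>M)"
    unfolding distrib_right[symmetric]
    by (intro nn_integral_mono mult_right_mono sum_of_squares_ge_ennreal) simp
  also have "\<dots> = (\<integral>\<^sup>+ x. (\<integral>\<^sup>+ y. (f x)\<^sup>2 * k x y \<partial>M) + (\<integral>\<^sup>+ y. (f y)\<^sup>2 * k x y \<partial>M) \<partial>M)"
    by (intro nn_integral_cong nn_integral_add) measurable
  also have "\<dots> = (\<integral>\<^sup>+ x. \<integral>\<^sup>+ y. (f x)\<^sup>2 * k x y \<partial>M \<partial>M) + (\<integral>\<^sup>+ x. \<integral>\<^sup>+ y. (f y)\<^sup>2 * k x y \<partial>M \<partial>M)"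
    by (intro nn_integral_add) measurable
  also have "\<dots> \<le> c * ?Q + c * ?Q" by (intro add_mono row_part col_part)
  also have "\<dots> = 2 * (c * ?Q)" by (simp only: mult_2)
  finally show ?thesis by (subst (asm) ennreal_mult_le_mult_iff) auto
qed

lemma integrable_fourier_gaussian_weight:
  fixes f :: "'a::euclidean_space \<Rightarrow> complex"
  assumes f: "integrable lborel f" and r: "r > 0"
  shows "integrable lborel (\<lambda>t. (cmod (fourier_integral f t))\<^sup>2 * gaussian r t)"
    and "integrable lborel (\<lambda>t. cnj (fourier_integral f t) * complex_of_real (gaussian r t))"
proof -
  have [measurable]: "f \<in> borel_measurable borel" using f by auto
  define K where "K = (LINT s|lborel. cmod (f s))"
  have K: "cmod (fourier_integral f t) \<le> K" "0 \<le> K" for t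
    unfolding K_def by (simp_all add: norm_fourier_integral_le)
  show "integrable lborel (\<lambda>t. (cmod (fourier_integral f t))\<^sup>2 * gaussian r t)"
  proof (rule Bochner_Integration.integrable_bound)
    show "integrable lborel (\<lambda>t::'a. K\<^sup>2 * gaussian r t)"
      using integrable_gaussian[OF r] by (rule integrable_mult_right)
    show "AE t in lborel. norm ((cmod (fourier_integral f t))\<^sup>2 * gaussian r t) \<le> norm (K\<^sup>2 * gaussian r t)"
      by (intro AE_I2) (simp add: abs_mult mult_right_mono power_mono[OF K(1)])
  qed measurable
  show "integrable lborel (\<lambda>t. cnj (fourier_integral f t) * complex_of_real (gaussian r t))"
  proof (rule Bochner_Integration.integrable_bound)
    show "integrable lborel (\<lambda>t::'a. K * gaussian r t)"
      using integrable_gaussian[OF r] by (rule integrable_mult_right)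
    show "AE t in lborel. norm (cnj (fourier_integral f t) * complex_of_real (gaussian r t))
        \<le> norm (K * gaussian r t)"
      by (intro AE_I2) (simp add: norm_mult abs_mult mult_right_mono K)
  qed measurable
qed

text \<open>A Gaussian weight on the transform side turns the squared norm into a quadratic form with a
  positive kernel.\<close>

lemma integral_fourier_gaussian_weight:
  fixes f :: "'a::euclidean_space \<Rightarrow> complex"
  assumes f: "integrable lborel f" and r: "r > 0"
  shows "complex_of_real (LINT t|lborel. (cmod (fourier_integral f t))\<^sup>2 * gaussian r t)
    = (LINT s|lborel. f s * (LINT u|lborel. cnj (f u) * complex_of_real (gaussian_transform r (s - u))))"
proof -
  let ?w = "\<lambda>t. cnj (fourier_integral f t) * complex_of_real (gaussian r t)"
  have inner: "(LINT t|lborel. iexp (s \<bullet> t) * ?w t)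
      = (LINT u|lborel. cnj (f u) * complex_of_real (gaussian_transform r (s - u)))" for s
  proof -
    let ?e = "\<lambda>t. iexp (s \<bullet> t) * complex_of_real (gaussian r t)"
    have e: "integrable lborel ?e"
      using integrable_iexp_gaussian[OF r, of s] by (simp add: inner_commute)
    have "iexp (s \<bullet> t) * ?w t = (LINT u|lborel. iexp (- (u \<bullet> t)) * cnj (f u)) * ?e t" for t
      unfolding cnj_fourier_integral[OF f] by (simp only: mult_ac)
    moreover have "(LINT t|lborel. (LINT u|lborel. iexp (- (u \<bullet> t)) * cnj (f u)) * ?e t)
        = (LINT u|lborel. cnj (f u) * (LINT t|lborel. iexp (- (u \<bullet> t)) * ?e t))"
      by (rule Fubini_bounded_kernel[OF _ e measurable_iexp_inner(2)]) (use f in auto)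
    ultimately show ?thesis unfolding integral_modulated_gaussian[OF r] by (simp only:)
  qed
  have "complex_of_real ((cmod (fourier_integral f t))\<^sup>2 * gaussian r t)
      = (LINT s|lborel. iexp (s \<bullet> t) * f s) * ?w t" for t
    unfolding fourier_integral_def[symmetric] of_real_mult complex_norm_square by (simp only: mult_ac)
  then have "complex_of_real (LINT t|lborel. (cmod (fourier_integral f t))\<^sup>2 * gaussian r t)
      = (LINT t|lborel. (LINT s|lborel. iexp (s \<bullet> t) * f s) * ?w t)"
    by (simp only: integral_complex_of_real[symmetric])
  also have "\<dots> = (LINT s|lborel. f s * (LINT t|lborel. iexp (s \<bullet> t) * ?w t))"
    by (rule Fubini_bounded_kernel[OF f integrable_fourier_gaussian_weight(2)[OF f r]
        measurable_iexp_inner(1)]) simp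
  finally show ?thesis unfolding inner .
qed

lemma Plancherel_gaussian_weight:
  fixes f :: "'a::euclidean_space \<Rightarrow> complex"
  assumes f: "integrable lborel f" and r: "r > 0"
  shows "(\<integral>\<^sup>+ t. ennreal ((cmod (fourier_integral f t))\<^sup>2 * gaussian r t) \<partial>lborel)
    \<le> ennreal ((2 * pi) ^ DIM('a)) * (\<integral>\<^sup>+ s. ennreal ((cmod (f s))\<^sup>2) \<partial>lborel)"
proof -
  have [measurable]: "f \<in> borel_measurable borel" using f by auto
  let ?k = "\<lambda>s u. ennreal (gaussian_transform r (s - u))" and ?f = "\<lambda>s. ennreal (cmod (f s))"
  let ?I = "\<lambda>s. LINT u|lborel. cnj (f u) * complex_of_real (gaussian_transform r (s - u))"
  have "(\<integral>\<^sup>+ t. ennreal ((cmod (fourier_integral f t))\<^sup>2 * gaussian r t) \<partial>lborel)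
      = ennreal (LINT t|lborel. (cmod (fourier_integral f t))\<^sup>2 * gaussian r t)"
    by (rule nn_integral_eq_integral[OF integrable_fourier_gaussian_weight(1)[OF f r]]) simp
  also have "(LINT t|lborel. (cmod (fourier_integral f t))\<^sup>2 * gaussian r t) = cmod (LINT s|lborel. f s * ?I s)"
    unfolding integral_fourier_gaussian_weight[OF f r, symmetric] norm_of_real
    by (rule abs_of_nonneg[symmetric]) (intro integral_nonneg_AE AE_I2, simp)
  also have "ennreal \<dots> \<le> (\<integral>\<^sup>+ s. ennreal (cmod (f s * ?I s)) \<partial>lborel)"
    by (rule norm_integral_le_nn_integral)
  also have "\<dots> \<le> (\<integral>\<^sup>+ s. \<integral>\<^sup>+ u. ?f s * ?f u * ?k s u \<partial>lborel \<partial>lborel)"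
  proof (rule nn_integral_mono)
    fix s :: 'a
    have "ennreal (cmod (f s * ?I s)) = ?f s * ennreal (cmod (?I s))"
      by (simp add: norm_mult ennreal_mult)
    also have "\<dots>
        \<le> ?f s * (\<integral>\<^sup>+ u. ennreal (cmod (cnj (f u) * complex_of_real (gaussian_transform r (s - u)))) \<partial>lborel)"
      by (intro mult_left_mono norm_integral_le_nn_integral) simp
    also have "\<dots> = ?f s * (\<integral>\<^sup>+ u. ?f u * ?k s u \<partial>lborel)"
      by (simp add: norm_mult ennreal_mult gaussian_transform_nonneg[OF r])
    also have "\<dots> = (\<integral>\<^sup>+ u. ?f s * ?f u * ?k s u \<partial>lborel)"
      by (subst nn_integral_cmult[symmetric]) (auto simp: mult.assoc)
    finally show "ennreal (cmod (f s * ?I s)) \<le> (\<integral>\<^sup>+ u. ?f s * ?f u * ?k s u \<partial>lborel)" .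
  qed
  also have "\<dots> \<le> ennreal ((2 * pi) ^ DIM('a)) * (\<integral>\<^sup>+ s. (?f s)\<^sup>2 \<partial>lborel)"
  proof (rule Schur_test[OF sigma_finite_lborel])
    show "(\<integral>\<^sup>+ u. ?k s u \<partial>lborel) \<le> ennreal ((2 * pi) ^ DIM('a))" for s :: 'a
      by (simp only: nn_integral_gaussian_transform[OF r] order_refl)
    then show "(\<integral>\<^sup>+ s. ?k s u \<partial>lborel) \<le> ennreal ((2 * pi) ^ DIM('a))" for u :: 'a
      by (simp only: gaussian_transform_minus_commute[of r _ u])
  qed measurable
  finally show ?thesis by (simp add: ennreal_power)
qed

lemma Plancherel_inequality:
  fixes f :: "'a::euclidean_space \<Rightarrow> complex"
  assumes f: "integrable lborel f"
  shows "(\<integral>\<^sup>+ t. ennreal ((cmod (fourier_integral f t))\<^sup>2) \<partial>lborel)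
    \<le> ennreal ((2 * pi) ^ DIM('a)) * (\<integral>\<^sup>+ s. ennreal ((cmod (f s))\<^sup>2) \<partial>lborel)" (is "_ \<le> ?bound")
proof -
  have [measurable]: "f \<in> borel_measurable borel" using f by auto
  let ?g = "\<lambda>n t. ennreal ((cmod (fourier_integral f t))\<^sup>2 * gaussian (1 / real (Suc n)) t)"
  have lim: "(\<lambda>n. ?g n t) \<longlonglongrightarrow> ennreal ((cmod (fourier_integral f t))\<^sup>2)" for t
  proof -
    have "(\<lambda>n. 1 / real (Suc n)) \<longlonglongrightarrow> 0" by (rule LIMSEQ_Suc) (rule lim_1_over_n)
    then have "(\<lambda>n. gaussian (1 / real (Suc n)) t) \<longlonglongrightarrow> exp (- (0 * norm t)\<^sup>2 / 2)"
      unfolding gaussian_def by (intro tendsto_intros) auto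
    from tendsto_mult[OF tendsto_const[of "(cmod (fourier_integral f t))\<^sup>2"] this]
    have "(\<lambda>n. (cmod (fourier_integral f t))\<^sup>2 * gaussian (1 / real (Suc n)) t)
        \<longlonglongrightarrow> (cmod (fourier_integral f t))\<^sup>2" by simp
    then show ?thesis by (rule tendsto_ennrealI)
  qed
  have "(\<integral>\<^sup>+ t. ennreal ((cmod (fourier_integral f t))\<^sup>2) \<partial>lborel) = (\<integral>\<^sup>+ t. liminf (\<lambda>n. ?g n t) \<partial>lborel)"
    by (intro nn_integral_cong lim_imp_Liminf[OF sequentially_bot, symmetric] lim)
  also have "\<dots> \<le> liminf (\<lambda>n. \<integral>\<^sup>+ t. ?g n t \<partial>lborel)"
    by (rule nn_integral_liminf) measurable
  also have "\<dots> \<le> liminf (\<lambda>n::nat. ?bound)"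
    by (intro Liminf_mono always_eventually allI Plancherel_gaussian_weight[OF f]) simp
  also have "\<dots> = ?bound" by (simp add: Liminf_const)
  finally show ?thesis .
qed

section \<open>The inverse Fourier transform on square-integrable functions\<close>

lemma integral_lebesgue_borel:
  fixes f :: "'a::euclidean_space \<Rightarrow> 'b::{banach,second_countable_topology}"
  shows "f \<in> borel_measurable borel \<Longrightarrow> integral\<^sup>L lebesgue f = integral\<^sup>L lborel f"
  by (rule integral_completion) simp

lemma integrable_lebesgue_borel:
  fixes f :: "'a::euclidean_space \<Rightarrow> 'b::{banach,second_countable_topology}"
  shows "f \<in> borel_measurable borel \<Longrightarrow> integrable lebesgue f \<longleftrightarrow> integrable lborel f"
  by (rule integrable_completion) simp

lemma borel_measurable_lebesgueI: "f \<in> borel_measurable borel \<Longrightarrow> f \<in> borel_measurable lebesgue"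
  by (rule measurable_completion) simp

lemma fourier_normalization:
  "(2 * pi) powr (- real CARD('d) / 2) = 1 / gaussian_mass TYPE(real^'d::finite)"
proof -
  have "gaussian_mass TYPE(real^'d) = (2 * pi) powr (real CARD('d) / 2)"
    unfolding gaussian_mass_def by (simp add: powr_half_sqrt[symmetric] powr_powr flip: powr_realpow)
  then show ?thesis by (simp add: powr_minus field_simps)
qed

lemma inv_fourier_int_eq:
  fixes f :: "real^'d::finite \<Rightarrow> complex"
  assumes [measurable]: "f \<in> borel_measurable borel"
  shows "inv_fourier_int f = (\<lambda>t. fourier_integral f t / complex_of_real (gaussian_mass TYPE(real^'d)))"
  unfolding inv_fourier_int_def fourier_integral_def fourier_normalization
  by (subst integral_lebesgue_borel) auto

lemma measurable_inv_fourier_int [measurable]: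
  assumes [measurable]: "f \<in> borel_measurable borel"
  shows "inv_fourier_int f \<in> borel_measurable borel"
  unfolding inv_fourier_int_eq[OF assms] by measurable

lemma inv_fourier_int_diff:
  assumes "integrable lborel f" "integrable lborel g"
  shows "inv_fourier_int (\<lambda>s. f s - g s) = (\<lambda>t. inv_fourier_int f t - inv_fourier_int g t)"
proof -
  have [measurable]: "f \<in> borel_measurable borel" "g \<in> borel_measurable borel" using assms by auto
  show ?thesis
    using integrable_iexp_mult(1)[OF assms(1)] integrable_iexp_mult(1)[OF assms(2)]
    by (simp add: inv_fourier_int_eq fourier_integral_def right_diff_distrib diff_divide_distrib)
qed

lemma inv_fourier_int_contraction:
  fixes f :: "real^'d::finite \<Rightarrow> complex"
  assumes f: "integrable lborel f" and f_sq: "square_integrable f"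
  shows "square_integrable (inv_fourier_int f)" "L2_norm (inv_fourier_int f) \<le> L2_norm f"
proof -
  have [measurable]: "f \<in> borel_measurable borel" using f by auto
  let ?m = "gaussian_mass TYPE(real^'d)"
  have "(\<integral>\<^sup>+ t. ennreal ((cmod (inv_fourier_int f t))\<^sup>2) \<partial>lebesgue)
      = (\<integral>\<^sup>+ t. ennreal (1 / ?m\<^sup>2) * ennreal ((cmod (fourier_integral f t))\<^sup>2) \<partial>lborel)"
    by (subst nn_integral_completion)
       (simp add: inv_fourier_int_eq norm_divide power_divide flip: ennreal_mult)
  also have "\<dots> = ennreal (1 / ?m\<^sup>2) * (\<integral>\<^sup>+ t. ennreal ((cmod (fourier_integral f t))\<^sup>2) \<partial>lborel)"
    by (rule nn_integral_cmult) measurable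
  also have "\<dots> \<le> ennreal (1 / ?m\<^sup>2) * (ennreal (?m\<^sup>2) * (\<integral>\<^sup>+ s. ennreal ((cmod (f s))\<^sup>2) \<partial>lborel))"
    using Plancherel_inequality[OF f] unfolding gaussian_mass_power2 by (rule mult_left_mono) simp
  also have "\<dots> = (\<integral>\<^sup>+ s. ennreal ((cmod (f s))\<^sup>2) \<partial>lebesgue)"
    using gaussian_mass_pos[where 'a="real^'d"]
    by (simp add: mult.assoc[symmetric] nn_integral_completion flip: ennreal_mult)
  also have "\<dots> = ennreal (L2_norm_sq f)" by (rule nn_integral_cmod_sq[OF f_sq])
  finally have nn_integral_le: "(\<integral>\<^sup>+ t. ennreal ((cmod (inv_fourier_int f t))\<^sup>2) \<partial>lebesgue) \<le> ennreal (L2_norm_sq f)" .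
  then show inv_sq: "square_integrable (inv_fourier_int f)"
    unfolding square_integrable_iff_nn_integral
    by (auto intro!: borel_measurable_lebesgueI intro: le_less_trans)
  show "L2_norm (inv_fourier_int f) \<le> L2_norm f"
    using nn_integral_le unfolding nn_integral_cmod_sq[OF inv_sq] by (simp add: L2_norm_def)
qed

lemma inv_fourier_int_pairing:
  fixes f v :: "real^'d::finite \<Rightarrow> complex"
  assumes f: "integrable lborel f" and v: "integrable lborel v"
  shows "(LINT t|lebesgue. inv_fourier_int f t * v t) = (LINT s|lebesgue. f s * inv_fourier_int v s)"
proof -
  have [measurable]: "f \<in> borel_measurable borel" "v \<in> borel_measurable borel" using f v by auto
  have "(LINT t|lborel. (LINT s|lborel. iexp (s \<bullet> t) * f s) * v t)
      = (LINT s|lborel. f s * (LINT t|lborel. iexp (s \<bullet> t) * v t))"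
    by (rule Fubini_bounded_kernel[OF f v measurable_iexp_inner(1)]) simp
  then have "(LINT t|lborel. fourier_integral f t * v t) = (LINT s|lborel. f s * fourier_integral v s)"
    by (simp add: fourier_integral_def inner_commute)
  then show ?thesis
    by (simp add: integral_lebesgue_borel inv_fourier_int_eq)
qed

lemma cube_borel [measurable]: "(cube R :: (real^'d::finite) set) \<in> sets borel"
proof -
  have "(cube R :: (real^'d) set) = cbox (\<chi> i. - R) (\<chi> i. R)"
    by (auto simp: cube_def mem_box_cart abs_le_iff minus_le_iff)
  then show ?thesis by simp
qed

lemma norm_le_of_cube: "x \<in> cube R \<Longrightarrow> norm (x::real^'d::finite) \<le> R * real CARD('d)"
proof -
  assume "x \<in> cube R"
  then have "\<bar>x $ i\<bar> \<le> R" for i by (simp add: cube_def)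
  then have "(\<Sum>i\<in>UNIV. \<bar>x $ i\<bar>) \<le> of_nat CARD('d) * R" by (intro sum_bounded_above) simp
  then show ?thesis using norm_le_l1_cart[of x] by (simp add: mult.commute)
qed

lemma mem_cubeI: "norm x \<le> R \<Longrightarrow> x \<in> cube R"
  using component_le_norm_cart order_trans unfolding cube_def by blast

definition cube_trunc :: "real \<Rightarrow> (real^'d::finite \<Rightarrow> complex) \<Rightarrow> real^'d \<Rightarrow> complex" where
  "cube_trunc R g = (\<lambda>s. indicator (cube R) s * g s)"

lemma cube_trunc_tendsto: "(\<lambda>n. cube_trunc (real n) g x) \<longlonglongrightarrow> g x"
proof -
  obtain n\<^sub>0 :: nat where n\<^sub>0: "norm x \<le> real n\<^sub>0" using real_arch_simple by blast
  have "cube_trunc (real n) g x = g x" if "n \<ge> n\<^sub>0" for n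
    using mem_cubeI[of x "real n"] n\<^sub>0 that by (simp add: cube_trunc_def)
  then show ?thesis by (intro tendsto_eventually eventually_sequentiallyI[of n\<^sub>0])
qed

lemma norm_cube_trunc_le: "cmod (cube_trunc R g x) \<le> cmod (g x)"
  by (simp add: cube_trunc_def indicator_def)

lemma norm_cube_trunc_diff_le:
  assumes "R \<ge> r" "R' \<ge> r"
  shows "cmod (cube_trunc R g s - cube_trunc R' g s) \<le> cmod (cube_trunc r g s - g s)"
proof (cases "s \<in> cube r")
  case True
  then have "s \<in> cube R" "s \<in> cube R'" using assms by (auto simp: cube_def intro: order_trans)
  then show ?thesis using True by (simp add: cube_trunc_def)
qed (simp add: cube_trunc_def indicator_def)

context
  fixes g :: "real^'d::finite \<Rightarrow> complex"
  assumes g [measurable]: "g \<in> borel_measurable borel" and g_sq: "square_integrable g"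
begin

lemma measurable_cube_trunc [measurable]: "cube_trunc R g \<in> borel_measurable borel"
  unfolding cube_trunc_def by measurable

lemma square_integrable_cube_trunc: "square_integrable (cube_trunc R g)"
  by (rule square_integrable_bound[of _ "\<lambda>s. cmod (g s)"])
     (use g_sq in \<open>auto simp: square_integrable_def norm_cube_trunc_le intro!: borel_measurable_lebesgueI\<close>)

lemma integrable_cube_trunc: "integrable lborel (cube_trunc R g)"
proof -
  have "square_integrable (\<lambda>s::real^'d. indicator (cube R) s :: complex)"
  proof (rule bounded_support_square_integrable(1)[of _ 1 "R * CARD('d)"])
    show "indicator (cube R) s = (0::complex)" if "norm s > R * CARD('d)" for s :: "real^'d"
      using norm_le_of_cube[of s R] that by (auto simp: indicator_def)
  qed (auto simp: indicator_def intro!: borel_measurable_lebesgueI)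
  from square_integrable_mult_integrable[OF this g_sq] show ?thesis
    by (subst integrable_lebesgue_borel[symmetric]) (simp_all add: cube_trunc_def)
qed

lemma square_integrable_inv_fourier_cube_trunc: "square_integrable (inv_fourier_int (cube_trunc R g))"
  by (intro inv_fourier_int_contraction integrable_cube_trunc square_integrable_cube_trunc)

lemma cube_trunc_L2_tendsto: "(\<lambda>n. L2_norm (\<lambda>s. cube_trunc (real n) g s - g s)) \<longlonglongrightarrow> 0"
  by (rule L2_dominated_convergence(3)[where w="\<lambda>s. cmod (g s)"])
     (use g_sq in \<open>auto simp: square_integrable_def cube_trunc_tendsto norm_cube_trunc_le
        intro: borel_measurable_lebesgueI\<close>)

lemma inv_fourier_cube_trunc_diff_le:
  assumes "R \<ge> r" "R' \<ge> r"
  shows "L2_norm (\<lambda>t. inv_fourier_int (cube_trunc R g) t - inv_fourier_int (cube_trunc R' g) t)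
    \<le> L2_norm (\<lambda>s. cube_trunc r g s - g s)"
proof -
  note diff_sq = square_integrable_diff[OF square_integrable_cube_trunc]
  have "L2_norm (\<lambda>t. inv_fourier_int (cube_trunc R g) t - inv_fourier_int (cube_trunc R' g) t)
      \<le> L2_norm (\<lambda>s. cube_trunc R g s - cube_trunc R' g s)"
    unfolding inv_fourier_int_diff[OF integrable_cube_trunc integrable_cube_trunc, symmetric]
    by (intro inv_fourier_int_contraction(2) Bochner_Integration.integrable_diff integrable_cube_trunc
        diff_sq square_integrable_cube_trunc)
  also have "\<dots> \<le> L2_norm (\<lambda>s. cube_trunc r g s - g s)"
    unfolding L2_norm_def L2_norm_sq_def
    using diff_sq[OF square_integrable_cube_trunc, of R R'] diff_sq[OF g_sq, of r]
    by (intro real_sqrt_le_mono integral_mono power_mono norm_cube_trunc_diff_le assms)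
       (auto simp: square_integrable_def)
  finally show ?thesis .
qed

lemma inv_fourier_cube_trunc_L2_limit:
  obtains \<phi> where "square_integrable \<phi>"
    "(\<lambda>n. L2_norm (\<lambda>t. inv_fourier_int (cube_trunc (real n) g) t - \<phi> t)) \<longlonglongrightarrow> 0"
proof -
  let ?F = "\<lambda>R. inv_fourier_int (cube_trunc R g)" and ?err = "\<lambda>n. L2_norm (\<lambda>s. cube_trunc (real n) g s - g s)"
  have "\<exists>N. \<forall>m\<ge>N. \<forall>n\<ge>N. L2_norm (\<lambda>t. ?F (real m) t - ?F (real n) t) < e" if "e > 0" for e
  proof -
    obtain N where N: "?err N < e"
      using eventually_happens'[OF sequentially_bot order_tendstoD(2)[OF cube_trunc_L2_tendsto \<open>e > 0\<close>]]
      by blast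
    have "L2_norm (\<lambda>t. ?F (real m) t - ?F (real n) t) < e" if "m \<ge> N" "n \<ge> N" for m n
      using inv_fourier_cube_trunc_diff_le[of "real N" "real m" "real n"] that N by simp
    then show ?thesis by blast
  qed
  then show thesis
    using L2_complete[of "\<lambda>n. ?F (real n)"] square_integrable_inv_fourier_cube_trunc that by blast
qed

lemma inv_fourier_L2_exists:
  "\<exists>\<phi>. square_integrable \<phi> \<and> ((\<lambda>R. L2_dist_sq \<phi> (inv_fourier_int (cube_trunc R g))) \<longlongrightarrow> 0) at_top"
proof -
  let ?F = "\<lambda>R. inv_fourier_int (cube_trunc R g)" and ?err = "\<lambda>n. L2_norm (\<lambda>s. cube_trunc (real n) g s - g s)"
  note F_sq = square_integrable_inv_fourier_cube_trunc
  obtain \<phi> where \<phi>: "square_integrable \<phi>" "(\<lambda>n. L2_norm (\<lambda>t. ?F (real n) t - \<phi> t)) \<longlonglongrightarrow> 0"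
    by (rule inv_fourier_cube_trunc_L2_limit)
  let ?n = "\<lambda>R::real. nat \<lfloor>R\<rfloor>"
  have floor: "filterlim ?n sequentially at_top"
    by (rule filterlim_compose[OF filterlim_nat_sequentially filterlim_floor_sequentially])
  have "((\<lambda>R. L2_norm (\<lambda>t. \<phi> t - ?F R t)) \<longlongrightarrow> 0) at_top"
  proof (rule Lim_null_comparison)
    show "((\<lambda>R. ?err (?n R) + L2_norm (\<lambda>t. ?F (real (?n R)) t - \<phi> t)) \<longlongrightarrow> 0) at_top"
      using tendsto_add[OF filterlim_compose[OF cube_trunc_L2_tendsto floor] filterlim_compose[OF \<phi>(2) floor]]
      by simp
    show "\<forall>\<^sub>F R in at_top. norm (L2_norm (\<lambda>t. \<phi> t - ?F R t))
        \<le> ?err (?n R) + L2_norm (\<lambda>t. ?F (real (?n R)) t - \<phi> t)"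
      using eventually_ge_at_top[of "0::real"]
    proof eventually_elim
      case (elim R)
      then have "L2_norm (\<lambda>t. ?F R t - ?F (real (?n R)) t) \<le> ?err (?n R)"
        by (intro inv_fourier_cube_trunc_diff_le) auto
      then show ?case
        using L2_norm_triangle_diff[OF F_sq[of R] F_sq[of "real (?n R)"] \<phi>(1)]
          L2_norm_minus_commute[of \<phi> "?F R"]
        by simp
    qed
  qed
  then have "((\<lambda>R. ennreal ((L2_norm (\<lambda>t. \<phi> t - ?F R t))\<^sup>2)) \<longlongrightarrow> ennreal (0\<^sup>2)) at_top"
    by (intro tendsto_ennrealI tendsto_power)
  then have "((\<lambda>R. L2_dist_sq \<phi> (?F R)) \<longlongrightarrow> 0) at_top"
    unfolding L2_dist_sq_eq[OF \<phi>(1) F_sq] by simp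
  with \<phi>(1) show ?thesis by blast
qed

lemma inv_fourier_L2_spec:
  "square_integrable (inv_fourier_L2 g)"
  "(\<lambda>n. L2_norm (\<lambda>t. inv_fourier_int (cube_trunc (real n) g) t - inv_fourier_L2 g t)) \<longlonglongrightarrow> 0"
proof -
  let ?F = "\<lambda>R. inv_fourier_int (cube_trunc R g)"
  note F_sq = square_integrable_inv_fourier_cube_trunc
  have spec: "square_integrable (inv_fourier_L2 g)" "((\<lambda>R. L2_dist_sq (inv_fourier_L2 g) (?F R)) \<longlongrightarrow> 0) at_top"
    using someI_ex[OF inv_fourier_L2_exists] unfolding inv_fourier_L2_def cube_trunc_def by auto
  then show "square_integrable (inv_fourier_L2 g)" by blast
  have "(\<lambda>n. ennreal ((L2_norm (\<lambda>t. ?F (real n) t - inv_fourier_L2 g t))\<^sup>2)) \<longlonglongrightarrow> ennreal 0"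
    using filterlim_compose[OF spec(2) filterlim_real_sequentially] L2_norm_minus_commute[of "inv_fourier_L2 g"]
    unfolding L2_dist_sq_eq[OF spec(1) F_sq] by simp
  then have "(\<lambda>n. (L2_norm (\<lambda>t. ?F (real n) t - inv_fourier_L2 g t))\<^sup>2) \<longlonglongrightarrow> 0"
    by (subst (asm) tendsto_ennreal_iff) auto
  from tendsto_real_sqrt[OF this]
  show "(\<lambda>n. L2_norm (\<lambda>t. ?F (real n) t - inv_fourier_L2 g t)) \<longlonglongrightarrow> 0"
    unfolding real_sqrt_abs by simp
qed

lemma inv_fourier_L2_pairing:
  assumes v: "integrable lborel v" "square_integrable v"
  shows "(LINT t|lebesgue. inv_fourier_L2 g t * v t) = (LINT s|lebesgue. g s * inv_fourier_int v s)"
proof -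
  let ?G = "\<lambda>n::nat. cube_trunc (real n) g"
  have "(\<lambda>n. L2_inner (inv_fourier_int (?G n)) (\<lambda>t. cnj (v t))) \<longlonglongrightarrow> L2_inner (inv_fourier_L2 g) (\<lambda>t. cnj (v t))"
    by (intro L2_inner_tendsto_left square_integrable_inv_fourier_cube_trunc inv_fourier_L2_spec
        square_integrable_cnj v)
  moreover have "(\<lambda>n. L2_inner (?G n) (\<lambda>s. cnj (inv_fourier_int v s)))
      \<longlonglongrightarrow> L2_inner g (\<lambda>s. cnj (inv_fourier_int v s))"
    by (intro L2_inner_tendsto_left square_integrable_cube_trunc g_sq cube_trunc_L2_tendsto
        square_integrable_cnj inv_fourier_int_contraction v)
  moreover have "L2_inner (inv_fourier_int (?G n)) (\<lambda>t. cnj (v t))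
      = L2_inner (?G n) (\<lambda>s. cnj (inv_fourier_int v s))" for n
    using inv_fourier_int_pairing[OF integrable_cube_trunc v(1)] by (simp add: L2_inner_def)
  ultimately have "L2_inner (inv_fourier_L2 g) (\<lambda>t. cnj (v t)) = L2_inner g (\<lambda>s. cnj (inv_fourier_int v s))"
    using LIMSEQ_unique by (simp only:) blast
  then show ?thesis by (simp add: L2_inner_def)
qed

end

definition gaussian_at :: "real \<Rightarrow> 'a::real_normed_vector \<Rightarrow> 'a \<Rightarrow> complex" where
  "gaussian_at r x t = complex_of_real (gaussian r (t - x))"

lemma measurable_gaussian_at [measurable]:
  fixes x :: "'a::euclidean_space"
  shows "gaussian_at r x \<in> borel_measurable borel"
    and "(\<lambda>(x, t). gaussian_at r x t) \<in> borel_measurable (borel \<Otimes>\<^sub>M (borel :: 'a measure))"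
  unfolding gaussian_at_def by measurable

lemma norm_gaussian_at: "cmod (gaussian_at r x t) = gaussian r (t - x)"
  by (simp add: gaussian_at_def)

lemma
  assumes r: "r > 0"
  shows integrable_gaussian_at: "integrable lborel (gaussian_at r (x::'a::euclidean_space))"
    and fourier_integral_gaussian_at:
      "fourier_integral (gaussian_at r x) s = iexp (x \<bullet> s) * complex_of_real (gaussian_transform r s)"
proof -
  have "integrable lborel (\<lambda>t::'a. complex_of_real (gaussian r t))"
    using integrable_gaussian[OF r] by (simp add: complex_of_real_integrable_eq)
  then have "integrable (distr lborel borel ((+) (- x))) (\<lambda>t. complex_of_real (gaussian r t))"
    by (simp add: lborel_distr_plus)
  then show "integrable lborel (gaussian_at r x)"
    unfolding gaussian_at_def by (subst (asm) integrable_distr_eq) auto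
  have "fourier_integral (gaussian_at r x) s = (LINT t|lborel. iexp ((x + t) \<bullet> s) * gaussian_at r x (x + t))"
    unfolding fourier_integral_def by (rule integral_lborel_translation[symmetric]) measurable
  also have "\<dots> = (LINT t|lborel. iexp (x \<bullet> s) * (iexp (t \<bullet> s) * complex_of_real (gaussian r t)))"
    by (simp add: gaussian_at_def inner_add_left distrib_left exp_add mult.assoc)
  also have "\<dots> = iexp (x \<bullet> s) * fourier_integral (\<lambda>t. complex_of_real (gaussian r t)) s"
    unfolding fourier_integral_def by (rule integral_mult_right_zero)
  finally show "fourier_integral (gaussian_at r x) s = iexp (x \<bullet> s) * complex_of_real (gaussian_transform r s)"
    unfolding fourier_integral_gaussian[OF r] .
qed

lemma square_integrable_gaussian_at:
  assumes r: "r > 0"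
  shows "square_integrable (gaussian_at r x)"
  unfolding square_integrable_def
proof
  show "integrable lebesgue (\<lambda>t. (cmod (gaussian_at r x t))\<^sup>2)"
  proof (rule Bochner_Integration.integrable_bound)
    show "integrable lebesgue (gaussian_at r x)"
      using integrable_gaussian_at[OF r] by (simp add: integrable_lebesgue_borel)
    show "AE t in lebesgue. norm ((cmod (gaussian_at r x t))\<^sup>2) \<le> norm (gaussian_at r x t)"
      by (simp add: norm_gaussian_at gaussian_power2_le)
  qed (auto intro!: borel_measurable_lebesgueI)
qed (auto intro!: borel_measurable_lebesgueI)

lemma inv_fourier_int_gaussian_at:
  fixes x s :: "real^'d::finite"
  assumes r: "r > 0"
  shows "inv_fourier_int (gaussian_at r x) s
    = iexp (x \<bullet> s) * complex_of_real (gaussian (1 / r) s / r ^ CARD('d))"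
  using gaussian_mass_pos[where 'a="real^'d"]
  by (simp add: inv_fourier_int_eq fourier_integral_gaussian_at[OF r] gaussian_transform_eq)

lemma integrable_inv_fourier_int_gaussian_at:
  assumes r: "r > 0"
  shows "integrable lborel (inv_fourier_int (gaussian_at r (x::real^'d::finite)))"
proof (rule Bochner_Integration.integrable_bound)
  show "integrable lborel (\<lambda>s::real^'d. gaussian (1 / r) s / r ^ CARD('d))"
    using r by (intro integrable_divide integrable_gaussian) simp
  show "AE s in lborel. norm (inv_fourier_int (gaussian_at r x) s) \<le> norm (gaussian (1 / r) s / r ^ CARD('d))"
    using r by (simp add: inv_fourier_int_gaussian_at norm_mult norm_divide norm_power)
qed measurable

lemma Fourier_inversion_gaussian_at:
  fixes x p :: "real^'d::finite"
  assumes r: "r > 0"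
  shows "(LINT s|lborel. iexp (- (p \<bullet> s)) * inv_fourier_int (gaussian_at r x) s)
    = complex_of_real (gaussian_mass TYPE(real^'d)) * gaussian_at r x p"
proof -
  have "iexp (- (p \<bullet> s)) * inv_fourier_int (gaussian_at r x) s
      = (iexp (- (p \<bullet> s)) * (iexp (x \<bullet> s) * complex_of_real (gaussian (1 / r) s)))
        / complex_of_real (r ^ CARD('d))" for s
    by (simp add: inv_fourier_int_gaussian_at[OF r])
  then have "(LINT s|lborel. iexp (- (p \<bullet> s)) * inv_fourier_int (gaussian_at r x) s)
      = complex_of_real (gaussian_transform (1 / r) (x - p)) / complex_of_real (r ^ CARD('d))"
    using integral_modulated_gaussian[of "1 / r" p x] r by simp
  also have "\<dots> = complex_of_real (gaussian_mass TYPE(real^'d)) * gaussian_at r x p"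
    using r by (simp add: gaussian_transform_eq gaussian_at_def gaussian_minus_commute[of r x] power_divide)
  finally show ?thesis .
qed

section \<open>From Gaussian test functions to continuous ones\<close>

lemma lebesgue_borel_representative:
  fixes f :: "'a::euclidean_space \<Rightarrow> complex"
  assumes "f \<in> borel_measurable lebesgue"
  obtains f' where "f' \<in> borel_measurable borel" "AE x in lebesgue. f x = f' x"
proof -
  have "(\<lambda>x. Re (f x)) \<in> borel_measurable lebesgue" "(\<lambda>x. Im (f x)) \<in> borel_measurable lebesgue"
    using assms by auto
  then obtain re im where re: "re \<in> borel_measurable lborel" "AE x in lborel. Re (f x) = re x"
    and im: "im \<in> borel_measurable lborel" "AE x in lborel. Im (f x) = im x"
    by (auto dest!: completion_ex_borel_measurable_real)
  have measurable: "(\<lambda>x. Complex (re x) (im x)) \<in> borel_measurable borel"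
    using re(1) im(1) by (auto simp: borel_measurable_complex_iff)
  have "AE x in lborel. f x = Complex (re x) (im x)"
    using re(2) im(2) by eventually_elim (auto intro: complex_eqI)
  then have "AE x in lebesgue. f x = Complex (re x) (im x)" by (rule AE_completion)
  with measurable show thesis by (rule that)
qed

lemma Cc_uniformly_continuous:
  fixes u :: "'a::euclidean_space \<Rightarrow> 'b::real_normed_vector"
  assumes "Cc u"
  shows "uniformly_continuous_on UNIV u"
  unfolding uniformly_continuous_on_def
proof (intro allI impI)
  fix e :: real assume e: "e > 0"
  obtain R where R: "\<And>x. norm x > R \<Longrightarrow> u x = 0" and cont: "continuous_on UNIV u"
    using assms by (auto simp: Cc_def)
  have "uniformly_continuous_on (cball 0 (R + 1)) u"
    by (rule compact_uniformly_continuous[OF continuous_on_subset[OF cont]]) auto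
  then obtain \<delta> where \<delta>: "\<delta> > 0"
      "\<And>x y. x \<in> cball 0 (R + 1) \<Longrightarrow> y \<in> cball 0 (R + 1) \<Longrightarrow> dist y x < \<delta> \<Longrightarrow> dist (u y) (u x) < e"
    using e unfolding uniformly_continuous_on_def by blast
  have "dist (u y) (u x) < e" if close: "dist y x < min \<delta> 1" for x y
  proof (cases "norm x \<le> R + 1 \<and> norm y \<le> R + 1")
    case True
    then show ?thesis using \<delta>(2)[of x y] close by simp
  next
    case False
    then have "norm x > R" "norm y > R"
      using close norm_triangle_sub[of x y] norm_triangle_sub[of y x]
      by (auto simp: dist_norm norm_minus_commute)
    then show ?thesis using R e by simp
  qed
  then show "\<exists>d>0. \<forall>x\<in>UNIV. \<forall>y\<in>UNIV. dist y x < d \<longrightarrow> dist (u y) (u x) < e"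
    using \<delta>(1) by (intro exI[of _ "min \<delta> 1"]) simp
qed

lemma gaussian_shift_le:
  fixes x t :: "'a::real_normed_vector"
  assumes x: "norm x \<le> \<rho>" and r: "1 \<le> r"
  shows "gaussian r (t - x) \<le> exp (\<rho>\<^sup>2 / 4) * gaussian (1/2) t * gaussian (r / sqrt 2) (t - x)"
proof -
  have "norm t \<le> \<rho> + norm (t - x)" using norm_triangle_sub[of t x] x by simp
  then have "(norm t)\<^sup>2 \<le> (\<rho> + norm (t - x))\<^sup>2" by (intro power_mono) auto
  also have "\<dots> \<le> 2 * \<rho>\<^sup>2 + 2 * (norm (t - x))\<^sup>2"
    using sum_squares_bound[of \<rho> "norm (t - x)"] by (simp add: power2_sum)
  also have "\<dots> \<le> 2 * \<rho>\<^sup>2 + 2 * (r * norm (t - x))\<^sup>2"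
    using r by (intro add_left_mono mult_left_mono power_mono) (auto simp: mult_le_cancel_right1)
  finally have "- (r * norm (t - x))\<^sup>2 / 2
      \<le> \<rho>\<^sup>2 / 4 + - (1/2 * norm t)\<^sup>2 / 2 + - (r / sqrt 2 * norm (t - x))\<^sup>2 / 2"
    by (simp add: power_mult_distrib power_divide)
  then show ?thesis unfolding gaussian_def exp_add[symmetric] by simp
qed

lemma gaussian_tail_le:
  assumes "0 \<le> \<delta>" "\<delta> \<le> norm z"
  shows "gaussian r z \<le> exp (- (r * \<delta>)\<^sup>2 / 4) * gaussian (r / sqrt 2) z"
proof -
  have "r\<^sup>2 * \<delta>\<^sup>2 \<le> r\<^sup>2 * (norm z)\<^sup>2" using assms by (intro mult_left_mono power_mono) auto
  then have "- (r * norm z)\<^sup>2 / 2 \<le> - (r * \<delta>)\<^sup>2 / 4 + - (r / sqrt 2 * norm z)\<^sup>2 / 2"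
    by (simp add: power_mult_distrib power_divide)
  then show ?thesis unfolding gaussian_def exp_add[symmetric] by simp
qed

lemma
  fixes t :: "'a::euclidean_space"
  assumes r: "r > 0"
  shows integrable_gaussian_reflect: "integrable lborel (\<lambda>x. gaussian r (t - x))"
    and integral_gaussian_reflect: "(LINT x|lborel. gaussian r (t - x)) = gaussian_mass TYPE('a) / r ^ DIM('a)"
proof -
  show "integrable lborel (\<lambda>x. gaussian r (t - x))"
    using integrable_norm[OF integrable_gaussian_at[OF r, of t]]
    by (simp add: norm_gaussian_at gaussian_minus_commute)
  have "(LINT x|lborel. gaussian r (t - x)) = (LINT x|lborel. gaussian r (- t + x))"
    by (simp add: gaussian_minus_commute[of r t])
  then show "(LINT x|lborel. gaussian r (t - x)) = gaussian_mass TYPE('a) / r ^ DIM('a)"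
    using integral_lborel_translation[of "gaussian r" "- t"] integral_gaussian[OF r, where 'a='a] by simp
qed

definition gaussian_mollify :: "real \<Rightarrow> ('a::euclidean_space \<Rightarrow> complex) \<Rightarrow> 'a \<Rightarrow> complex" where
  "gaussian_mollify r u t =
    complex_of_real (r ^ DIM('a) / gaussian_mass TYPE('a)) * (LINT x|lborel. u x * gaussian_at r x t)"

lemma norm_gaussian_mollify_le:
  fixes v :: "'a::euclidean_space \<Rightarrow> complex"
  assumes r: "r > 0" and c: "integrable lborel c"
    and bound: "\<And>x. cmod (v x) * gaussian r (t - x) \<le> c x"
  shows "cmod (gaussian_mollify r v t) \<le> r ^ DIM('a) / gaussian_mass TYPE('a) * (LINT x|lborel. c x)"
proof -
  have "cmod (LINT x|lborel. v x * gaussian_at r x t) \<le> (LINT x|lborel. c x)"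
  proof (cases "integrable lborel (\<lambda>x. v x * gaussian_at r x t)")
    case True
    then show ?thesis
      by (rule Bochner_Integration.integral_norm_bound_integral[OF _ c])
         (use bound in \<open>simp add: norm_mult norm_gaussian_at\<close>)
  next
    case False
    have "0 \<le> c x" for x by (rule order_trans[OF _ bound]) simp
    then show ?thesis using False by (simp add: not_integrable_integral_eq)
  qed
  then show ?thesis
    using r gaussian_mass_pos[where 'a='a]
    by (simp add: gaussian_mollify_def norm_mult norm_divide norm_power divide_right_mono mult_left_mono)
qed

context
  fixes u :: "real^'d::finite \<Rightarrow> complex"
  assumes u: "Cc u"
begin

lemma Cc_integrable_lborel: "integrable lborel u"
  using Cc_integrable[OF u] integrable_lebesgue_borel[OF Cc_measurable[OF u]] by simp

lemma measurable_Cc [measurable]: "u \<in> borel_measurable borel"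
  by (rule Cc_measurable[OF u])

lemma measurable_gaussian_mollify [measurable]: "gaussian_mollify r u \<in> borel_measurable borel"
proof -
  have "(\<lambda>t. LINT x|lborel. u x * gaussian_at r x t) \<in> borel_measurable borel"
    unfolding gaussian_at_def by (rule lborel.borel_measurable_lebesgue_integral) measurable
  then show ?thesis unfolding gaussian_mollify_def by (intro borel_measurable_times borel_measurable_const)
qed

lemma integrable_mult_gaussian_at: "integrable lborel (\<lambda>x. u x * gaussian_at r x t)"
proof (rule Bochner_Integration.integrable_bound[OF Cc_integrable_lborel])
  show "(\<lambda>x. u x * gaussian_at r x t) \<in> borel_measurable lborel" unfolding gaussian_at_def by measurable
  show "AE x in lborel. norm (u x * gaussian_at r x t) \<le> norm (u x)"
    by (simp add: norm_mult norm_gaussian_at mult_left_le gaussian_le_1)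
qed

lemma gaussian_mollify_dominated:
  obtains D where "\<And>r t. 1 \<le> r \<Longrightarrow> cmod (gaussian_mollify r u t) \<le> D * gaussian (1/2) t"
proof -
  obtain K \<rho> where K: "K \<ge> 0" "\<And>x. cmod (u x) \<le> K" and \<rho>: "\<And>x. norm x > \<rho> \<Longrightarrow> u x = 0"
    using Cc_bounded[OF u] by metis
  let ?D = "K * exp (\<rho>\<^sup>2 / 4)"
  have "cmod (gaussian_mollify r u t) \<le> ?D * sqrt 2 ^ CARD('d) * gaussian (1/2) t" if r: "1 \<le> r" for r t
  proof -
    let ?c = "\<lambda>x. ?D * gaussian (1/2) t * gaussian (r / sqrt 2) (t - x)"
    have "cmod (gaussian_mollify r u t)
        \<le> r ^ DIM(real^'d) / gaussian_mass TYPE(real^'d) * (LINT x|lborel. ?c x)"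
    proof (rule norm_gaussian_mollify_le)
      show "integrable lborel ?c" using r by (intro integrable_mult_right integrable_gaussian_reflect) simp
      show "cmod (u x) * gaussian r (t - x) \<le> ?c x" for x
      proof (cases "norm x > \<rho>")
        case False
        then have "cmod (u x) * gaussian r (t - x)
            \<le> K * (exp (\<rho>\<^sup>2 / 4) * gaussian (1/2) t * gaussian (r / sqrt 2) (t - x))"
          using K r by (intro mult_mono gaussian_shift_le) auto
        then show ?thesis by (simp add: mult.assoc)
      qed (use \<rho> K(1) in simp)
    qed (use r in simp)
    also have "\<dots> = ?D * sqrt 2 ^ CARD('d) * gaussian (1/2) t"
      using r gaussian_mass_pos[where 'a="real^'d"] integral_gaussian_reflect[of "r / sqrt 2" t]
      by (simp add: power_divide field_simps)
    finally show ?thesis .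
  qed
  then show thesis by (rule that)
qed

lemma gaussian_mollify_diff:
  assumes r: "r > 0"
  shows "gaussian_mollify r u t - u t = gaussian_mollify r (\<lambda>x. u x - u t) t"
proof -
  have "(LINT x|lborel. gaussian_at r x t) = complex_of_real (gaussian_mass TYPE(real^'d) / r ^ CARD('d))"
    unfolding gaussian_at_def by (simp add: integral_gaussian_reflect[OF r])
  moreover have "integrable lborel (\<lambda>x. u t * gaussian_at r x t)"
    unfolding gaussian_at_def using integrable_gaussian_reflect[OF r, of t] by simp
  ultimately show ?thesis
    using r gaussian_mass_pos[where 'a="real^'d"] integrable_mult_gaussian_at[of r t]
    by (simp add: gaussian_mollify_def left_diff_distrib right_diff_distrib)
qed

lemma gaussian_mollify_error_le:
  assumes r: "r > 0" and \<delta>: "\<delta> > 0" and e: "e \<ge> 0" and K: "\<And>x. cmod (u x) \<le> K"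
    and modulus: "\<And>x. dist x t < \<delta> \<Longrightarrow> cmod (u x - u t) \<le> e"
  shows "cmod (gaussian_mollify r u t - u t) \<le> e + 2 * K * sqrt 2 ^ CARD('d) * exp (- (r * \<delta>)\<^sup>2 / 4)"
proof -
  let ?m = "gaussian_mass TYPE(real^'d)"
  let ?tail = "exp (- (r * \<delta>)\<^sup>2 / 4)"
  let ?c = "\<lambda>x. e * gaussian r (t - x) + 2 * K * ?tail * gaussian (r / sqrt 2) (t - x)"
  have "0 \<le> K" using K[of 0] norm_ge_zero order_trans by blast
  have "cmod (gaussian_mollify r u t - u t) \<le> r ^ DIM(real^'d) / ?m * (LINT x|lborel. ?c x)"
    unfolding gaussian_mollify_diff[OF r]
  proof (rule norm_gaussian_mollify_le[OF r])
    show "integrable lborel ?c"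
      using r
      by (intro Bochner_Integration.integrable_add integrable_mult_right integrable_gaussian_reflect) auto
    show "cmod (u x - u t) * gaussian r (t - x) \<le> ?c x" for x
    proof (cases "dist x t < \<delta>")
      case True
      then show ?thesis
        using \<open>0 \<le> K\<close> mult_right_mono[OF modulus[OF True], of "gaussian r (t - x)"]
        by (simp add: add_increasing2)
    next
      case False
      have "cmod (u x - u t) \<le> 2 * K" using norm_triangle_ineq4[of "u x" "u t"] K[of x] K[of t] by linarith
      then have "cmod (u x - u t) * gaussian r (t - x) \<le> 2 * K * (?tail * gaussian (r / sqrt 2) (t - x))"
        using False \<delta> \<open>0 \<le> K\<close> by (intro mult_mono gaussian_tail_le) (auto simp: dist_norm norm_minus_commute)
      then show ?thesis using e by (simp add: add_increasing mult.assoc)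
    qed
  qed
  also have "(LINT x|lborel. ?c x)
      = e * (?m / r ^ DIM(real^'d)) + 2 * K * ?tail * (?m / (r / sqrt 2) ^ DIM(real^'d))"
    using r by (simp add: integrable_gaussian_reflect integral_gaussian_reflect)
  also have "r ^ DIM(real^'d) / ?m * \<dots> = e + 2 * K * sqrt 2 ^ CARD('d) * ?tail"
    using r gaussian_mass_pos[where 'a="real^'d"] by (simp add: power_divide field_simps)
  finally show ?thesis .
qed

lemma uniform_limit_gaussian_mollify: "uniform_limit UNIV (\<lambda>r. gaussian_mollify r u) u at_top"
proof (rule uniform_limitI)
  fix e :: real assume "e > 0"
  then have half: "e / 2 > 0" by simp
  obtain K where K: "\<And>x. cmod (u x) \<le> K" using Cc_bounded[OF u] by metis
  obtain \<delta> where \<delta>: "\<delta> > 0" "\<And>x y. dist x y < \<delta> \<Longrightarrow> dist (u x) (u y) < e / 2"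
    using Cc_uniformly_continuous[OF u] half unfolding uniformly_continuous_on_def by blast
  let ?C = "2 * K * sqrt 2 ^ CARD('d)"
  have "filterlim (\<lambda>r::real. - (\<delta>\<^sup>2 / 4) * r\<^sup>2) at_bot at_top"
    using \<delta>(1)
    by (intro filterlim_tendsto_neg_mult_at_bot[OF tendsto_const] filterlim_pow_at_top filterlim_ident) auto
  from tendsto_mult_right_zero[OF filterlim_compose[OF exp_at_bot this], of ?C]
  have "((\<lambda>r. ?C * exp (- (r * \<delta>)\<^sup>2 / 4)) \<longlongrightarrow> 0) at_top"
    by (simp add: power_mult_distrib mult.commute)
  from order_tendstoD(2)[OF this half] eventually_gt_at_top[of "0::real"]
  show "\<forall>\<^sub>F r in at_top. \<forall>t\<in>UNIV. dist (gaussian_mollify r u t) (u t) < e"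
  proof eventually_elim
    case (elim r)
    have error: "cmod (gaussian_mollify r u t - u t) \<le> e / 2 + ?C * exp (- (r * \<delta>)\<^sup>2 / 4)" for t
      using \<delta> half elim by (intro gaussian_mollify_error_le K) (auto simp: dist_norm intro: less_imp_le)
    have "cmod (gaussian_mollify r u t - u t) < e" for t
      using error[of t] elim by linarith
    then show ?case by (simp add: dist_norm)
  qed
qed

lemma gaussian_mollify_pairing:
  assumes [measurable]: "p \<in> borel_measurable borel" and p_sq: "square_integrable p" and r: "1 \<le> r"
  shows "(LINT t|lborel. p t * gaussian_mollify r u t) =
    complex_of_real (r ^ CARD('d) / gaussian_mass TYPE(real^'d))
      * (LINT x|lborel. u x * (LINT t|lborel. p t * gaussian_at r x t))"
proof -
  obtain \<rho> where \<rho>: "\<And>x. norm x > \<rho> \<Longrightarrow> u x = 0" using Cc_bounded[OF u] by metis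
  let ?G = "\<lambda>t::real^'d. exp (\<rho>\<^sup>2 / 4) * gaussian (1/2) t"
  let ?k = "\<lambda>x t. if norm x \<le> \<rho> then gaussian_at r x t / complex_of_real (?G t) else 0"
  let ?w = "\<lambda>t. p t * complex_of_real (?G t)"
  have weight: "complex_of_real (?G t) \<noteq> 0" for t using gaussian_pos[of "1/2" t] by simp
  have [measurable]: "?w \<in> borel_measurable borel" by measurable
  have "integrable lebesgue (\<lambda>t. p t * (complex_of_real (exp (\<rho>\<^sup>2 / 4)) * gaussian_at (1/2) 0 t))"
    by (intro square_integrable_mult_integrable square_integrable_cmult p_sq square_integrable_gaussian_at) simp
  then have w: "integrable lborel ?w"
    by (subst integrable_lebesgue_borel[symmetric]) (simp_all add: gaussian_at_def)
  have "(LINT t|lborel. (LINT x|lborel. ?k x t * u x) * ?w t)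
      = (LINT x|lborel. u x * (LINT t|lborel. ?k x t * ?w t))"
  proof (rule Fubini_bounded_kernel[OF Cc_integrable_lborel w])
    show "(\<lambda>(x, t). ?k x t) \<in> borel_measurable (borel \<Otimes>\<^sub>M borel)" unfolding gaussian_at_def by measurable
    have "gaussian r (t - x) \<le> ?G t" if "norm x \<le> \<rho>" for x t :: "real^'d"
      by (rule order_trans[OF gaussian_shift_le[OF that r]]) (simp add: mult_left_le gaussian_le_1)
    then show "cmod (?k x t) \<le> 1" for x t
      using gaussian_pos[of "1/2" t] by (auto simp: norm_divide norm_mult norm_gaussian_at)
  qed
  moreover have "?k x t * u x = (u x * gaussian_at r x t) / complex_of_real (?G t)" for x t
    using \<rho>[of x] by simp
  then have "(LINT x|lborel. ?k x t * u x) * ?w t = p t * (LINT x|lborel. u x * gaussian_at r x t)" for t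
    using weight[of t] by simp
  moreover have "u x * (LINT t|lborel. ?k x t * ?w t) = u x * (LINT t|lborel. p t * gaussian_at r x t)" for x
  proof (cases "norm x > \<rho>")
    case False
    then have "?k x t * ?w t = p t * gaussian_at r x t" for t using weight[of t] by simp
    then show ?thesis by (simp only:)
  qed (simp add: \<rho>)
  ultimately have "(LINT t|lborel. p t * (LINT x|lborel. u x * gaussian_at r x t))
      = (LINT x|lborel. u x * (LINT t|lborel. p t * gaussian_at r x t))"
    by (simp only:)
  then show ?thesis
    by (simp add: gaussian_mollify_def mult.left_commute[of "p _"])
qed

lemma gaussian_mollify_pairing_tendsto:
  assumes [measurable]: "p \<in> borel_measurable borel" and p_sq: "square_integrable p"
  shows "((\<lambda>r. LINT t|lborel. p t * gaussian_mollify r u t) \<longlongrightarrow> (LINT t|lborel. p t * u t)) at_top"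
proof -
  obtain D where D: "\<And>r t. 1 \<le> r \<Longrightarrow> cmod (gaussian_mollify r u t) \<le> D * gaussian (1/2) t"
    using gaussian_mollify_dominated by blast
  show ?thesis
  proof (rule integral_dominated_convergence_at_top[where w="\<lambda>t. D * cmod (p t * gaussian_at (1/2) 0 t)"])
    have "integrable lebesgue (\<lambda>t. p t * gaussian_at (1/2) 0 t)"
      by (intro square_integrable_mult_integrable p_sq square_integrable_gaussian_at) simp
    then show "integrable lborel (\<lambda>t. D * cmod (p t * gaussian_at (1/2) 0 t))"
      by (subst (asm) integrable_lebesgue_borel) auto
    show "AE t in lborel. ((\<lambda>r. p t * gaussian_mollify r u t) \<longlongrightarrow> p t * u t) at_top"
      by (intro AE_I2 tendsto_mult tendsto_const tendsto_uniform_limitI[OF uniform_limit_gaussian_mollify]) simp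
    show "\<forall>\<^sub>F r in at_top. AE t in lborel. cmod (p t * gaussian_mollify r u t)
        \<le> D * cmod (p t * gaussian_at (1/2) 0 t)"
      using eventually_ge_at_top[of 1]
    proof eventually_elim
      case (elim r)
      then show ?case
        using mult_left_mono[OF D] by (auto simp: norm_mult norm_gaussian_at mult.left_commute[of D])
    qed
  qed measurable
qed

end

definition discrete_integral :: "'i set \<Rightarrow> ('i \<Rightarrow> complex) \<Rightarrow> ('i \<Rightarrow> 'a) \<Rightarrow> ('a \<Rightarrow> complex) \<Rightarrow> complex" where
  "discrete_integral M w q F = (\<Sum>m\<in>M. w m * F (q m))"

lemma norm_discrete_integral_le:
  assumes "\<And>x. cmod (F x) \<le> b"
  shows "cmod (discrete_integral M w q F) \<le> (\<Sum>m\<in>M. cmod (w m)) * b"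
  unfolding discrete_integral_def sum_distrib_right
  by (rule sum_norm_le) (simp add: norm_mult assms mult_left_mono)

lemma discrete_integral_diff:
  "discrete_integral M w q (\<lambda>x. F x - G x) = discrete_integral M w q F - discrete_integral M w q G"
  by (simp add: discrete_integral_def right_diff_distrib sum_subtractf)

lemma discrete_integral_mult_right: "discrete_integral M w q (\<lambda>x. F x * c) = discrete_integral M w q F * c"
  by (simp add: discrete_integral_def sum_distrib_right mult.assoc)

lemma uniform_limit_discrete_integral:
  assumes lim: "uniform_limit UNIV F f G" and variation: "\<And>k. (\<Sum>m\<in>M k. cmod (w k m)) \<le> C"
  shows "uniform_limit UNIV (\<lambda>i k. discrete_integral (M k) (w k) (q k) (F i))
    (\<lambda>k. discrete_integral (M k) (w k) (q k) f) G"
proof (rule uniform_limitI)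
  let ?I = "\<lambda>k. discrete_integral (M k) (w k) (q k)"
  fix e :: real assume "e > 0"
  have C: "C \<ge> 0" using variation by (rule order_trans[rotated]) (simp add: sum_nonneg)
  with \<open>e > 0\<close> have "e / (C + 1) > 0" by simp
  from uniform_limitD[OF lim this]
  show "\<forall>\<^sub>F i in G. \<forall>k\<in>UNIV. dist (?I k (F i)) (?I k f) < e"
  proof eventually_elim
    case (elim i)
    have "dist (?I k (F i)) (?I k f) \<le> C * (e / (C + 1))" for k
      unfolding dist_norm discrete_integral_diff[symmetric]
      using elim \<open>e > 0\<close> C by (intro order_trans[OF norm_discrete_integral_le mult_right_mono[OF variation]])
        (auto simp: dist_norm intro: less_imp_le)
    moreover have "C * (e / (C + 1)) < e" using \<open>e > 0\<close> C by (simp add: field_simps)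
    ultimately show ?case by (auto intro: le_less_trans)
  qed
qed

lemma discrete_integral_gaussian_mollify:
  fixes u :: "real^'d::finite \<Rightarrow> complex"
  assumes u: "Cc u"
  shows "discrete_integral M w q (gaussian_mollify r u) =
    complex_of_real (r ^ CARD('d) / gaussian_mass TYPE(real^'d))
      * (LINT x|lborel. u x * discrete_integral M w q (gaussian_at r x))"
proof -
  let ?c = "complex_of_real (r ^ CARD('d) / gaussian_mass TYPE(real^'d))"
  have "discrete_integral M w q (gaussian_mollify r u)
      = ?c * (\<Sum>m\<in>M. w m * (LINT x|lborel. u x * gaussian_at r x (q m)))"
    by (simp add: discrete_integral_def gaussian_mollify_def sum_distrib_left mult_ac)
  also have "\<dots> = ?c * (\<Sum>m\<in>M. LINT x|lborel. w m * (u x * gaussian_at r x (q m)))"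
    by (simp only: integral_mult_right_zero)
  also have "(\<Sum>m\<in>M. LINT x|lborel. w m * (u x * gaussian_at r x (q m)))
      = (LINT x|lborel. (\<Sum>m\<in>M. w m * (u x * gaussian_at r x (q m))))"
    by (intro Bochner_Integration.integral_sum[symmetric] integrable_mult_right integrable_mult_gaussian_at u)
  finally show ?thesis
    by (simp add: discrete_integral_def sum_distrib_left mult.left_commute[of "w _"])
qed

lemma discrete_integral_mollify_tendsto:
  fixes p u :: "real^'d::finite \<Rightarrow> complex" and w :: "nat \<Rightarrow> 'i \<Rightarrow> complex"
  assumes p [measurable]: "p \<in> borel_measurable borel" and p_sq: "square_integrable p"
    and u: "Cc u" and r: "1 \<le> r"
    and variation: "\<And>k. (\<Sum>m\<in>M k. cmod (w k m)) \<le> C"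
    and gaussian_limit: "\<And>x. (\<lambda>k. discrete_integral (M k) (w k) (q k) (gaussian_at r x))
      \<longlonglongrightarrow> (LINT t|lborel. p t * gaussian_at r x t)"
  shows "(\<lambda>k. discrete_integral (M k) (w k) (q k) (gaussian_mollify r u))
    \<longlonglongrightarrow> (LINT t|lborel. p t * gaussian_mollify r u t)"
  unfolding discrete_integral_gaussian_mollify[OF u] gaussian_mollify_pairing[OF u p p_sq r]
proof (rule tendsto_mult[OF tendsto_const])
  let ?I = "\<lambda>k x. discrete_integral (M k) (w k) (q k) (gaussian_at r x)"
  have [measurable]: "u \<in> borel_measurable borel" by (rule Cc_measurable[OF u])
  show "(\<lambda>k. LINT x|lborel. u x * ?I k x) \<longlonglongrightarrow> (LINT x|lborel. u x * (LINT t|lborel. p t * gaussian_at r x t))"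
  proof (rule integral_dominated_convergence[where w="\<lambda>x. C * cmod (u x)"])
    show "integrable lborel (\<lambda>x. C * cmod (u x))"
      by (intro integrable_mult_right integrable_norm Cc_integrable_lborel u)
    show "AE x in lborel. (\<lambda>k. u x * ?I k x) \<longlonglongrightarrow> u x * (LINT t|lborel. p t * gaussian_at r x t)"
      by (intro AE_I2 tendsto_mult tendsto_const gaussian_limit)
    have "cmod (?I k x) \<le> C" for k x
      using norm_discrete_integral_le[of "gaussian_at r x" 1 "M k" "w k" "q k"] variation[of k]
      by (simp add: norm_gaussian_at gaussian_le_1)
    then show "AE x in lborel. norm (u x * ?I k x) \<le> C * cmod (u x)" for k
      by (simp add: norm_mult mult.commute[of C] mult_left_mono)
    show "(\<lambda>x. u x * ?I k x) \<in> borel_measurable lborel" for k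
      unfolding discrete_integral_def gaussian_at_def by measurable
    show "(\<lambda>x. u x * (LINT t|lborel. p t * gaussian_at r x t)) \<in> borel_measurable lborel"
      unfolding gaussian_at_def by measurable
  qed
qed

lemma discrete_integral_tendsto_of_gaussian:
  fixes phi u :: "real^'d::finite \<Rightarrow> complex" and w :: "nat \<Rightarrow> 'i \<Rightarrow> complex"
  assumes phi: "square_integrable phi" and u: "Cc u"
    and variation: "\<And>k. (\<Sum>m\<in>M k. cmod (w k m)) \<le> C"
    and gaussian_limit: "\<And>r x. r > 0 \<Longrightarrow> (\<lambda>k. discrete_integral (M k) (w k) (q k) (gaussian_at r x))
      \<longlonglongrightarrow> (LINT t|lebesgue. phi t * gaussian_at r x t)"
  shows "(\<lambda>k. discrete_integral (M k) (w k) (q k) u) \<longlonglongrightarrow> (LINT t|lebesgue. phi t * u t)"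
proof -
  let ?I = "\<lambda>k. discrete_integral (M k) (w k) (q k)"
  have [measurable]: "phi \<in> borel_measurable lebesgue" using phi by (simp add: square_integrable_def)
  obtain p where p [measurable]: "p \<in> borel_measurable borel" and phi_p: "AE x in lebesgue. phi x = p x"
    using lebesgue_borel_representative[of phi] by auto
  have p_sq: "square_integrable p" by (rule square_integrable_AE_cong(1)[OF phi phi_p])
  have pairing: "(LINT t|lebesgue. phi t * v t) = (LINT t|lborel. p t * v t)"
    if v: "v \<in> borel_measurable borel" for v :: "real^'d \<Rightarrow> complex"
  proof -
    note [measurable] = borel_measurable_lebesgueI[OF p] borel_measurable_lebesgueI[OF v]
    have "(LINT t|lebesgue. phi t * v t) = (LINT t|lebesgue. p t * v t)"
      by (intro integral_cong_AE) (auto intro: eventually_mono[OF phi_p])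
    then show ?thesis using p v by (simp add: integral_lebesgue_borel)
  qed
  have mollified: "\<forall>\<^sub>F r in at_top. (\<lambda>k. ?I k (gaussian_mollify r u))
      \<longlonglongrightarrow> (LINT t|lborel. p t * gaussian_mollify r u t)"
    using eventually_ge_at_top[of 1]
  proof eventually_elim
    case (elim r)
    then show ?case
      using gaussian_limit[of r]
      by (intro discrete_integral_mollify_tendsto[OF p p_sq u elim variation]) (simp add: pairing)
  qed
  show ?thesis
    unfolding pairing[OF Cc_measurable[OF u]]
    by (rule swap_uniform_limit'[OF mollified gaussian_mollify_pairing_tendsto[OF u p p_sq]
        uniform_limit_discrete_integral[OF uniform_limit_gaussian_mollify[OF u] variation]]) simp_all
qed

section \<open>The cascade of a refinement mask\<close>

lemma finite_Lambda0: "finite (Lambda0 N0 :: (real^'d::finite) set)"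
  unfolding Lambda0_def by (rule finite_Zd_bounded)

lemma Lambda0_Zd: "Lambda0 N0 \<subseteq> Zd"
  by (auto simp: Lambda0_def)

text \<open>The unit cells at the points of \<open>M\<close> are disjoint, and \<open>B\<^bsup>-k\<^esup>\<close> maps them into a fixed ball.\<close>

lemma card_Zd_le:
  fixes B :: "real^'d::finite^'d"
  assumes det: "det B \<noteq> 0" and M: "finite M" "M \<subseteq> Zd"
    and radius: "\<And>m. m \<in> M \<Longrightarrow> norm (mat_pow (matrix_inv B) k *v m) \<le> R"
    and contraction: "onorm ((*v) (mat_pow (matrix_inv B) k)) \<le> D"
  shows "real (card M) \<le> \<bar>det B\<bar> ^ k * measure lebesgue (cball (0::real^'d) (R + D * CARD('d)))"
proof -
  let ?F = "\<lambda>l. indicator M l :: real" and ?P = "mat_pow B k"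
  let ?ball = "cball (0::real^'d) (R + D * CARD('d))"
  have step: "integrable lebesgue (\<lambda>t. ?F (vec_floor t))" "(LINT t|lebesgue. ?F (vec_floor t)) = (\<Sum>l\<in>M. ?F l)"
    by (rule integral_step_function[OF M]; simp)+
  have det_P: "det ?P \<noteq> 0" and abs_det_P: "\<bar>det ?P\<bar> = \<bar>det B\<bar> ^ k"
    using det by (simp_all add: det_mat_pow power_abs)
  note measurable_F = borel_measurable_integrable[OF step(1)]
  have "real (card M) = \<bar>det B\<bar> ^ k * (LINT t|lebesgue. ?F (vec_floor (?P *v t)))"
    using integral_affine[OF det_P measurable_F, of 0] det_P step(2) by (simp add: abs_det_P[symmetric])
  also have "(LINT t|lebesgue. ?F (vec_floor (?P *v t))) \<le> (LINT t|lebesgue. 1 * indicator ?ball t)"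
  proof (rule integral_mono)
    show "integrable lebesgue (\<lambda>t. ?F (vec_floor (?P *v t)))"
      using integrable_affine[OF det_P measurable_F, of 0] step(1) by simp
    show "integrable lebesgue (\<lambda>t. 1 * indicator ?ball t :: real)" by (rule integrable_indicator_cball)
    show "?F (vec_floor (?P *v t)) \<le> 1 * indicator ?ball t" for t
    proof (cases "vec_floor (?P *v t) \<in> M")
      case True
      have "norm (t - mat_pow (matrix_inv B) k *v vec_floor (?P *v t)) \<le> D * CARD('d)"
        by (rule order_trans[OF refined_lattice_dist_le[OF det] mult_right_mono[OF contraction]]) simp
      then have "norm t \<le> R + D * CARD('d)"
        using radius[OF True] norm_triangle_sub[of t "mat_pow (matrix_inv B) k *v vec_floor (?P *v t)"]
        by linarith
      then show ?thesis by simp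
    qed simp
  qed
  finally show ?thesis by (simp add: mult_left_mono)
qed

locale mask =
  fixes A :: "real^'d::finite^'d" and h :: "real^'d \<Rightarrow> complex" and N0 :: nat
  assumes A_int: "integral_matrix A" and abs_det: "\<bar>det A\<bar> = 2"
    and decay: "summable (\<lambda>k. onorm ((*v) (mat_pow (matrix_inv A) k)))"
    and h_supp: "\<And>n. n \<notin> Lambda0 N0 \<Longrightarrow> h n = 0"
    and h_orth: "\<And>k. k \<in> (*v) A ` Zd \<Longrightarrow> (\<Sum>n\<in>Lambda0 N0. h n * cnj (h (n + k))) = of_bool (k = 0)"
    and h_sum: "(\<Sum>n\<in>Lambda0 N0. h n) = complex_of_real (sqrt 2)"
begin

abbreviation C :: "nat \<Rightarrow> real^'d^'d" where
  "C k \<equiv> mat_pow (matrix_inv A) k"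

abbreviation \<Lambda> :: "(real^'d) set" where
  "\<Lambda> \<equiv> Lambda0 N0"

abbreviation sqrt2 :: complex where
  "sqrt2 \<equiv> complex_of_real (sqrt 2)"

lemma det_A: "det A \<noteq> 0"
  by (rule det_nonzero[OF abs_det])

lemma C_Suc_A: "C (Suc k) *v (A *v p + n) = C k *v p + C (Suc k) *v n"
  by (simp add: matrix_vector_right_distrib mat_pow_Suc_vec matrix_inv_invertible[OF det_A])

primrec cascade_support :: "nat \<Rightarrow> (real^'d) set" where
  "cascade_support 0 = {0}"
| "cascade_support (Suc k) = (\<lambda>(p, n). A *v p + n) ` (cascade_support k \<times> \<Lambda>)"

primrec cascade_weight :: "nat \<Rightarrow> real^'d \<Rightarrow> complex" where
  "cascade_weight 0 = (\<lambda>m. of_bool (m = 0))"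
| "cascade_weight (Suc k) = (\<lambda>m. \<Sum>p\<in>cascade_support k. h (m - A *v p) / sqrt2 * cascade_weight k p)"

text \<open>The discrete measures obtained by iterating the refinement equation on a unit mass at the origin.\<close>

abbreviation cascade :: "nat \<Rightarrow> (real^'d \<Rightarrow> complex) \<Rightarrow> complex" where
  "cascade k \<equiv> discrete_integral (cascade_support k) (cascade_weight k) ((*v) (C k))"

lemma finite_cascade_support: "finite (cascade_support k)"
  by (induction k) (auto simp: finite_Lambda0)

lemma cascade_support_Zd: "cascade_support k \<subseteq> Zd"
proof (induction k)
  case (Suc k)
  then show ?case using Lambda0_Zd by (auto intro!: Zd_add Zd_integral_matrix[OF A_int])
qed simp

lemma sum_cascade_weight_Suc:
  "(\<Sum>m\<in>cascade_support (Suc k). cascade_weight (Suc k) m * F m) =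
    (\<Sum>p\<in>cascade_support k. \<Sum>n\<in>\<Lambda>. h n / sqrt2 * cascade_weight k p * F (A *v p + n))"
proof -
  let ?f = "\<lambda>p m. h (m - A *v p) / sqrt2 * cascade_weight k p * F m"
  have "(\<Sum>m\<in>cascade_support (Suc k). cascade_weight (Suc k) m * F m)
      = (\<Sum>p\<in>cascade_support k. \<Sum>m\<in>cascade_support (Suc k). ?f p m)"
    unfolding cascade_weight.simps sum_distrib_right by (rule sum.swap)
  also have "\<dots> = (\<Sum>p\<in>cascade_support k. \<Sum>n\<in>\<Lambda>. h n / sqrt2 * cascade_weight k p * F (A *v p + n))"
  proof (rule sum.cong[OF refl])
    fix p assume p: "p \<in> cascade_support k"
    have "(\<Sum>m\<in>cascade_support (Suc k). ?f p m) = (\<Sum>m\<in>(+) (A *v p) ` \<Lambda>. ?f p m)"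
    proof (rule sum.mono_neutral_right[OF finite_cascade_support])
      show "(+) (A *v p) ` \<Lambda> \<subseteq> cascade_support (Suc k)" using p by force
      have "m - A *v p \<notin> \<Lambda>" if "m \<notin> (+) (A *v p) ` \<Lambda>" for m
        using that by (metis add_diff_cancel_left' diff_add_cancel image_eqI add.commute)
      then show "\<forall>m\<in>cascade_support (Suc k) - (+) (A *v p) ` \<Lambda>. ?f p m = 0"
        by (simp add: h_supp)
    qed
    then show "(\<Sum>m\<in>cascade_support (Suc k). ?f p m)
        = (\<Sum>n\<in>\<Lambda>. h n / sqrt2 * cascade_weight k p * F (A *v p + n))"
      by (simp add: sum.reindex)
  qed
  finally show ?thesis .
qed

lemma sum_h_cnj_h_lattice:
  assumes "p \<in> Zd" "p' \<in> Zd"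
  shows "(\<Sum>n\<in>\<Lambda>. h n * cnj (h (A *v p + n - A *v p'))) = of_bool (p' = p)"
proof -
  have "A *v p + n - A *v p' = n + A *v (p - p')" for n
    by (simp add: matrix_vector_mult_diff_distrib)
  moreover have "(\<Sum>n\<in>\<Lambda>. h n * cnj (h (n + A *v (p - p')))) = of_bool (A *v (p - p') = 0)"
    using assms Zd_diff by (intro h_orth) blast
  moreover have "A *v (p - p') = 0 \<longleftrightarrow> p' = p"
    using matrix_inv_invertible(4)[OF det_A, of "p - p'"] by auto
  ultimately show ?thesis by (simp only:)
qed

lemma sum_cascade_weight_power2: "(\<Sum>m\<in>cascade_support k. (cmod (cascade_weight k m))\<^sup>2) = 1 / 2 ^ k"
proof (induction k)
  case (Suc k)
  let ?S = "cascade_support k" and ?w = "cascade_weight k" and ?w' = "cascade_weight (Suc k)"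
  have sqrt2_sq: "sqrt2 * sqrt2 = 2" by (simp flip: of_real_mult)
  have "complex_of_real (\<Sum>m\<in>cascade_support (Suc k). (cmod (?w' m))\<^sup>2)
      = (\<Sum>m\<in>cascade_support (Suc k). ?w' m * cnj (?w' m))"
    by (simp only: of_real_sum complex_norm_square)
  also have "\<dots> = (\<Sum>p\<in>?S. \<Sum>n\<in>\<Lambda>. h n / sqrt2 * ?w p * cnj (?w' (A *v p + n)))"
    by (rule sum_cascade_weight_Suc)
  also have "\<dots> = (\<Sum>p\<in>?S. \<Sum>n\<in>\<Lambda>. \<Sum>p'\<in>?S. ?w p * cnj (?w p') / 2 * (h n * cnj (h (A *v p + n - A *v p'))))"
    by (simp add: sum_distrib_left sqrt2_sq[symmetric] mult_ac)
  also have "\<dots> = (\<Sum>p\<in>?S. \<Sum>p'\<in>?S. ?w p * cnj (?w p') / 2 * (\<Sum>n\<in>\<Lambda>. h n * cnj (h (A *v p + n - A *v p'))))"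
    unfolding sum_distrib_left by (intro sum.cong refl sum.swap)
  also have "\<dots> = (\<Sum>p\<in>?S. \<Sum>p'\<in>?S. if p' = p then ?w p * cnj (?w p) / 2 else 0)"
    using cascade_support_Zd by (intro sum.cong refl, subst sum_h_cnj_h_lattice) auto
  also have "\<dots> = (\<Sum>p\<in>?S. ?w p * cnj (?w p) / 2)"
    by (simp add: finite_cascade_support)
  also have "\<dots> = complex_of_real ((\<Sum>p\<in>?S. (cmod (?w p))\<^sup>2) / 2)"
    by (simp only: complex_norm_square sum_divide_distrib of_real_sum of_real_divide of_real_numeral)
  finally show ?case unfolding Suc.IH of_real_eq_iff by simp
qed simp

lemma cascade_0: "cascade 0 F = F 0"
  by (simp add: discrete_integral_def)

lemma cascade_Suc: "cascade (Suc k) F = (\<Sum>n\<in>\<Lambda>. h n / sqrt2 * cascade k (\<lambda>x. F (x + C (Suc k) *v n)))"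
  unfolding discrete_integral_def sum_cascade_weight_Suc C_Suc_A
  by (subst sum.swap) (simp add: sum_distrib_left mult.assoc)

lemma cascade_Suc': "cascade (Suc k) F = (\<Sum>n\<in>\<Lambda>. h n / sqrt2 * cascade k (\<lambda>x. F (matrix_inv A *v (x + n))))"
proof (induction k arbitrary: F)
  case 0
  show ?case unfolding cascade_Suc cascade_0 by (simp add: mat_pow_Suc)
next
  case (Suc k)
  let ?f = "\<lambda>n n'. h n' / sqrt2 * (h n / sqrt2 * cascade k (\<lambda>x. F (matrix_inv A *v (x + C (Suc k) *v n + n'))))"
  have arg: "matrix_inv A *v (x + n') + C (Suc (Suc k)) *v n
      = matrix_inv A *v (x + C (Suc k) *v n + n')" for x n n'
    by (simp add: mat_pow_Suc[of _ "Suc k"] matrix_vector_mul_assoc[symmetric]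
        matrix_vector_right_distrib add_ac)
  have "cascade (Suc (Suc k)) F = (\<Sum>n\<in>\<Lambda>. \<Sum>n'\<in>\<Lambda>. ?f n n')"
    unfolding cascade_Suc[of "Suc k"] Suc.IH sum_distrib_left arg by (simp only: mult.left_commute)
  also have "\<dots> = (\<Sum>n'\<in>\<Lambda>. \<Sum>n\<in>\<Lambda>. ?f n n')" by (rule sum.swap)
  also have "\<dots> = (\<Sum>n'\<in>\<Lambda>. h n' / sqrt2 * cascade (Suc k) (\<lambda>x. F (matrix_inv A *v (x + n'))))"
    unfolding cascade_Suc[of k] sum_distrib_left ..
  finally show ?case .
qed

lemma cascade_1: "cascade k (\<lambda>x. 1) = 1"
proof (induction k)
  case (Suc k)
  have "cascade (Suc k) (\<lambda>x. 1) = (\<Sum>n\<in>\<Lambda>. h n) / sqrt2"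
    unfolding cascade_Suc Suc.IH by (simp add: sum_divide_distrib)
  then show ?case unfolding h_sum by simp
qed (rule cascade_0)

definition support_radius :: real where
  "support_radius = (\<Sum>j. onorm ((*v) (C j))) * (\<Sum>n\<in>\<Lambda>. norm n)"

lemma support_radius_nonneg: "support_radius \<ge> 0"
  unfolding support_radius_def by (intro mult_nonneg_nonneg suminf_nonneg decay sum_nonneg) simp_all

lemma norm_cascade_point_le:
  assumes "m \<in> cascade_support k"
  shows "norm (C k *v m) \<le> support_radius"
proof -
  let ?N = "\<Sum>n\<in>\<Lambda>. norm n"
  have "norm (C k *v m) \<le> (\<Sum>j<Suc k. onorm ((*v) (C j))) * ?N"
    using assms
  proof (induction k arbitrary: m)
    case 0
    then show ?case by (simp add: sum_nonneg del: mat_pow_0)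
  next
    case (Suc k)
    then obtain p n where p: "p \<in> cascade_support k" and n: "n \<in> \<Lambda>" and m: "m = A *v p + n" by auto
    have "norm (C (Suc k) *v n) \<le> onorm ((*v) (C (Suc k))) * norm n" by (rule norm_matrix_vector_le_onorm)
    also have "\<dots> \<le> onorm ((*v) (C (Suc k))) * ?N"
      by (intro mult_left_mono member_le_sum n finite_Lambda0 onorm_matrix_nonneg) simp
    finally have "norm (C (Suc k) *v n) \<le> onorm ((*v) (C (Suc k))) * ?N" .
    then show ?case
      using Suc.IH[OF p] norm_triangle_ineq[of "C k *v p" "C (Suc k) *v n"]
      by (simp add: m C_Suc_A distrib_right)
  qed
  also have "\<dots> \<le> support_radius"
    unfolding support_radius_def by (intro mult_right_mono sum_le_suminf decay sum_nonneg) simp_all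
  finally show ?thesis .
qed

lemma cascade_cong:
  assumes "\<And>x. norm x \<le> support_radius \<Longrightarrow> F x = G x"
  shows "cascade k F = cascade k G"
  unfolding discrete_integral_def by (intro sum.cong refl) (simp add: assms norm_cascade_point_le)

lemma cascade_variation_bounded:
  obtains K where "\<And>k. (\<Sum>m\<in>cascade_support k. cmod (cascade_weight k m)) \<le> K"
proof -
  obtain D where D: "\<And>k. onorm ((*v) (C k)) \<le> D" using onorm_powers_bounded[OF decay] by metis
  let ?V = "measure lebesgue (cball (0::real^'d) (support_radius + D * CARD('d)))"
  have "(\<Sum>m\<in>cascade_support k. cmod (cascade_weight k m)) \<le> sqrt ?V" for k
  proof -
    let ?S = "cascade_support k"
    have "(\<Sum>m\<in>?S. \<bar>cmod (cascade_weight k m)\<bar> * \<bar>1\<bar>)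
        \<le> L2_set (\<lambda>m. cmod (cascade_weight k m)) ?S * L2_set (\<lambda>m. 1) ?S"
      by (rule L2_set_mult_ineq)
    also have "\<dots> = sqrt (real (card ?S) / 2 ^ k)"
      by (simp add: L2_set_def sum_cascade_weight_power2 real_sqrt_divide)
    also have "\<dots> \<le> sqrt ?V"
      using card_Zd_le[OF det_A finite_cascade_support cascade_support_Zd norm_cascade_point_le D, of k k]
      by (simp add: abs_det field_simps)
    finally show ?thesis by simp
  qed
  then show thesis by (rule that)
qed

end

section \<open>Orthogonality of exponentials on the cube\<close>

lemma
  assumes l: "l \<in> \<int>"
  shows integrable_exp_interval: "integrable lborel (\<lambda>x. indicator {-pi..pi} x * iexp (l * x))"
    and integral_exp_interval:
      "(LINT x|lborel. indicator {-pi..pi} x * iexp (l * x)) = of_bool (l = 0) * complex_of_real (2 * pi)"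
proof -
  have "integrable lborel (\<lambda>x::real. indicator {-pi..pi} x *\<^sub>R iexp (l * x))"
    by (rule borel_integrable_compact) (auto intro!: continuous_intros)
  then show "integrable lborel (\<lambda>x. indicator {-pi..pi} x * iexp (l * x))"
    by (simp add: scaleR_conv_of_real of_real_indicator)
  have scaleR: "indicator {-pi..pi} x * iexp (l * x) = indicator {-pi..pi} x *\<^sub>R iexp (l * x)" for x :: real
    by (simp add: scaleR_conv_of_real of_real_indicator)
  show "(LINT x|lborel. indicator {-pi..pi} x * iexp (l * x)) = of_bool (l = 0) * complex_of_real (2 * pi)"
  proof (cases "l = 0")
    case True
    then show ?thesis unfolding scaleR by (simp add: scaleR_conv_of_real)
  next
    case False
    let ?F = "\<lambda>x. iexp (l * x) / (\<i> * complex_of_real l)"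
    have "(LINT x|lborel. indicator {-pi..pi} x *\<^sub>R iexp (l * x)) = ?F pi - ?F (- pi)"
    proof (rule integral_FTC_atLeastAtMost)
      show "continuous_on {- pi..pi} (\<lambda>x. iexp (l * x))" by (intro continuous_intros)
      fix x :: real
      have "((\<lambda>z. exp (\<i> * (complex_of_real l * z)) / (\<i> * complex_of_real l))
          has_field_derivative iexp (l * x)) (at (complex_of_real x))"
        using False by (auto intro!: derivative_eq_intros simp: mult.commute[of _ \<i>])
      from has_vector_derivative_real_field[OF has_field_derivative_at_within[OF this]]
      show "(?F has_vector_derivative iexp (l * x)) (at x within {- pi..pi})" by simp
    qed simp
    also have "\<dots> = (cis (l * pi) - cis (- (l * pi))) / (\<i> * complex_of_real l)"
      by (simp add: cis_conv_exp diff_divide_distrib)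
    also have "cis (l * pi) - cis (- (l * pi)) = 0"
      using l by (simp add: complex_eq_iff sin_times_pi_eq_0)
    finally show ?thesis unfolding scaleR using False by simp
  qed
qed

lemma indicator_cube_eq_prod:
  "(indicator (cube R) \<eta> :: complex) = (\<Prod>b\<in>Basis. indicator {-R..R} (\<eta> \<bullet> b))" for \<eta> :: "real^'d::finite"
proof (cases "\<eta> \<in> cube R")
  case True
  then have "\<eta> \<bullet> b \<in> {-R..R}" if "b \<in> Basis" for b
    using that by (auto simp: cube_def Basis_vec_def inner_axis abs_le_iff minus_le_iff)
  then show ?thesis using True by simp
next
  case False
  then obtain i where "\<eta> \<bullet> axis i 1 \<notin> {-R..R}"
    by (auto simp: cube_def inner_axis abs_le_iff minus_le_iff not_le)
  then have "(\<Prod>b\<in>Basis. indicator {-R..R} (\<eta> \<bullet> b)) = (0::complex)"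
    by (intro prod_zero bexI[of _ "axis i 1"]) (auto simp: axis_in_Basis_iff)
  then show ?thesis using False by simp
qed

lemma
  fixes l :: "real^'d::finite"
  assumes l: "l \<in> Zd"
  shows integrable_exp_cube: "integrable lborel (\<lambda>\<eta>. indicator (cube pi) \<eta> * iexp (l \<bullet> \<eta>))"
    and integral_exp_cube:
      "(LINT \<eta>|lborel. indicator (cube pi) \<eta> * iexp (l \<bullet> \<eta>))
        = of_bool (l = 0) * complex_of_real ((2 * pi) ^ CARD('d))"
proof -
  let ?f = "\<lambda>b x. indicator {-pi..pi} x * iexp ((l \<bullet> b) * x)"
  have coordinate: "l \<bullet> b \<in> \<int>" if "b \<in> Basis" for b
    using l that by (auto simp: Zd_def Basis_vec_def inner_axis)
  have product: "indicator (cube pi) \<eta> * iexp (l \<bullet> \<eta>) = (\<Prod>b\<in>Basis. ?f b (\<eta> \<bullet> b))" for \<eta>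
    unfolding indicator_cube_eq_prod inner_commute[of l \<eta>] iexp_inner_eq_prod by (simp add: prod.distrib)
  show "integrable lborel (\<lambda>\<eta>. indicator (cube pi) \<eta> * iexp (l \<bullet> \<eta>))"
    unfolding product by (intro integrable_prod_Basis integrable_exp_interval coordinate)
  have "(LINT \<eta>|lborel. indicator (cube pi) \<eta> * iexp (l \<bullet> \<eta>)) = (\<Prod>b\<in>Basis. LINT x|lborel. ?f b x)"
    unfolding product by (intro integral_prod_Basis integrable_exp_interval coordinate)
  also have "\<dots> = (\<Prod>b\<in>Basis. of_bool (l \<bullet> b = 0) * complex_of_real (2 * pi))"
    by (intro prod.cong refl integral_exp_interval coordinate)
  also have "\<dots> = of_bool (l = 0) * complex_of_real ((2 * pi) ^ CARD('d))"
  proof (cases "l = 0")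
    case False
    then obtain b where "b \<in> Basis" "l \<bullet> b \<noteq> 0" using euclidean_all_zero_iff[of l] by blast
    then have "(\<Prod>b\<in>Basis. of_bool (l \<bullet> b = 0) * complex_of_real (2 * pi)) = 0"
      by (intro prod_zero bexI[of _ b]) auto
    then show ?thesis using False by simp
  qed simp
  finally show "(LINT \<eta>|lborel. indicator (cube pi) \<eta> * iexp (l \<bullet> \<eta>))
      = of_bool (l = 0) * complex_of_real ((2 * pi) ^ CARD('d))" .
qed

lemma norm_power2_trigonometric_sum:
  "complex_of_real ((cmod (\<Sum>m\<in>M. w m * iexp (- (m \<bullet> \<eta>))))\<^sup>2)
    = (\<Sum>m\<in>M. \<Sum>m'\<in>M. w m * cnj (w m') * iexp ((m' - m) \<bullet> \<eta>))"
proof -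
  have "w m * iexp (- (m \<bullet> \<eta>)) * cnj (w m' * iexp (- (m' \<bullet> \<eta>)))
      = w m * cnj (w m') * iexp ((m' - m) \<bullet> \<eta>)" for m m'
    by (simp add: exp_cnj inner_diff_left exp_diff exp_minus algebra_simps divide_inverse)
  then show ?thesis
    unfolding complex_norm_square cnj_sum sum_product by (simp only:)
qed

lemma Parseval_cube:
  fixes w :: "real^'d::finite \<Rightarrow> complex"
  assumes M: "finite M" "M \<subseteq> Zd"
  shows "(\<integral>\<^sup>+ \<eta>. ennreal (indicator (cube pi) \<eta> * (cmod (\<Sum>m\<in>M. w m * iexp (- (m \<bullet> \<eta>))))\<^sup>2) \<partial>lborel)
    = ennreal ((2 * pi) ^ CARD('d) * (\<Sum>m\<in>M. (cmod (w m))\<^sup>2))"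
proof -
  let ?q = "\<lambda>\<eta>. indicator (cube pi) \<eta> * (cmod (\<Sum>m\<in>M. w m * iexp (- (m \<bullet> \<eta>))))\<^sup>2"
  let ?e = "\<lambda>m m' \<eta>. w m * cnj (w m') * (indicator (cube pi) \<eta> * iexp ((m' - m) \<bullet> \<eta>))"
  have expand: "complex_of_real (?q \<eta>) = (\<Sum>m\<in>M. \<Sum>m'\<in>M. ?e m m' \<eta>)" for \<eta>
    by (simp only: of_real_mult of_real_indicator norm_power2_trigonometric_sum sum_distrib_left
        mult.left_commute)
  have integrable_e: "integrable lborel (?e m m')" if "m \<in> M" "m' \<in> M" for m m'
    using that M(2) by (intro integrable_mult_right integrable_exp_cube Zd_diff) auto
  have integral_e: "(LINT \<eta>|lborel. ?e m m' \<eta>)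
      = (if m' = m then w m * cnj (w m) * complex_of_real ((2 * pi) ^ CARD('d)) else 0)"
    if "m \<in> M" "m' \<in> M" for m m'
  proof -
    have "m' - m \<in> Zd" using that M(2) by (intro Zd_diff) auto
    from integral_exp_cube[OF this] show ?thesis by (cases "m' = m") simp_all
  qed
  have "integrable lborel (\<lambda>\<eta>. complex_of_real (?q \<eta>))"
    unfolding expand by (intro Bochner_Integration.integrable_sum integrable_e)
  then have integrable_q: "integrable lborel ?q" by (simp only: complex_of_real_integrable_eq)
  have "complex_of_real (LINT \<eta>|lborel. ?q \<eta>) = (\<Sum>m\<in>M. \<Sum>m'\<in>M. LINT \<eta>|lborel. ?e m m' \<eta>)"
    unfolding integral_complex_of_real[symmetric] expand
    by (subst Bochner_Integration.integral_sum,
        intro Bochner_Integration.integrable_sum integrable_e, assumption+)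
       (intro sum.cong refl Bochner_Integration.integral_sum integrable_e)
  also have "\<dots> = (\<Sum>m\<in>M. \<Sum>m'\<in>M. if m' = m then w m * cnj (w m) * complex_of_real ((2 * pi) ^ CARD('d)) else 0)"
    by (intro sum.cong refl integral_e)
  also have "\<dots> = (\<Sum>m\<in>M. w m * cnj (w m) * complex_of_real ((2 * pi) ^ CARD('d)))"
    using M(1) by simp
  also have "\<dots> = complex_of_real ((2 * pi) ^ CARD('d) * (\<Sum>m\<in>M. (cmod (w m))\<^sup>2))"
    unfolding sum_distrib_right[symmetric] complex_norm_square[symmetric] by simp
  finally have "(LINT \<eta>|lborel. ?q \<eta>) = (2 * pi) ^ CARD('d) * (\<Sum>m\<in>M. (cmod (w m))\<^sup>2)"
    by (simp only: of_real_eq_iff)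
  then show ?thesis
    using nn_integral_eq_integral[OF integrable_q] by (simp add: indicator_def)
qed

section \<open>The refinable function\<close>

lemma measurable_matrix_vector_mult [measurable]:
  "(*v) M \<in> borel_measurable borel" for M :: "real^'n::finite^'m::finite"
  by (intro borel_measurable_continuous_onI linear_continuous_on matrix_vector_mul_bounded_linear)

lemma Cc_translate:
  assumes "Cc u"
  shows "Cc (\<lambda>t. u (t + v))"
proof -
  obtain R where R: "\<And>x. norm x > R \<Longrightarrow> u x = 0" and cont: "continuous_on UNIV u"
    using assms by (auto simp: Cc_def)
  have "u (t + v) = 0" if "norm t > R + norm v" for t
    using that norm_triangle_ineq4[of "t + v" v] by (intro R) simp
  moreover have "continuous_on UNIV (\<lambda>t. u (t + v))"
    by (intro continuous_on_compose2[OF cont] continuous_intros) auto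
  ultimately show ?thesis unfolding Cc_def by blast
qed

lemma inner_inverse_transpose_power:
  fixes A :: "real^'d::finite^'d"
  assumes det: "det A \<noteq> 0"
  shows "x \<bullet> (mat_pow (matrix_inv (transpose A)) k *v y) = (mat_pow (matrix_inv A) k *v x) \<bullet> y"
proof (induction k arbitrary: x)
  case (Suc k)
  let ?T = "transpose A"
  have det_T: "det ?T \<noteq> 0" using det by simp
  have adjoint: "x \<bullet> (matrix_inv ?T *v z) = (matrix_inv A *v x) \<bullet> z" for z
  proof -
    have "x \<bullet> (matrix_inv ?T *v z) = (matrix_inv ?T *v z) \<bullet> (A *v (matrix_inv A *v x))"
      by (simp add: matrix_inv_invertible[OF det] inner_commute)
    also have "\<dots> = (?T *v (matrix_inv ?T *v z)) \<bullet> (matrix_inv A *v x)"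
      by (simp only: transpose_matrix_vector dot_lmul_matrix)
    finally show ?thesis by (simp only: matrix_inv_invertible[OF det_T] inner_commute)
  qed
  have "x \<bullet> (mat_pow (matrix_inv ?T) (Suc k) *v y) = x \<bullet> (matrix_inv ?T *v (mat_pow (matrix_inv ?T) k *v y))"
    by (simp only: mat_pow_Suc matrix_vector_mul_assoc)
  then show ?case by (simp only: adjoint Suc.IH mat_pow_Suc_vec)
qed simp

lemma norm_inverse_transpose_power_le:
  fixes A :: "real^'d::finite^'d"
  assumes det: "det A \<noteq> 0"
  shows "norm (mat_pow (matrix_inv (transpose A)) k *v y) \<le> onorm ((*v) (mat_pow (matrix_inv A) k)) * norm y"
proof -
  let ?z = "mat_pow (matrix_inv (transpose A)) k *v y" and ?c = "onorm ((*v) (mat_pow (matrix_inv A) k))"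
  have "norm ?z * norm ?z = (mat_pow (matrix_inv A) k *v ?z) \<bullet> y"
    by (simp add: inner_inverse_transpose_power[OF det, symmetric] power2_norm_eq_inner flip: power2_eq_square)
  also have "\<dots> \<le> norm (mat_pow (matrix_inv A) k *v ?z) * norm y" by (rule norm_cauchy_schwarz)
  also have "\<dots> \<le> (?c * norm ?z) * norm y"
    by (intro mult_right_mono norm_matrix_vector_le_onorm norm_ge_zero)
  finally have "norm ?z * norm ?z \<le> norm ?z * (?c * norm y)" by (simp only: mult_ac)
  then show ?thesis by (cases "?z = 0") simp_all
qed

context mask
begin

abbreviation C\<^sub>t :: "nat \<Rightarrow> real^'d^'d" where
  "C\<^sub>t k \<equiv> mat_pow (matrix_inv (transpose A)) k"

definition partial_product :: "nat \<Rightarrow> real^'d \<Rightarrow> complex" where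
  "partial_product k \<xi> = (\<Prod>j<k. m0 N0 h (C\<^sub>t (Suc j) *v \<xi>))"

lemma partial_product_eq_cascade: "partial_product k \<xi> = cascade k (\<lambda>x. iexp (- (x \<bullet> \<xi>)))"
proof (induction k)
  case 0
  show ?case unfolding cascade_0 by (simp add: partial_product_def)
next
  case (Suc k)
  have add: "iexp (- ((x + y) \<bullet> \<xi>)) = iexp (- (x \<bullet> \<xi>)) * iexp (- (y \<bullet> \<xi>))" for x y
    by (simp add: inner_add_left exp_add[symmetric] algebra_simps)
  have "cascade (Suc k) (\<lambda>x. iexp (- (x \<bullet> \<xi>)))
      = partial_product k \<xi> * (\<Sum>n\<in>\<Lambda>. h n / sqrt2 * iexp (- ((C (Suc k) *v n) \<bullet> \<xi>)))"
    unfolding cascade_Suc add discrete_integral_mult_right Suc.IH[symmetric]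
    by (simp add: sum_distrib_left mult.left_commute)
  also have "(\<Sum>n\<in>\<Lambda>. h n / sqrt2 * iexp (- ((C (Suc k) *v n) \<bullet> \<xi>))) = m0 N0 h (C\<^sub>t (Suc k) *v \<xi>)"
    unfolding m0_def inner_inverse_transpose_power[OF det_A, of _ "Suc k"] by (simp add: sum_divide_distrib)
  finally show ?case by (simp add: partial_product_def)
qed

lemma measurable_partial_product [measurable]: "partial_product k \<in> borel_measurable borel"
  unfolding partial_product_eq_cascade discrete_integral_def by measurable

lemma partial_product_bounded:
  obtains K where "\<And>k \<xi>. cmod (partial_product k \<xi>) \<le> K"
proof -
  obtain K where K: "\<And>k. (\<Sum>m\<in>cascade_support k. cmod (cascade_weight k m)) \<le> K"
    using cascade_variation_bounded by blast
  have "cmod (partial_product k \<xi>) \<le> K" for k \<xi>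
    unfolding partial_product_eq_cascade
    using norm_discrete_integral_le[of "\<lambda>x. iexp (- (x \<bullet> \<xi>))" 1 "cascade_support k"] K[of k]
    by (fastforce intro: order_trans)
  then show thesis by (rule that)
qed

lemma norm_m0_diff_1_le: "cmod (m0 N0 h t - 1) \<le> (\<Sum>n\<in>\<Lambda>. cmod (h n) * norm n) * norm t"
proof -
  have "m0 N0 h t - 1 = (\<Sum>n\<in>\<Lambda>. h n * (iexp (- (n \<bullet> t)) - 1)) / sqrt2"
    by (simp add: m0_def right_diff_distrib sum_subtractf h_sum diff_divide_distrib)
  also have "cmod \<dots> \<le> cmod (\<Sum>n\<in>\<Lambda>. h n * (iexp (- (n \<bullet> t)) - 1))"
    by (simp add: norm_divide divide_le_eq mult_le_cancel_left1)
  also have "\<dots> \<le> (\<Sum>n\<in>\<Lambda>. cmod (h n) * (norm n * norm t))"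
  proof (rule sum_norm_le)
    fix n :: "real^'d"
    have "cmod (iexp (- (n \<bullet> t)) - 1) \<le> \<bar>n \<bullet> t\<bar>" using iexp_approx1[of "- (n \<bullet> t)" 0] by simp
    also have "\<dots> \<le> norm n * norm t" by (rule Cauchy_Schwarz_ineq2)
    finally show "norm (h n * (iexp (- (n \<bullet> t)) - 1)) \<le> cmod (h n) * (norm n * norm t)"
      unfolding norm_mult by (rule mult_left_mono) simp
  qed
  finally show ?thesis by (simp add: sum_distrib_right mult.assoc)
qed

lemma partial_product_tendsto: "(\<lambda>k. partial_product k \<xi>) \<longlonglongrightarrow> (\<Prod>j. m0 N0 h (C\<^sub>t (Suc j) *v \<xi>))"
proof -
  let ?f = "\<lambda>j. m0 N0 h (C\<^sub>t (Suc j) *v \<xi>)" and ?K = "\<Sum>n\<in>\<Lambda>. cmod (h n) * norm n"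
  have "summable (\<lambda>j. cmod (?f j - 1))"
  proof (rule summable_comparison_test'[where N=0])
    show "summable (\<lambda>j. ?K * (onorm ((*v) (C (Suc j))) * norm \<xi>))"
      by (intro summable_mult summable_mult2) (rule summable_Suc_iff[THEN iffD2, OF decay])
    fix j
    have "cmod (?f j - 1) \<le> ?K * norm (C\<^sub>t (Suc j) *v \<xi>)" by (rule norm_m0_diff_1_le)
    also have "\<dots> \<le> ?K * (onorm ((*v) (C (Suc j))) * norm \<xi>)"
      by (intro mult_left_mono norm_inverse_transpose_power_le det_A sum_nonneg) simp
    finally show "norm (cmod (?f j - 1)) \<le> ?K * (onorm ((*v) (C (Suc j))) * norm \<xi>)" by simp
  qed
  then have "convergent_prod ?f"
    by (intro abs_convergent_prod_imp_convergent_prod summable_imp_abs_convergent_prod)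
  then have "(\<lambda>n. \<Prod>j\<le>n. ?f j) \<longlonglongrightarrow> prodinf ?f" by (rule convergent_prod_LIMSEQ)
  then have "(\<lambda>n. partial_product (Suc n) \<xi>) \<longlonglongrightarrow> prodinf ?f" unfolding partial_product_def lessThan_Suc_atMost .
  then show ?thesis by (rule LIMSEQ_imp_Suc)
qed

abbreviation g :: "real^'d \<Rightarrow> complex" where
  "g \<equiv> g_fun N0 h A"

lemma partial_product_tendsto_g:
  "(\<lambda>k. partial_product k \<xi> / complex_of_real (gaussian_mass TYPE(real^'d))) \<longlonglongrightarrow> g \<xi>"
  using tendsto_divide[OF partial_product_tendsto tendsto_const[of "complex_of_real (gaussian_mass TYPE(real^'d))"]]
    gaussian_mass_pos[where 'a="real^'d"]
  unfolding g_fun_def fourier_normalization by simp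

lemma measurable_g [measurable]: "g \<in> borel_measurable borel"
  by (rule borel_measurable_LIMSEQ_metric[OF _ partial_product_tendsto_g]) measurable

lemma abs_det_C\<^sub>t: "\<bar>det (C\<^sub>t k)\<bar> = 1 / 2 ^ k"
proof -
  have "\<bar>det (matrix_inv (transpose A))\<bar> = 1 / 2"
    using det_A abs_det by (simp add: det_matrix_inv abs_inverse)
  then show ?thesis by (simp only: det_mat_pow power_abs power_one_over)
qed

text \<open>On the cube scaled by \<open>(A\<^sup>\<tau>)\<^sup>k\<close> the partial product is a trigonometric polynomial
  whose coefficients have square sum \<open>2\<^sup>-\<^sup>k\<close>.\<close>

lemma nn_integral_partial_product_cube:
  "(\<integral>\<^sup>+ \<xi>. ennreal (indicator (cube pi) (C\<^sub>t k *v \<xi>) * (cmod (partial_product k \<xi>))\<^sup>2) \<partial>lebesgue)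
    = ennreal ((2 * pi) ^ CARD('d))"
proof -
  let ?S = "\<lambda>\<eta>. \<Sum>m\<in>cascade_support k. cascade_weight k m * iexp (- (m \<bullet> \<eta>))"
  let ?H = "\<lambda>\<eta>. ennreal (indicator (cube pi) \<eta> * (cmod (?S \<eta>))\<^sup>2)"
  have H [measurable]: "?H \<in> borel_measurable borel" by measurable
  have det: "det (C\<^sub>t k) \<noteq> 0" using abs_det_C\<^sub>t[of k] by auto
  have "partial_product k \<xi> = ?S (C\<^sub>t k *v \<xi>)" for \<xi>
    by (simp only: partial_product_eq_cascade discrete_integral_def inner_inverse_transpose_power[OF det_A])
  then have "(\<integral>\<^sup>+ \<xi>. ennreal (indicator (cube pi) (C\<^sub>t k *v \<xi>) * (cmod (partial_product k \<xi>))\<^sup>2) \<partial>lebesgue)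
      = (\<integral>\<^sup>+ \<xi>. ?H (C\<^sub>t k *v \<xi> + 0) \<partial>lebesgue)"
    by simp
  also have "\<dots> = ennreal (1 / \<bar>det (C\<^sub>t k)\<bar>) * (\<integral>\<^sup>+ \<eta>. ?H \<eta> \<partial>lebesgue)"
    by (rule nn_integral_affine[OF det borel_measurable_lebesgueI[OF H]])
  also have "(\<integral>\<^sup>+ \<eta>. ?H \<eta> \<partial>lebesgue) = (\<integral>\<^sup>+ \<eta>. ?H \<eta> \<partial>lborel)"
    by (rule nn_integral_completion)
  also have "\<dots> = ennreal ((2 * pi) ^ CARD('d) * (1 / 2 ^ k))"
    unfolding sum_cascade_weight_power2[symmetric]
    by (rule Parseval_cube[OF finite_cascade_support cascade_support_Zd])
  also have "ennreal (1 / \<bar>det (C\<^sub>t k)\<bar>) * \<dots> = ennreal ((2 * pi) ^ CARD('d))"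
    by (simp add: abs_det_C\<^sub>t flip: ennreal_mult)
  finally show ?thesis .
qed

lemma eventually_C\<^sub>t_in_cube: "\<forall>\<^sub>F k in sequentially. C\<^sub>t k *v \<xi> \<in> cube pi"
proof -
  have "(\<lambda>k. onorm ((*v) (C k)) * norm \<xi>) \<longlonglongrightarrow> 0"
    using summable_LIMSEQ_zero[OF decay] by (rule tendsto_mult_left_zero)
  then have "\<forall>\<^sub>F k in sequentially. onorm ((*v) (C k)) * norm \<xi> < pi"
    by (rule order_tendstoD) simp
  then show ?thesis
    by eventually_elim
      (intro mem_cubeI order_trans[OF norm_inverse_transpose_power_le[OF det_A]] less_imp_le)
qed

lemma square_integrable_g: "square_integrable g"
proof -
  let ?m = "complex_of_real (gaussian_mass TYPE(real^'d))"
  let ?c = "ennreal (1 / (cmod ?m)\<^sup>2)"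
  let ?H = "\<lambda>k \<xi>. ennreal (indicator (cube pi) (C\<^sub>t k *v \<xi>) * (cmod (partial_product k \<xi>))\<^sup>2)"
  have [measurable]: "?H k \<in> borel_measurable lebesgue" for k
    by (intro borel_measurable_lebesgueI) measurable
  have integral_H: "(\<integral>\<^sup>+ \<xi>. ?c * ?H k \<xi> \<partial>lebesgue) = ?c * ennreal ((2 * pi) ^ CARD('d))" for k
    unfolding nn_integral_partial_product_cube[of k, symmetric] by (rule nn_integral_cmult) measurable
  have liminf: "liminf (\<lambda>k. ?c * ?H k \<xi>) = ennreal ((cmod (g \<xi>))\<^sup>2)" for \<xi>
  proof (rule lim_imp_Liminf[OF sequentially_bot Lim_transform_eventually])
    show "(\<lambda>k. ennreal ((cmod (partial_product k \<xi> / ?m))\<^sup>2)) \<longlonglongrightarrow> ennreal ((cmod (g \<xi>))\<^sup>2)"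
      by (intro tendsto_ennrealI tendsto_power tendsto_norm partial_product_tendsto_g)
    show "\<forall>\<^sub>F k in sequentially. ennreal ((cmod (partial_product k \<xi> / ?m))\<^sup>2) = ?c * ?H k \<xi>"
      using eventually_C\<^sub>t_in_cube[of \<xi>]
      by eventually_elim (simp add: norm_divide power_divide flip: ennreal_mult)
  qed
  have "(\<integral>\<^sup>+ \<xi>. ennreal ((cmod (g \<xi>))\<^sup>2) \<partial>lebesgue) \<le> liminf (\<lambda>k. \<integral>\<^sup>+ \<xi>. ?c * ?H k \<xi> \<partial>lebesgue)"
    unfolding liminf[symmetric] by (rule nn_integral_liminf) measurable
  also have "\<dots> < \<infinity>"
    unfolding integral_H by (simp add: Liminf_const flip: ennreal_mult)
  finally show ?thesis
    unfolding square_integrable_iff_nn_integral using borel_measurable_lebesgueI[OF measurable_g] by simp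
qed

abbreviation phi :: "real^'d \<Rightarrow> complex" where
  "phi \<equiv> phi_A N0 h A"

lemma square_integrable_phi: "square_integrable phi"
  unfolding phi_A_def by (rule inv_fourier_L2_spec(1)[OF measurable_g square_integrable_g])

lemma measurable_phi [measurable]: "phi \<in> borel_measurable lebesgue"
  using square_integrable_phi by (simp add: square_integrable_def)

lemma integral_partial_product:
  assumes v: "integrable lborel v"
  shows "(LINT s|lborel. partial_product k s * v s) = cascade k (\<lambda>p. LINT s|lborel. iexp (- (p \<bullet> s)) * v s)"
proof -
  have "(LINT s|lborel. partial_product k s * v s)
      = (LINT s|lborel. (\<Sum>m\<in>cascade_support k. cascade_weight k m * (iexp (- ((C k *v m) \<bullet> s)) * v s)))"
    unfolding partial_product_eq_cascade discrete_integral_def sum_distrib_right by (simp only: mult.assoc)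
  also have "\<dots> = (\<Sum>m\<in>cascade_support k. LINT s|lborel. cascade_weight k m * (iexp (- ((C k *v m) \<bullet> s)) * v s))"
    by (intro Bochner_Integration.integral_sum integrable_mult_right)
       (subst inner_commute, rule integrable_iexp_mult(2)[OF v])
  finally show ?thesis by (simp only: discrete_integral_def integral_mult_right_zero)
qed

lemma cascade_gaussian_tendsto:
  assumes r: "r > 0"
  shows "(\<lambda>k. cascade k (gaussian_at r x)) \<longlonglongrightarrow> (LINT t|lebesgue. phi t * gaussian_at r x t)"
proof -
  let ?v = "inv_fourier_int (gaussian_at r x)" and ?m = "complex_of_real (gaussian_mass TYPE(real^'d))"
  obtain K where K: "\<And>k \<xi>. cmod (partial_product k \<xi>) \<le> K" using partial_product_bounded by blast
  have v: "integrable lborel ?v" by (rule integrable_inv_fourier_int_gaussian_at[OF r])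
  have [measurable]: "?v \<in> borel_measurable borel" using v by auto
  have "(\<lambda>k. LINT s|lborel. partial_product k s / ?m * ?v s) \<longlonglongrightarrow> (LINT s|lborel. g s * ?v s)"
  proof (rule integral_dominated_convergence[where w="\<lambda>s. K / cmod ?m * cmod (?v s)"])
    show "integrable lborel (\<lambda>s. K / cmod ?m * cmod (?v s))"
      by (intro integrable_mult_right integrable_norm v)
    show "AE s in lborel. (\<lambda>k. partial_product k s / ?m * ?v s) \<longlonglongrightarrow> g s * ?v s"
      by (intro AE_I2 tendsto_mult[OF partial_product_tendsto_g tendsto_const])
    show "AE s in lborel. norm (partial_product k s / ?m * ?v s) \<le> K / cmod ?m * cmod (?v s)" for k
      unfolding norm_mult norm_divide by (intro AE_I2 mult_right_mono divide_right_mono K) simp_all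
  qed measurable
  moreover have "(LINT s|lborel. partial_product k s / ?m * ?v s) = cascade k (gaussian_at r x)" for k
  proof -
    have "(LINT s|lborel. partial_product k s / ?m * ?v s) = (LINT s|lborel. partial_product k s * ?v s) / ?m"
      by simp
    then show ?thesis
      unfolding integral_partial_product[OF v] Fourier_inversion_gaussian_at[OF r]
      using gaussian_mass_pos[where 'a="real^'d"]
      by (simp add: mult.commute[of ?m] discrete_integral_mult_right)
  qed
  moreover have "(LINT s|lborel. g s * ?v s) = (LINT t|lebesgue. phi t * gaussian_at r x t)"
    unfolding phi_A_def
    using inv_fourier_L2_pairing[OF measurable_g square_integrable_g integrable_gaussian_at[OF r]
        square_integrable_gaussian_at[OF r]]
    by (simp add: integral_lebesgue_borel)
  ultimately show ?thesis by simp
qed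

lemma cascade_tendsto:
  assumes "Cc u"
  shows "(\<lambda>k. cascade k u) \<longlonglongrightarrow> (LINT t|lebesgue. phi t * u t)"
proof -
  obtain K where "\<And>k. (\<Sum>m\<in>cascade_support k. cmod (cascade_weight k m)) \<le> K"
    using cascade_variation_bounded by blast
  then show ?thesis
    by (rule discrete_integral_tendsto_of_gaussian[OF square_integrable_phi assms _ cascade_gaussian_tendsto])
qed

lemma phi_pairing_eq_0:
  assumes "Cc u" "\<And>x. norm x \<le> support_radius \<Longrightarrow> u x = 0"
  shows "(LINT t|lebesgue. phi t * u t) = 0"
proof -
  have "cascade k u = cascade k (\<lambda>x. 0)" for k by (rule cascade_cong[OF assms(2)])
  then show ?thesis using cascade_tendsto[OF assms(1)] by (simp add: discrete_integral_def LIMSEQ_const_iff)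
qed

lemma phi_support: "AE t in lebesgue. norm t > support_radius \<longrightarrow> phi t = 0"
proof -
  let ?\<chi> = "\<lambda>t::real^'d. complex_of_real (min 1 (max 0 (norm t - support_radius)))"
  have cont: "continuous_on UNIV ?\<chi>" by (intro continuous_intros)
  have [measurable]: "?\<chi> \<in> borel_measurable lebesgue"
    by (intro borel_measurable_lebesgueI borel_measurable_continuous_onI cont)
  have "cmod (?\<chi> t) * cmod (phi t) \<le> 1 * cmod (phi t)" for t
    by (intro mult_right_mono) (simp_all add: abs_le_iff)
  then have "square_integrable (\<lambda>t. ?\<chi> t * phi t)"
    using square_integrable_phi
    by (intro square_integrable_bound[of _ "\<lambda>t. cmod (phi t)"]) (auto simp: square_integrable_def norm_mult)
  then have "AE t in lebesgue. ?\<chi> t * phi t = 0"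
  proof (rule Cc_integral_eq_0_imp_AE)
    fix u :: "real^'d \<Rightarrow> complex" assume "Cc u"
    then have "(LINT t|lebesgue. phi t * (?\<chi> t * u t)) = 0"
      by (intro phi_pairing_eq_0 Cc_mult_left[OF _ cont]) simp_all
    then show "(LINT t|lebesgue. ?\<chi> t * phi t * u t) = 0" by (simp only: mult_ac)
  qed
  then show ?thesis by eventually_elim (auto simp: min_def max_def split: if_splits)
qed

lemma phi_integral: "(LINT t|lebesgue. phi t) = 1"
proof -
  let ?u = "cutoff support_radius :: real^'d \<Rightarrow> complex"
  have "cascade k ?u = cascade k (\<lambda>x. 1)" for k by (rule cascade_cong) (simp add: cutoff_eq_1)
  then have "(LINT t|lebesgue. phi t * ?u t) = 1"
    using cascade_tendsto[OF Cc_cutoff, of support_radius] by (simp add: cascade_1 LIMSEQ_const_iff)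
  moreover have "(LINT t|lebesgue. phi t * ?u t) = (LINT t|lebesgue. phi t)"
  proof (rule integral_cong_AE)
    show "(\<lambda>t. phi t * ?u t) \<in> borel_measurable lebesgue"
      by (intro borel_measurable_times measurable_phi Cc_measurable_lebesgue[OF Cc_cutoff])
    show "AE t in lebesgue. phi t * ?u t = phi t"
      using phi_support
      by eventually_elim (metis cutoff_eq_1 linorder_not_less mult.right_neutral mult_zero_left)
  qed measurable
  ultimately show ?thesis by simp
qed

lemma integral_dil_transl_pairing:
  assumes "f \<in> borel_measurable lebesgue" "u \<in> borel_measurable lebesgue"
  shows "(LINT t|lebesgue. dil A (transl n f) t * u t)
    = (LINT t|lebesgue. f t * u (matrix_inv A *v (t + n))) / sqrt2"
proof -
  let ?F = "\<lambda>t. f t * u (matrix_inv A *v (t + n))"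
  have "det (matrix_inv A) \<noteq> 0" by (rule det_matrix_inv_nonzero[OF det_A])
  from measurable_compose[OF measurable_lebesgue_affine[OF this] assms(2), of "matrix_inv A *v n"]
  have "?F \<in> borel_measurable lebesgue"
    using assms(1) by (intro borel_measurable_times) (simp_all add: matrix_vector_right_distrib)
  from integral_affine[OF det_A this, of "- n"]
  have "(LINT t|lebesgue. f (A *v t - n) * u t) = (LINT t|lebesgue. ?F t) / 2"
    by (simp add: matrix_inv_invertible[OF det_A] abs_det scaleR_conv_of_real)
  moreover have "sqrt2 * (z / 2) = z / sqrt2" for z
    by (simp add: field_simps flip: of_real_mult)
  moreover have "(LINT t|lebesgue. dil A (transl n f) t * u t)
      = sqrt2 * (LINT t|lebesgue. f (A *v t - n) * u t)"
    unfolding dil_def transl_def mult.assoc by (rule integral_mult_right_zero)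
  ultimately show ?thesis by (simp only:)
qed

lemma phi_refinement: "AE t in lebesgue. phi t = (\<Sum>n\<in>\<Lambda>. h n * dil A (transl n phi) t)"
proof -
  let ?r = "\<lambda>t. \<Sum>n\<in>\<Lambda>. h n * dil A (transl n phi) t"
  have dil_sq: "square_integrable (dil A (transl n phi))" for n
    by (intro square_integrable_dil[OF det_A] square_integrable_transl square_integrable_phi)
  have r_sq: "square_integrable ?r" by (intro square_integrable_sum square_integrable_cmult dil_sq)
  have "AE t in lebesgue. phi t - ?r t = 0"
  proof (rule Cc_integral_eq_0_imp_AE[OF square_integrable_diff[OF square_integrable_phi r_sq]])
    fix u :: "real^'d \<Rightarrow> complex" assume u: "Cc u"
    have u_sq: "square_integrable u" by (rule Cc_square_integrable[OF u])
    have "Cc (\<lambda>x. u (matrix_inv A *v (x + n)))" for n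
      using Cc_translate[OF Cc_linear_compose[OF u det_matrix_inv_nonzero[OF det_A], of 1], of n] by simp
    then have "(\<lambda>k. cascade (Suc k) u)
        \<longlonglongrightarrow> (\<Sum>n\<in>\<Lambda>. h n / sqrt2 * (LINT t|lebesgue. phi t * u (matrix_inv A *v (t + n))))"
      unfolding cascade_Suc' by (intro tendsto_sum tendsto_mult tendsto_const cascade_tendsto)
    from LIMSEQ_unique[OF LIMSEQ_Suc[OF cascade_tendsto[OF u]] this]
    have "(LINT t|lebesgue. phi t * u t) = (\<Sum>n\<in>\<Lambda>. LINT t|lebesgue. h n * (dil A (transl n phi) t * u t))"
      by (simp add: integral_dil_transl_pairing Cc_measurable_lebesgue[OF u])
    also have "\<dots> = (LINT t|lebesgue. (\<Sum>n\<in>\<Lambda>. h n * (dil A (transl n phi) t * u t)))"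
      by (intro Bochner_Integration.integral_sum[symmetric] integrable_mult_right
          square_integrable_mult_integrable dil_sq u_sq)
    also have "\<dots> = (LINT t|lebesgue. ?r t * u t)" by (simp only: sum_distrib_right mult.assoc)
    finally show "(LINT t|lebesgue. (phi t - ?r t) * u t) = 0"
      using square_integrable_mult_integrable[OF square_integrable_phi u_sq]
        square_integrable_mult_integrable[OF r_sq u_sq]
      by (simp add: left_diff_distrib)
  qed
  then show ?thesis by eventually_elim simp
qed

end

section \<open>Unimodular changes of the lattice\<close>

lemma Ints_det:
  fixes M :: "real^'n::finite^'n"
  assumes "\<And>i j. M $ i $ j \<in> \<int>"
  shows "det M \<in> \<int>"
  unfolding det_def using assms by (intro Ints_sum Ints_mult Ints_prod Ints_of_int) auto

lemma Zd_unimodular_inverse: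
  fixes S :: "real^'d::finite^'d"
  assumes "integral_matrix S" "\<bar>det S\<bar> = 1" "x \<in> Zd"
  shows "matrix_inv S *v x \<in> Zd"
proof -
  have det: "det S \<noteq> 0" using assms(2) by auto
  let ?M = "\<lambda>k. (\<chi> i j. if j = k then x $ i else S $ i $ j) :: real^'d^'d"
  have "matrix_inv S *v x = (\<chi> k. det (?M k) / det S)"
    using cramer[OF det, of "matrix_inv S *v x" x] by (simp add: matrix_inv_invertible[OF det])
  moreover have "det (?M k) \<in> \<int>" for k
    using assms(1,3) by (intro Ints_det) (simp add: Zd_def integral_matrix_def)
  ultimately show ?thesis using assms(2) by (auto simp: Zd_def abs_if split: if_splits)
qed

locale unimodular_conjugacy =
  fixes S A A0 :: "real^'d::finite^'d"
  assumes S_int: "integral_matrix S" and abs_det_S: "\<bar>det S\<bar> = 1"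
    and intertwining: "S ** A0 = A ** S" and det_A0: "det A0 \<noteq> 0"
begin

lemma det_S: "det S \<noteq> 0"
  using abs_det_S by auto

lemmas S_inv = matrix_inv_invertible[OF det_S]

lemma det_A_eq: "det A = det A0"
  using arg_cong[OF intertwining, of det] det_S by (simp add: det_mul)

lemma det_A: "det A \<noteq> 0"
  using det_A0 by (simp add: det_A_eq)

lemma S_A0: "S *v (A0 *v x) = A *v (S *v x)"
  by (simp add: matrix_vector_mul_assoc intertwining)

lemma S_inverse_A0: "S *v (matrix_inv A0 *v x) = matrix_inv A *v (S *v x)"
proof -
  have "S *v (matrix_inv A0 *v x) = matrix_inv A *v (S *v (A0 *v (matrix_inv A0 *v x)))"
    by (simp only: S_A0 matrix_inv_invertible[OF det_A])
  then show ?thesis by (simp only: matrix_inv_invertible[OF det_A0])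
qed

lemma bij_S_Zd: "bij_betw ((*v) S) Zd Zd"
  by (rule bij_betw_byWitness[where f'="(*v) (matrix_inv S)"])
     (auto simp: S_inv intro: Zd_integral_matrix[OF S_int] Zd_unimodular_inverse[OF S_int abs_det_S])

definition pullback :: "(real^'d \<Rightarrow> complex) \<Rightarrow> real^'d \<Rightarrow> complex" where
  "pullback f = (\<lambda>t. f (S *v t))"

lemma pullback_inverse: "pullback (\<lambda>t. f (matrix_inv S *v t)) = f"
  by (simp add: pullback_def S_inv)

lemma transl_pullback: "transl l (pullback f) = pullback (transl (S *v l) f)"
  by (simp add: pullback_def transl_def matrix_vector_mult_diff_distrib)

lemma dil_pullback: "dil A0 (pullback f) = pullback (dil A f)"
  and dil_inv_pullback: "dil_inv A0 (pullback f) = pullback (dil_inv A f)"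
  by (simp_all add: pullback_def dil_def dil_inv_def S_A0 S_inverse_A0)

lemma dil_pow_pullback: "dil_pow A0 n (pullback f) = pullback (dil_pow A n f)"
proof -
  have "(dil A0 ^^ k) (pullback f) = pullback ((dil A ^^ k) f)"
    and "(dil_inv A0 ^^ k) (pullback f) = pullback ((dil_inv A ^^ k) f)" for k
    by (induction k) (simp_all add: dil_pullback dil_inv_pullback)
  then show ?thesis by (simp add: dil_pow_def)
qed

lemma dil_transl_pullback: "dil A0 (transl (matrix_inv S *v n) (pullback f)) t = dil A (transl n f) (S *v t)"
  unfolding transl_pullback dil_pullback S_inv by (simp add: pullback_def)

lemma square_integrable_pullback: "square_integrable f \<Longrightarrow> square_integrable (pullback f)"
  and L2_norm_sq_pullback: "square_integrable f \<Longrightarrow> L2_norm_sq (pullback f) = L2_norm_sq f"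
  using square_integrable_affine[OF det_S, of f 0] by (simp_all add: pullback_def abs_det_S)

lemma pullback_cases:
  assumes "square_integrable f"
  obtains f' where "square_integrable f'" "f = pullback f'"
proof
  show "square_integrable (\<lambda>t. f (matrix_inv S *v t))"
    using square_integrable_affine(1)[OF det_matrix_inv_nonzero[OF det_S] assms, of 0] by simp
qed (simp add: pullback_inverse)

lemma L2_inner_pullback:
  assumes "square_integrable f" "square_integrable g"
  shows "L2_inner (pullback f) (pullback g) = L2_inner f g"
  unfolding L2_inner_def pullback_def
  using integral_affine[OF det_S borel_measurable_integrable[OF
      square_integrable_mult_integrable[OF assms(1) square_integrable_cnj[OF assms(2)]]], of 0]
  by (simp add: abs_det_S)

lemma L2_dist_sq_pullback:
  assumes "square_integrable f" "square_integrable g"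
  shows "L2_dist_sq (pullback f) (pullback g) = L2_dist_sq f g"
proof -
  have "L2_norm (\<lambda>t. pullback f t - pullback g t) = L2_norm (\<lambda>t. f t - g t)"
    using L2_norm_sq_pullback[OF square_integrable_diff[OF assms]] by (simp add: pullback_def L2_norm_def)
  then show ?thesis by (simp add: L2_dist_sq_eq square_integrable_pullback assms)
qed

lemma parseval_frame_wavelet_pullback:
  assumes psi: "parseval_frame_wavelet A psi"
  shows "parseval_frame_wavelet A0 (pullback psi)"
  unfolding parseval_frame_wavelet_def
proof (intro conjI allI impI)
  have psi_sq: "square_integrable psi" using psi by (simp add: parseval_frame_wavelet_def)
  then show "square_integrable (pullback psi)" by (rule square_integrable_pullback)
  fix f :: "real^'d \<Rightarrow> complex" assume "square_integrable f"
  then obtain f' where f': "square_integrable f'" "f = pullback f'" by (rule pullback_cases)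
  let ?e = "\<lambda>(n, l). (cmod (L2_inner f' (dil_pow A n (transl l psi))))\<^sup>2"
  have sq: "square_integrable (dil_pow A n (transl l psi))" for n l
    by (intro square_integrable_dil_pow square_integrable_transl det_A psi_sq)
  have "(?e has_sum L2_norm_sq f) (UNIV \<times> Zd)"
    using psi f' by (simp add: parseval_frame_wavelet_def L2_norm_sq_pullback)
  then have "((\<lambda>p. ?e (map_prod id ((*v) S) p)) has_sum L2_norm_sq f) (UNIV \<times> Zd)"
    by (subst has_sum_reindex_bij_betw[OF bij_betw_map_prod[OF bij_betw_id bij_S_Zd]])
  then show "((\<lambda>(n, l). (cmod (L2_inner f (dil_pow A0 n (transl l (pullback psi)))))\<^sup>2)
      has_sum L2_norm_sq f) (UNIV \<times> Zd)"
    by (simp add: f'(2) transl_pullback dil_pow_pullback L2_inner_pullback f'(1) sq case_prod_unfold)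
qed

lemma translation_span_pullback: "translation_span (pullback f) = pullback ` translation_span f"
proof (intro equalityI subsetI)
  fix x assume "x \<in> translation_span (pullback f)"
  then obtain F c where F: "finite F" "F \<subseteq> Zd" and x: "x = (\<lambda>t. \<Sum>l\<in>F. c l * transl l (pullback f) t)"
    unfolding translation_span_def by blast
  have "x = pullback (\<lambda>t. \<Sum>l\<in>F. c l * transl (S *v l) f t)"
    unfolding x transl_pullback by (simp add: pullback_def)
  moreover have "(\<lambda>t. \<Sum>l\<in>F. c l * transl (S *v l) f t) \<in> translation_span f"
    using F Zd_integral_matrix[OF S_int] by (intro sum_transl_in_translation_span) auto
  ultimately show "x \<in> pullback ` translation_span f" by blast
next
  fix x assume "x \<in> pullback ` translation_span f"
  then obtain F c where F: "finite F" "F \<subseteq> Zd" and x: "x = pullback (\<lambda>t. \<Sum>l\<in>F. c l * transl l f t)"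
    unfolding translation_span_def by blast
  have "x = (\<lambda>t. \<Sum>l\<in>F. c l * transl (matrix_inv S *v l) (pullback f) t)"
    unfolding x transl_pullback S_inv by (simp add: pullback_def)
  then show "x \<in> translation_span (pullback f)"
    using F Zd_unimodular_inverse[OF S_int abs_det_S] by (auto intro!: sum_transl_in_translation_span)
qed

lemma L2_closure_pullback:
  assumes X: "\<And>x. x \<in> X \<Longrightarrow> square_integrable x"
  shows "L2_closure (pullback ` X) = pullback ` L2_closure X"
proof (intro equalityI subsetI)
  fix y assume y: "y \<in> L2_closure (pullback ` X)"
  then have "square_integrable y" by (simp add: L2_closure_def)
  then obtain y' where y': "square_integrable y'" "y = pullback y'" by (rule pullback_cases)
  have "y' \<in> L2_closure X"
    using y y'(1) by (rule L2_closure_map) (auto simp: y'(2) L2_dist_sq_pullback X y'(1))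
  then show "y \<in> pullback ` L2_closure X" using y'(2) by blast
next
  fix y assume "y \<in> pullback ` L2_closure X"
  then obtain y' where y': "y' \<in> L2_closure X" "y = pullback y'" by blast
  then have y'_sq: "square_integrable y'" by (simp add: L2_closure_def)
  show "y \<in> L2_closure (pullback ` X)"
    using y'(1)
    by (rule L2_closure_map) (auto simp: y'(2) L2_dist_sq_pullback X y'_sq square_integrable_pullback)
qed

lemma Vn_pullback:
  assumes "square_integrable f"
  shows "Vn A0 n (pullback f) = pullback ` Vn A n f"
proof -
  have "V0 (pullback f) = pullback ` V0 f"
    unfolding V0_eq_L2_closure translation_span_pullback
    by (rule L2_closure_pullback) (rule translation_span_square_integrable[OF assms])
  then show ?thesis by (simp add: Vn_def image_image dil_pow_pullback)
qed

lemma Vn_dense_pullback: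
  assumes f: "square_integrable f" and dense: "L2_closure (\<Union>n::int. Vn A n f) = {g. square_integrable g}"
  shows "L2_closure (\<Union>n::int. Vn A0 n (pullback f)) = {g. square_integrable g}"
proof -
  have "square_integrable x" if "x \<in> Vn A n f" for n x
    using that unfolding Vn_def V0_eq_L2_closure
    by (auto simp: L2_closure_def intro: square_integrable_dil_pow[OF det_A])
  then have "L2_closure (\<Union>n::int. Vn A0 n (pullback f)) = pullback ` {g. square_integrable g}"
    unfolding Vn_pullback[OF f] image_UN[symmetric] dense[symmetric] by (intro L2_closure_pullback) blast
  also have "\<dots> = {g. square_integrable g}"
    by (auto intro: square_integrable_pullback elim: pullback_cases)
  finally show ?thesis .
qed

end

section \<open>The filter bank\<close>

lemma sum_finite_support_reindex:
  assumes "inj_on g Z" "finite K" "K \<subseteq> Z" "finite Y"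
    and "\<And>l. l \<in> Z \<Longrightarrow> f (g l) \<noteq> 0 \<Longrightarrow> l \<in> K" "\<And>y. f y \<noteq> 0 \<Longrightarrow> y \<in> Y"
  shows "(\<Sum>l\<in>K. f (g l)) = (\<Sum>y\<in>Y \<inter> g ` Z. f y)"
proof -
  have "(\<Sum>l\<in>K. f (g l)) = (\<Sum>y\<in>g ` K. f y)"
    using sum.reindex[OF inj_on_subset[OF assms(1,3)], of f] by simp
  also have "\<dots> = (\<Sum>y\<in>Y \<inter> g ` Z. f y)"
    using assms(2-6) by (intro sum.mono_neutral_cong) auto
  finally show ?thesis .
qed

locale mirror_filter_bank = mask A h N0 for A :: "real^'d::finite^'d" and h N0 +
  fixes lA qA :: "real^'d"
  assumes lA_Z: "lA \<in> Zd" and qA_Z: "qA \<in> Zd"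
    and cosets: "Zd = (\<lambda>v. lA + v) ` ((*v) A ` Zd) \<union> (*v) A ` Zd"
    and q_even: "\<And>v. v \<in> (*v) A ` Zd \<Longrightarrow> \<exists>k::int. qA \<bullet> v = 2 * of_int k"
    and q_odd: "\<And>v. v \<in> (\<lambda>v. lA + v) ` ((*v) A ` Zd) \<Longrightarrow> \<exists>k::int. qA \<bullet> v = 2 * of_int k + 1"
    and complementary: "\<And>m n. m \<in> (*v) A ` Zd \<Longrightarrow> n \<in> Zd \<Longrightarrow>
          Zd = (\<lambda>a. n - a) ` ((*v) A ` Zd) \<union> (\<lambda>a. lA - m - n + a) ` ((*v) A ` Zd) \<and>
          (\<lambda>a. n - a) ` ((*v) A ` Zd) \<inter> (\<lambda>a. lA - m - n + a) ` ((*v) A ` Zd) = {}"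
    and coinciding: "\<And>m n. m \<in> (\<lambda>v. lA + v) ` ((*v) A ` Zd) \<Longrightarrow> n \<in> Zd \<Longrightarrow>
          (\<lambda>a. n - a) ` ((*v) A ` Zd) = (\<lambda>a. lA - m - n + a) ` ((*v) A ` Zd)"
begin

definition high_pass :: "real^'d \<Rightarrow> complex" where
  "high_pass n = (-1) powi \<lfloor>qA \<bullet> n\<rfloor> * cnj (h (lA - n))"

definition \<Lambda>\<^sub>h :: "(real^'d) set" where
  "\<Lambda>\<^sub>h = {n \<in> Zd. lA - n \<in> \<Lambda>}"

lemma A_Zd: "x \<in> Zd \<Longrightarrow> A *v x \<in> Zd"
  by (rule Zd_integral_matrix[OF A_int])

lemma inj_A: "A *v x = A *v y \<longleftrightarrow> x = y"
  by (metis matrix_inv_invertible(4)[OF det_A])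

lemma finite_\<Lambda>\<^sub>h: "finite \<Lambda>\<^sub>h"
proof -
  have "\<Lambda>\<^sub>h \<subseteq> (\<lambda>n. lA - n) ` \<Lambda>"
  proof
    fix n assume "n \<in> \<Lambda>\<^sub>h"
    then show "n \<in> (\<lambda>n. lA - n) ` \<Lambda>"
      by (intro image_eqI[where x="lA - n"]) (auto simp: \<Lambda>\<^sub>h_def)
  qed
  then show ?thesis by (rule finite_subset) (intro finite_imageI finite_Lambda0)
qed

lemma mem_\<Lambda>\<^sub>h_iff: "n \<in> \<Lambda>\<^sub>h \<longleftrightarrow> lA - n \<in> \<Lambda>"
proof
  assume "lA - n \<in> \<Lambda>"
  moreover from this have "n \<in> Zd" using Zd_diff[OF lA_Z, of "lA - n"] Lambda0_Zd by auto
  ultimately show "n \<in> \<Lambda>\<^sub>h" by (simp add: \<Lambda>\<^sub>h_def)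
qed (simp add: \<Lambda>\<^sub>h_def)

lemma high_pass_support: "n \<notin> \<Lambda>\<^sub>h \<Longrightarrow> high_pass n = 0"
  by (simp add: high_pass_def mem_\<Lambda>\<^sub>h_iff h_supp)

lemma high_pass_mult:
  assumes n: "n \<in> Zd" and k: "qA \<bullet> k = of_int c"
  shows "high_pass n * cnj (high_pass (n + k)) = (-1) powi c * (h (lA - (n + k)) * cnj (h (lA - n)))"
proof -
  have "qA \<bullet> n \<in> \<int>"
    unfolding inner_vec_def using n qA_Z by (intro Ints_sum) (auto simp: Zd_def)
  then obtain i where i: "qA \<bullet> n = of_int i" by (elim Ints_cases)
  then have floor: "\<lfloor>qA \<bullet> (n + k)\<rfloor> = i + c" by (simp add: inner_add_right k flip: of_int_add)
  have "(-1) powi i * (-1) powi (i + c) = ((-1) powi c :: complex)"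
    by (simp add: power_int_minus_left)
  moreover have "high_pass n * cnj (high_pass (n + k))
      = ((-1) powi i * (-1) powi (i + c)) * (h (lA - (n + k)) * cnj (h (lA - n)))"
    unfolding high_pass_def floor i floor_of_int by (simp add: power_int_minus_left)
  ultimately show ?thesis by simp
qed

definition low_coset :: "real^'d \<Rightarrow> (real^'d) set" where
  "low_coset p = (\<lambda>a. p - a) ` ((*v) A ` Zd)"

definition high_coset :: "real^'d \<Rightarrow> real^'d \<Rightarrow> (real^'d) set" where
  "high_coset k p = (\<lambda>a. lA - k - p + a) ` ((*v) A ` Zd)"

definition correlation :: "real^'d \<Rightarrow> real^'d \<Rightarrow> complex" where
  "correlation k y = h y * cnj (h (y + k))"

lemma correlation_support: "correlation k y \<noteq> 0 \<Longrightarrow> y \<in> \<Lambda>"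
  using h_supp by (auto simp: correlation_def)

lemma sum_low_pass:
  assumes K: "finite K" "K \<subseteq> Zd" and K_support: "{l\<in>Zd. p - A *v l \<in> \<Lambda>} \<subseteq> K"
  shows "(\<Sum>l\<in>K. h (p - A *v l) * cnj (h (q - A *v l)))
    = (\<Sum>y\<in>\<Lambda> \<inter> low_coset p. correlation (q - p) y)"
proof -
  have "h (p - A *v l) * cnj (h (q - A *v l)) = correlation (q - p) (p - A *v l)" for l
    by (simp add: correlation_def)
  moreover have "(\<Sum>l\<in>K. correlation (q - p) (p - A *v l))
      = (\<Sum>y\<in>\<Lambda> \<inter> (\<lambda>l. p - A *v l) ` Zd. correlation (q - p) y)"
    using K_support correlation_support
    by (intro sum_finite_support_reindex K finite_Lambda0) (auto simp: inj_on_def inj_A)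
  ultimately show ?thesis by (simp add: low_coset_def image_image)
qed

lemma sum_high_pass:
  assumes p: "p \<in> Zd" and c: "qA \<bullet> (q - p) = of_int c"
    and K: "finite K" "K \<subseteq> Zd" and K_support: "{l\<in>Zd. p - A *v l \<in> \<Lambda>\<^sub>h} \<subseteq> K"
  shows "(\<Sum>l\<in>K. high_pass (p - A *v l) * cnj (high_pass (q - A *v l)))
    = (-1) powi c * (\<Sum>y\<in>\<Lambda> \<inter> high_coset (q - p) p. correlation (q - p) y)"
proof -
  let ?g = "\<lambda>l. lA - (q - p) - p + A *v l"
  have "high_pass (p - A *v l) * cnj (high_pass (q - A *v l)) = (-1) powi c * correlation (q - p) (?g l)"
    if "l \<in> Zd" for l
    using high_pass_mult[OF Zd_diff[OF p A_Zd[OF that]] c] by (simp add: correlation_def algebra_simps)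
  then have "(\<Sum>l\<in>K. high_pass (p - A *v l) * cnj (high_pass (q - A *v l)))
      = (\<Sum>l\<in>K. (-1) powi c * correlation (q - p) (?g l))"
    using K(2) by (intro sum.cong) auto
  also have "(\<Sum>l\<in>K. (-1) powi c * correlation (q - p) (?g l))
      = (-1) powi c * (\<Sum>l\<in>K. correlation (q - p) (?g l))"
    by (rule sum_distrib_left[symmetric])
  also have "(\<Sum>l\<in>K. correlation (q - p) (?g l)) = (\<Sum>y\<in>\<Lambda> \<inter> ?g ` Zd. correlation (q - p) y)"
  proof (rule sum_finite_support_reindex[OF _ K finite_Lambda0 _ correlation_support])
    show "inj_on ?g Zd" by (auto simp: inj_on_def inj_A)
    fix l assume l: "l \<in> Zd" "correlation (q - p) (?g l) \<noteq> 0"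
    then have "h (lA - (p - A *v l)) \<noteq> 0" by (auto simp: correlation_def algebra_simps)
    then show "l \<in> K" using h_supp l(1) K_support by (auto simp: mem_\<Lambda>\<^sub>h_iff)
  qed
  finally show ?thesis by (simp add: high_coset_def image_image)
qed

lemma sum_filter_bank:
  assumes p: "p \<in> Zd" and c: "qA \<bullet> (q - p) = of_int c"
    and K: "finite K" "K \<subseteq> Zd" "{l\<in>Zd. p - A *v l \<in> \<Lambda> \<union> \<Lambda>\<^sub>h} \<subseteq> K"
  shows "(\<Sum>l\<in>K. h (p - A *v l) * cnj (h (q - A *v l)) + high_pass (p - A *v l) * cnj (high_pass (q - A *v l)))
    = (\<Sum>y\<in>\<Lambda> \<inter> low_coset p. correlation (q - p) y)
      + (-1) powi c * (\<Sum>y\<in>\<Lambda> \<inter> high_coset (q - p) p. correlation (q - p) y)"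
proof -
  have "{l\<in>Zd. p - A *v l \<in> \<Lambda>} \<subseteq> K" "{l\<in>Zd. p - A *v l \<in> \<Lambda>\<^sub>h} \<subseteq> K" using K(3) by blast+
  then show ?thesis
    unfolding sum.distrib by (intro arg_cong2[where f="(+)"] sum_low_pass sum_high_pass p c K(1,2))
qed

text \<open>If \<open>q - p \<in> A \<int>\<^sup>d\<close>, the two cosets partition the lattice and the sum is the orthogonality
  relation; otherwise they coincide and the signs cancel.\<close>

lemma perfect_reconstruction:
  assumes p: "p \<in> Zd" and q: "q \<in> Zd" and K: "finite K" "K \<subseteq> Zd" "{l\<in>Zd. p - A *v l \<in> \<Lambda> \<union> \<Lambda>\<^sub>h} \<subseteq> K"
  shows "(\<Sum>l\<in>K. h (p - A *v l) * cnj (h (q - A *v l)) + high_pass (p - A *v l) * cnj (high_pass (q - A *v l)))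
    = of_bool (p = q)"
proof -
  let ?k = "q - p" and ?Z = "(*v) A ` Zd"
  have "?k \<in> ?Z \<or> ?k \<in> (\<lambda>v. lA + v) ` ?Z" using cosets Zd_diff[OF q p] by blast
  then show ?thesis
  proof
    assume k: "?k \<in> ?Z"
    obtain j where "qA \<bullet> ?k = 2 * of_int j" using q_even[OF k] by blast
    then have even: "qA \<bullet> ?k = of_int (2 * j)" by simp
    have "Zd = low_coset p \<union> high_coset ?k p" "low_coset p \<inter> high_coset ?k p = {}"
      unfolding low_coset_def high_coset_def using complementary[OF k p] by blast+
    then have "\<Lambda> = (\<Lambda> \<inter> low_coset p) \<union> (\<Lambda> \<inter> high_coset ?k p)"
      and "(\<Lambda> \<inter> low_coset p) \<inter> (\<Lambda> \<inter> high_coset ?k p) = {}"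
      using Lambda0_Zd[of N0] by blast+
    then have "(\<Sum>y\<in>\<Lambda> \<inter> low_coset p. correlation ?k y) + (\<Sum>y\<in>\<Lambda> \<inter> high_coset ?k p. correlation ?k y)
        = (\<Sum>y\<in>\<Lambda>. correlation ?k y)"
      by (metis finite_Int finite_Lambda0 sum.union_disjoint)
    also have "\<dots> = of_bool (p = q)" unfolding correlation_def using h_orth[OF k] by auto
    finally show ?thesis unfolding sum_filter_bank[OF p even K] by (simp add: power_int_minus_left)
  next
    assume k: "?k \<in> (\<lambda>v. lA + v) ` ?Z"
    obtain j where "qA \<bullet> ?k = 2 * of_int j + 1" using q_odd[OF k] by blast
    then have odd: "qA \<bullet> ?k = of_int (2 * j + 1)" by simp
    have "p \<noteq> q"
    proof
      assume "p = q"
      with odd have "2 * j + 1 = 0" by (simp only: diff_self inner_zero_right of_int_0_eq_iff eq_commute[of 0])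
      then show False by presburger
    qed
    moreover have "low_coset p = high_coset ?k p"
      unfolding low_coset_def high_coset_def by (rule coinciding[OF k p])
    ultimately show ?thesis unfolding sum_filter_bank[OF p odd K] by (simp add: power_int_minus_left)
  qed
qed

abbreviation psi :: "real^'d \<Rightarrow> complex" where
  "psi \<equiv> psi_A N0 h A lA qA"

lemma psi_eq_sum: "psi t = (\<Sum>n\<in>\<Lambda>\<^sub>h. high_pass n * dil A (transl n phi) t)"
  unfolding psi_A_def high_pass_def[symmetric]
  by (rule infsum_finite_support(1)) (auto simp: finite_\<Lambda>\<^sub>h high_pass_support, simp add: \<Lambda>\<^sub>h_def)

sublocale pair: refinable_pair A h high_pass "\<Lambda> \<union> \<Lambda>\<^sub>h" phi psi support_radius
proof
  show "AE t in lebesgue. phi t = (\<Sum>n\<in>\<Lambda> \<union> \<Lambda>\<^sub>h. h n * dil A (transl n phi) t)"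
    using phi_refinement
  proof eventually_elim
    case (elim t)
    show ?case unfolding elim
      by (rule sum.mono_neutral_left) (auto simp: finite_Lambda0 finite_\<Lambda>\<^sub>h h_supp)
  qed
  have "psi t = (\<Sum>n\<in>\<Lambda> \<union> \<Lambda>\<^sub>h. high_pass n * dil A (transl n phi) t)" for t
    unfolding psi_eq_sum
    by (rule sum.mono_neutral_left) (auto simp: finite_Lambda0 finite_\<Lambda>\<^sub>h high_pass_support)
  then show "AE t in lebesgue. psi t = (\<Sum>n\<in>\<Lambda> \<union> \<Lambda>\<^sub>h. high_pass n * dil A (transl n phi) t)" by simp
  show "\<Lambda> \<union> \<Lambda>\<^sub>h \<subseteq> Zd" using Lambda0_Zd by (auto simp: \<Lambda>\<^sub>h_def)
qed ((rule perfect_reconstruction; assumption) |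
    simp add: abs_det decay A_Zd finite_Lambda0 finite_\<Lambda>\<^sub>h h_supp high_pass_support
      square_integrable_phi phi_support phi_integral support_radius_nonneg)+

end

theorem theorem10p1:
  fixes A0 S A :: "real^'d::finite^'d"
    and lA qA :: "real^'d"
    and h :: "real^'d \<Rightarrow> complex"
    and N0 :: nat
  assumes A0_int: "integral_matrix A0" and A0_exp: "expansive A0"
    and A0_det: "det A0 = 2 \<or> det A0 = -2"
    and S_int: "integral_matrix S" and S_det: "det S = 1 \<or> det S = -1"
    and A_int: "integral_matrix A"
    and sim: "A0 = matrix_inv S ** A ** S"
    and AT: "(*v) A ` Zd = (*v) (transpose A) ` Zd"
    and lA_Z: "lA \<in> Zd" and qA_Z: "qA \<in> Zd"
    and part: "Zd = (\<lambda>v. lA + v) ` ((*v) A ` Zd) \<union> (*v) A ` Zd"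
              "(\<lambda>v. lA + v) ` ((*v) A ` Zd) \<inter> (*v) A ` Zd = {}"
    and q_even: "\<forall>v\<in>(*v) A ` Zd. \<exists>k::int. qA \<bullet> v = 2 * of_int k"
    and q_odd: "\<forall>v\<in>(\<lambda>v. lA + v) ` ((*v) A ` Zd). \<exists>k::int. qA \<bullet> v = 2 * of_int k + 1"
    and cond_even: "\<forall>m\<in>(*v) A ` Zd. \<forall>n\<in>Zd.
          Zd = (\<lambda>a. n - a) ` ((*v) A ` Zd) \<union> (\<lambda>a. lA - m - n + a) ` ((*v) A ` Zd) \<and>
          (\<lambda>a. n - a) ` ((*v) A ` Zd) \<inter> (\<lambda>a. lA - m - n + a) ` ((*v) A ` Zd) = {}"
    and cond_odd: "\<forall>m\<in>(\<lambda>v. lA + v) ` ((*v) A ` Zd). \<forall>n\<in>Zd.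
          (\<lambda>a. n - a) ` ((*v) A ` Zd) = (\<lambda>a. lA - m - n + a) ` ((*v) A ` Zd)"
    and h_supp: "\<forall>n. n \<notin> Lambda0 N0 \<longrightarrow> h n = 0"
    and h_orth: "\<forall>k\<in>(*v) A ` Zd.
          (\<Sum>n\<in>Lambda0 N0. h n * cnj (h (n + k))) = (if k = 0 then 1 else 0)"
    and h_sum: "(\<Sum>n\<in>Lambda0 N0. h n) = complex_of_real (sqrt 2)"
  defines "phiA0 \<equiv> (\<lambda>t. phi_A N0 h A (S *v t))"
    and "psiA0 \<equiv> (\<lambda>t. psi_A N0 h A lA qA (S *v t))"
  shows "parseval_frame_wavelet A0 psiA0 \<and>
    (AE t in lebesgue. phiA0 t =
           (\<Sum>n\<in>Lambda0 N0. h n * dil A0 (transl (matrix_inv S *v n) phiA0) t)) \<and>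
    (AE t in lebesgue. psiA0 t =
           (\<Sum>n\<in>{n\<in>Zd. lA - n \<in> Lambda0 N0}. (-1) powi \<lfloor>qA \<bullet> n\<rfloor> * cnj (h (lA - n)) *
              dil A0 (transl (matrix_inv S *v n) phiA0) t)) \<and>
    (\<forall>n::int. Vn A0 n phiA0 \<subseteq> Vn A0 (n + 1) phiA0) \<and>
    L2_closure (\<Union>n::int. Vn A0 n phiA0) = {f. square_integrable f}"
proof -
  have abs_det_A0: "\<bar>det A0\<bar> = 2" and abs_det_S: "\<bar>det S\<bar> = 1" and "det S \<noteq> 0" using A0_det S_det by auto
  then have SA0: "S ** A0 = A ** S" unfolding sim by (simp add: matrix_mul_assoc matrix_inv_invertible)
  interpret unimodular_conjugacy S A A0
    using S_int abs_det_S SA0 abs_det_A0 by unfold_locales auto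
  have abs_det_A: "\<bar>det A\<bar> = 2" using abs_det_A0 by (simp add: det_A_eq)
  note decay = summable_onorm_inverse_powers[OF expansive_similar[OF A0_exp det_S SA0] det_A]
  interpret mirror_filter_bank A h N0 lA qA
    by unfold_locales (fact A_int abs_det_A decay h_supp[rule_format] h_orth[folded of_bool_def, rule_format] h_sum
      lA_Z qA_Z part(1) q_even[rule_format] q_odd[rule_format] cond_even[rule_format] cond_odd[rule_format])+
  have pullbacks: "phiA0 = pullback phi" "psiA0 = pullback psi"
    by (simp_all add: phiA0_def psiA0_def pullback_def)
  have "AE t in lebesgue. pullback phi t = (\<Sum>n\<in>\<Lambda>. h n * dil A (transl n phi) (S *v t))"
    using AE_affine[OF det_S phi_refinement, of 0] by (simp add: pullback_def)
  moreover have "pullback psi t = (\<Sum>n\<in>\<Lambda>\<^sub>h. high_pass n * dil A (transl n phi) (S *v t))" for t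
    by (simp add: pullback_def psi_eq_sum)
  ultimately show ?thesis
    unfolding pullbacks dil_transl_pullback high_pass_def[symmetric] \<Lambda>\<^sub>h_def[symmetric]
    using parseval_frame_wavelet_pullback[OF pair.parseval_psi] Vn_pullback[OF square_integrable_phi] pair.Vn_nested
      Vn_dense_pullback[OF square_integrable_phi pair.Vn_dense] by (simp add: image_mono)
qed

end
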